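(* Let $\Phi=\bigl((X_n)_{n=0}^{\infty},(\varphi_n)_{n=0}^{\infty},(C_n)_{n=0}^{\infty}\bigr)$ be a non-autonomous system. Let $(\varepsilon_n)_{n=0}^\infty$ be a sequence of positive real numbers and let $(M_n)_{n=0}^\infty$ be a sequence of non-negative integers. Then there is a sequence $(\delta_j)_{j=1}^\infty$ of functions $$\delta_j\colon \Delta_{j-1}(\Phi)\times\mathcal{U}_{j-1}(\Phi)\to(0,\infty)$$ with the following property. Suppose that $\mathcal{T}=(f_{n,j})_{0\leq n<j<\infty}$ is an infinite triangle such that, for all $j\geq 1$, $$|f_{j-1,j}-\varphi_{j-1}|<\delta_j(\mathcal{T}_{j-1},U_{j-1}(\mathcal{T}))\quad\text{on } U_{j-1}(\mathcal{T}),\text{ and}$$ $$|f_{n,j}-f_{n,j-1}|<\delta_j(\mathcal{T}_{j-1},U_{j-1}(\mathcal{T}))\quad\text{on } U_n(\mathcal{T}),\text{ for } 0\leq n<j-1.$$ Then for every $n\geq 0$ the sequence $(f_{n,j})_{j=n+1}^\infty$ converges uniformly to a holomorphic map $f_n\colon U_n(\mathcal{T})\to\mathbb{C}$, and there exists a sequence of diffeomorphisms $\Theta_n\colon\mathbb{C}\to\mathbb{C}$, $n\ge 0$, with the following properties: (a) $f_n\circ\Theta_n=\Theta_{n+1}\circ\varphi_n$ on $X_n$ for all $n\geq 0$; (b) $\|\Theta_n-\operatorname{id}\|_{\mathcal{C}^{M_n}}\leq\varepsilon_n$ on $U_n(\mathcal{T})$ for all $n\geq 0$; (c) $\Theta_n=\operatorname{id}$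 outside $U_n(\mathcal{T})$ and on $C_n$ for all $n\geq 0$; (d) $\Theta_n$ satisfies the Cauchy--Riemann differential equations on $X_n$; in particular, it is conformal on $\operatorname{int}(X_n)$.
   Context: $\operatorname{CP}(\varphi)$ denotes the set of critical points of a holomorphic function $\varphi$ in its domain. For an integer $m\ge 0$, $\|f\|_{\mathcal{C}^m}$ on an open set denotes $\sum_{k=0}^m\sup\|\mathrm{D}^k f\|$, the supremum being over that set and $\|\cdot\|$ denoting the operator norm. A non-autonomous system (marked, holomorphic, on compact sets) is a triple $\Phi=\bigl((X_n)_{n=0}^{\infty},(\varphi_n)_{n=0}^{\infty},(C_n)_{n=0}^{\infty}\bigr)$ where each $X_n\subseteq\mathbb{C}$ is compact, each $\varphi_n$ is a holomorphic function defined on an open neighbourhood of $X_n$ with $\varphi_n(X_n)\subseteq X_{n+1}$, and each $C_n\subseteq X_n$ is a finite set with $\operatorname{CP}(\varphi_n)\cap X_n\subseteq C_n$ and $\varphi_n(C_n)\subseteq C_{n+1}$. $\mathcal{U}_n(\Phi)$ is the set of all open neighbourhoods of $X_n$ on which $\varphi_n$ is defined. A finite triangle of level $k\geq 0$ is a collection $\mathcal{T}=(f_{n,j})_{0\leq n<j\leq k}$ of holomorphic functions such that: (i) for $0\leq n<k$, all $f_{n,j}$ with $j=n+1,\dots,k$ are defined and holomorphic on the same domain $U_n=U_n(\mathcal{T})\in\mathcal{U}_n(\Phi)$; (ii) for every $z\in C_n$ and $n<j\leq k$, $f_{n,j}(z)=\varphi_n(z)$ and the local degree of $f_{n,j}$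 near $z$ equals that of $\varphi_n$. The set of finite triangles of level $k$ is $\Delta_k(\Phi)$ ($\Delta_0(\Phi)$ has exactly one element, the triangle with empty index set). An infinite triangle is a collection $\mathcal{T}=(f_{n,j})_{0\leq n<j<\infty}$ such that $\mathcal{T}_k:=(f_{n,j})_{0\leq n<j\leq k}\in\Delta_k(\Phi)$ for all $k\geq 0$; each $f_{n,j}$ is then defined on a set $U_n(\mathcal{T})\in\mathcal{U}_n(\Phi)$ depending on $n$ but not on $j$. *)

theory Defs
  imports "HOL-Complex_Analysis.Complex_Analysis" "HOL-Library.Extended_Nat"
begin

section \<open>Holomorphic functions\<close>

definition critical_points :: "(complex \<Rightarrow> complex) \<Rightarrow> complex set \<Rightarrow> complex set" where
  "critical_points f D = {z \<in> D. deriv f z = 0}"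

text \<open>The order of the zero of \<open>f - f z\<close> at \<open>z\<close>, with value \<open>\<infinity>\<close> if \<open>f\<close> is constant near \<open>z\<close>.\<close>

definition local_degree :: "(complex \<Rightarrow> complex) \<Rightarrow> complex \<Rightarrow> enat" where
  "local_degree f z =
     (if \<forall>\<^sub>F w in nhds z. f w = f z then \<infinity>
      else enat (nat (zorder (\<lambda>w. f w - f z) z)))"

definition conformal_on :: "(complex \<Rightarrow> complex) \<Rightarrow> complex set \<Rightarrow> bool" where
  "conformal_on f S \<longleftrightarrow>
     f holomorphic_on S \<and> inj_on f S \<and> (\<forall>z\<in>S. deriv f z \<noteq> 0)"

definition cauchy_riemann_at :: "(complex \<Rightarrow> complex) \<Rightarrow> complex \<Rightarrow> bool" where
  "cauchy_riemann_at f z \<longleftrightarrow>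
     f differentiable (at z) \<and>
     frechet_derivative f (at z) \<i> = \<i> * frechet_derivative f (at z) 1"


section \<open>Real differentiability of higher order\<close>

text \<open>\<open>C_k_on k f S\<close>: on the open set \<open>S\<close>, the map \<open>f\<close> is \<open>k\<close> times continuously differentiable
  (over the reals).\<close>

fun C_k_on :: "nat \<Rightarrow> ('a::euclidean_space \<Rightarrow> 'b::real_normed_vector) \<Rightarrow> 'a set \<Rightarrow> bool" where
  "C_k_on 0 f S \<longleftrightarrow> continuous_on S f"
| "C_k_on (Suc k) f S \<longleftrightarrow>
     (\<forall>x\<in>S. f differentiable (at x)) \<and>
     (\<forall>v. C_k_on k (\<lambda>x. frechet_derivative f (at x) v) S)"

definition smooth_on :: "('a::euclidean_space \<Rightarrow> 'b::real_normed_vector) \<Rightarrow> 'a set \<Rightarrow> bool" where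
  "smooth_on f S \<longleftrightarrow> (\<forall>k. C_k_on k f S)"

definition diffeomorphism :: "('a::euclidean_space \<Rightarrow> 'a) \<Rightarrow> bool" where
  "diffeomorphism f \<longleftrightarrow> bij f \<and> smooth_on f UNIV \<and> smooth_on (inv f) UNIV"

text \<open>The \<open>k\<close>-th derivative as a \<open>k\<close>-linear map: \<open>higher_deriv f [v\<^sub>1, \<dots>, v\<^sub>k] x\<close> is
  \<open>D\<^sup>kf(x)(v\<^sub>1, \<dots>, v\<^sub>k)\<close>.\<close>

fun higher_deriv ::
    "('a::euclidean_space \<Rightarrow> 'b::real_normed_vector) \<Rightarrow> 'a list \<Rightarrow> 'a \<Rightarrow> 'b" where
  "higher_deriv f [] x = f x"
| "higher_deriv f (v # vs) x = frechet_derivative (higher_deriv f vs) (at x) v"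

text \<open>Operator norm of the \<open>k\<close>-linear map \<open>D\<^sup>kf(x)\<close>. Extended non-negative reals are used so that
  suprema of unbounded sets are \<open>\<infinity>\<close> (and the supremum over the empty set is \<open>0\<close>).\<close>

definition deriv_norm ::
    "nat \<Rightarrow> ('a::euclidean_space \<Rightarrow> 'b::real_normed_vector) \<Rightarrow> 'a \<Rightarrow> ennreal" where
  "deriv_norm k f x =
     (SUP vs \<in> {vs. length vs = k \<and> (\<forall>v\<in>set vs. norm v \<le> 1)}. ennreal (norm (higher_deriv f vs x)))"

definition C_norm_on ::
    "nat \<Rightarrow> ('a::euclidean_space \<Rightarrow> 'b::real_normed_vector) \<Rightarrow> 'a set \<Rightarrow> ennreal" where
  "C_norm_on m f S = (\<Sum>k\<le>m. SUP x\<in>S. deriv_norm k f x)"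


section \<open>Non-autonomous systems\<close>

text \<open>\<open>dom_at \<Phi> n\<close> is the domain of definition of \<open>map_at \<Phi> n\<close>; values outside it are irrelevant.\<close>

record nonautonomous =
  space_at :: "nat \<Rightarrow> complex set"
  dom_at :: "nat \<Rightarrow> complex set"
  map_at :: "nat \<Rightarrow> complex \<Rightarrow> complex"
  marked_at :: "nat \<Rightarrow> complex set"

definition nonautonomous_system :: "nonautonomous \<Rightarrow> bool" where
  "nonautonomous_system \<Phi> \<longleftrightarrow>
     (\<forall>n. compact (space_at \<Phi> n) \<and>
          open (dom_at \<Phi> n) \<and> space_at \<Phi> n \<subseteq> dom_at \<Phi> n \<and>
          map_at \<Phi> n holomorphic_on dom_at \<Phi> n \<and>
          map_at \<Phi> n ` space_at \<Phi> n \<subseteq> space_at \<Phi> (Suc n) \<and>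
          finite (marked_at \<Phi> n) \<and> marked_at \<Phi> n \<subseteq> space_at \<Phi> n \<and>
          critical_points (map_at \<Phi> n) (dom_at \<Phi> n) \<inter> space_at \<Phi> n \<subseteq> marked_at \<Phi> n \<and>
          map_at \<Phi> n ` marked_at \<Phi> n \<subseteq> marked_at \<Phi> (Suc n))"

definition nbhds_at :: "nonautonomous \<Rightarrow> nat \<Rightarrow> complex set set" where
  "nbhds_at \<Phi> n = {U. open U \<and> space_at \<Phi> n \<subseteq> U \<and> U \<subseteq> dom_at \<Phi> n}"


section \<open>Triangles\<close>

text \<open>\<open>tri_map T n j\<close> is \<open>f\<^bsub>n,j\<^esub>\<close>, with domain \<open>tri_dom T n\<close>.\<close>

record triangle =
  tri_dom :: "nat \<Rightarrow> complex set"
  tri_map :: "nat \<Rightarrow> nat \<Rightarrow> complex \<Rightarrow> complex"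

text \<open>The last two conditions, and membership in \<open>extensional\<close>, fix all values that are not part of
  the triangle, so that each finite triangle of level \<open>k\<close> has exactly one representation. Thus a
  function on \<open>finite_triangles \<Phi> k\<close> cannot depend on anything but the triangle itself.\<close>

definition finite_triangles :: "nonautonomous \<Rightarrow> nat \<Rightarrow> triangle set" where
  "finite_triangles \<Phi> k =
     {T. (\<forall>n<k. tri_dom T n \<in> nbhds_at \<Phi> n) \<and>
         (\<forall>n j. n < j \<and> j \<le> k \<longrightarrow>
            tri_map T n j holomorphic_on tri_dom T n \<and>
            tri_map T n j \<in> extensional (tri_dom T n) \<and>
            (\<forall>z\<in>marked_at \<Phi> n.
               tri_map T n j z = map_at \<Phi> n z \<and>
               local_degree (tri_map T n j) z = local_degree (map_at \<Phi> n) z)) \<and>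
         (\<forall>n\<ge>k. tri_dom T n = {}) \<and>
         (\<forall>n j. \<not> (n < j \<and> j \<le> k) \<longrightarrow> tri_map T n j = (\<lambda>_. undefined))}"

definition truncate_triangle :: "nat \<Rightarrow> triangle \<Rightarrow> triangle" where
  "truncate_triangle k T =
     \<lparr>tri_dom = (\<lambda>n. if n < k then tri_dom T n else {}),
      tri_map = (\<lambda>n j. if n < j \<and> j \<le> k then tri_map T n j else (\<lambda>_. undefined))\<rparr>"

definition infinite_triangle :: "nonautonomous \<Rightarrow> triangle \<Rightarrow> bool" where
  "infinite_triangle \<Phi> T \<longleftrightarrow> (\<forall>k. truncate_triangle k T \<in> finite_triangles \<Phi> k)"

lemma finite_triangles_0:
  "finite_triangles \<Phi> 0 = {\<lparr>tri_dom = (\<lambda>_. {}), tri_map = (\<lambda>_ _ _. undefined)\<rparr>}"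
proof -
  have "T = \<lparr>tri_dom = (\<lambda>_. {}), tri_map = (\<lambda>_ _ _. undefined)\<rparr>"
    if "T \<in> finite_triangles \<Phi> 0" for T :: triangle
    using that by (cases T) (auto simp: finite_triangles_def fun_eq_iff)
  then show ?thesis
    by (auto simp: finite_triangles_def)
qed

end

theory Submission
  imports Defs
begin

text \<open>
  For a fixed level \<open>j\<close>, the equations \<open>f\<^bsub>n,j\<^esub> \<circ> \<Theta>\<^bsub>n,j\<^esub> = \<Theta>\<^bsub>n+1,j\<^esub> \<circ> \<phi>\<^sub>n\<close> near \<open>X\<^sub>n\<close>, with
  \<open>\<Theta>\<^bsub>n,j\<^esub> = id\<close> for \<open>n \<ge> j\<close>, are solved by downward recursion on \<open>n\<close>: one lifts
  \<open>\<Theta>\<^bsub>n+1,j\<^esub> \<circ> \<phi>\<^sub>n\<close> through \<open>f\<^bsub>n,j\<^esub>\<close>, which is possible across critical points because values and local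
  degrees agree on \<open>C\<^sub>n\<close>. If \<open>f\<^bsub>n,j+1\<^esub>\<close> is uniformly close to \<open>f\<^bsub>n,j\<^esub>\<close>, the new holomorphic lift is close to
  the old one on a fixed neighbourhood of \<open>X\<^sub>n\<close>, hence close with all derivatives on a smaller one. Multiplying
  the difference by a bump function that is 1 near \<open>X\<^sub>n\<close> gives a globally defined smooth correction
  of \<open>\<Theta>\<^bsub>n,j\<^esub>\<close>, as small as we like in \<open>C\<^sup>k\<close> for any prescribed \<open>k\<close>. All choices at level
  \<open>j\<close> depend on the finite triangle of level \<open>j\<close> only, so they determine how small \<open>\<delta>\<^bsub>j+1\<^esub>\<close> has to be. With
  summable corrections the \<open>\<Theta>\<^bsub>n,j\<^esub>\<close> converge smoothly as \<open>j \<rightarrow> \<infinity>\<close>; each is holomorphic near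
  \<open>X\<^sub>n\<close>, so the limit satisfies the Cauchy-Riemann equations on \<open>X\<^sub>n\<close>.
\<close>

section \<open>Calculus of smooth functions\<close>

text \<open>Two losses shape the proof. Lifts are holomorphic only near \<open>X_n\<close>, and
  these neighbourhoods may shrink at every level; hence the limit inherits the Cauchy-Riemann
  equations on \<open>X_n\<close> only. Moreover, cutting off a correction costs a constant that
  depends on the neighbourhood. All neighbourhoods of one level are therefore fixed before any
  tolerance: the lifting statements provide one neighbourhood that serves every tolerance. For the
  same reason the lift at index n uses the uncut holomorphic lift at index n+1; the cut-off map
  agrees with it only on a smaller neighbourhood and serves as the global map. Near a critical point
  the implicit function theorem degenerates. What replaces it is a bound for quotients whose
  numerator vanishes at least to the order of the denominator; equal local degrees supply these
  orders. Points near which \<open>phi_n\<close> is constant have infinite degree and are treated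
  apart: there the old lift still solves the new equation. Bijectivity survives the limit because
  all derivatives stay within 1/2 of the identity, which is a closed condition.\<close>

lemma has_derivative_cong_open:
  assumes "open S" "x \<in> S" "\<And>y. y \<in> S \<Longrightarrow> f y = g y"
  shows "(f has_derivative f') (at x) \<longleftrightarrow> (g has_derivative f') (at x)"
  using assms has_derivative_transform_within_open[of f f' x UNIV S g]
    has_derivative_transform_within_open[of g f' x UNIV S f] by auto

lemma frechet_derivative_cong_open:
  assumes "open S" "x \<in> S" "\<And>y. y \<in> S \<Longrightarrow> f y = g y"
  shows "frechet_derivative f (at x) = frechet_derivative g (at x)"
  unfolding frechet_derivative_def using has_derivative_cong_open[OF assms] by simp

lemma has_frechet_derivative:
  "f differentiable (at x) \<Longrightarrow> (f has_derivative frechet_derivative f (at x)) (at x)"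
  by (simp add: frechet_derivative_works)

lemma C_k_on_cong:
  assumes "open S" "\<And>x. x \<in> S \<Longrightarrow> f x = g x" "C_k_on k f S"
  shows "C_k_on k g S"
  using assms(2,3)
proof (induction k arbitrary: f g)
  case 0
  then show ?case by (auto cong: continuous_on_cong)
next
  case (Suc k)
  have "g differentiable (at x)" if "x \<in> S" for x
    using has_derivative_cong_open[OF assms(1) that Suc.prems(1)] Suc.prems(2) that
    unfolding differentiable_def C_k_on.simps by meson
  moreover have "C_k_on k (\<lambda>x. frechet_derivative g (at x) v) S" for v
    by (rule Suc.IH[of "\<lambda>x. frechet_derivative f (at x) v"])
      (use Suc.prems frechet_derivative_cong_open[OF assms(1) _ Suc.prems(1)] in auto)
  ultimately show ?case by simp
qed

lemma C_k_on_union: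
  assumes "open A" "open B" "C_k_on k f A" "C_k_on k f B"
  shows "C_k_on k f (A \<union> B)"
  using assms(3,4) by (induction k arbitrary: f) (auto intro!: continuous_on_open_Un assms)

lemma C_k_on_subset: "C_k_on k f S \<Longrightarrow> T \<subseteq> S \<Longrightarrow> C_k_on k f T"
  by (induction k arbitrary: f) (auto intro: continuous_on_subset)

lemma C_k_on_continuous: "C_k_on k f S \<Longrightarrow> continuous_on S f"
  by (cases k) (auto simp: differentiable_imp_continuous_within continuous_at_imp_continuous_on)

lemma C_k_on_SucD: "C_k_on (Suc k) f S \<Longrightarrow> C_k_on k f S"
proof (induction k arbitrary: f)
  case 0
  then show ?case using C_k_on_continuous by fastforce
next
  case (Suc k)
  have "C_k_on k (\<lambda>x. frechet_derivative f (at x) v) S" for v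
    by (rule Suc.IH) (use Suc.prems in simp)
  then show ?case using Suc.prems by auto
qed

text \<open>Allows an explicit formula for the derivative in place of
  \<open>frechet_derivative\<close>; the closure properties below are inductions on \<open>k\<close>
  through this rule.\<close>

lemma C_k_on_SucI:
  assumes "open S" "\<And>x. x \<in> S \<Longrightarrow> (f has_derivative f' x) (at x)"
    and "\<And>v. C_k_on k (\<lambda>x. f' x v) S"
  shows "C_k_on (Suc k) f S"
proof -
  have "C_k_on k (\<lambda>x. frechet_derivative f (at x) v) S" for v
    by (rule C_k_on_cong[OF assms(1) _ assms(3)[of v]]) (use assms(2) frechet_derivative_at in metis)
  then show ?thesis using assms(2) by (auto simp: differentiable_def)
qed

section \<open>Closure properties of C^k maps\<close>

lemma C_k_on_const: "C_k_on k (\<lambda>_. c) S"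
  by (induction k arbitrary: c) auto

lemma C_k_on_linear:
  assumes "bounded_linear h" "open S"
  shows "C_k_on k h S"
proof (cases k)
  case 0
  then show ?thesis using assms linear_continuous_on by auto
next
  case (Suc l)
  then show ?thesis
    using C_k_on_SucI[OF assms(2) bounded_linear_imp_has_derivative[OF assms(1)] C_k_on_const] by blast
qed

lemma C_k_on_add:
  assumes "open S" "C_k_on k f S" "C_k_on k g S"
  shows "C_k_on k (\<lambda>x. f x + g x) S"
  using assms(2,3)
proof (induction k arbitrary: f g)
  case 0
  then show ?case by (auto intro: continuous_intros)
next
  case (Suc k)
  show ?case
    by (rule C_k_on_SucI[OF assms(1), where f' = "\<lambda>x v. frechet_derivative f (at x) v + frechet_derivative g (at x) v"])
      (use Suc in \<open>auto intro!: has_derivative_add has_frechet_derivative Suc.IH\<close>)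
qed

lemma (in bounded_bilinear) C_k_on_bilinear:
  assumes "open S" "C_k_on k f S" "C_k_on k g S"
  shows "C_k_on k (\<lambda>x. prod (f x) (g x)) S"
  using assms(2,3)
proof (induction k arbitrary: f g)
  case 0
  then show ?case by (auto intro: continuous_on)
next
  case (Suc k)
  note C = C_k_on_SucD[OF Suc.prems(1)] C_k_on_SucD[OF Suc.prems(2)]
  show ?case
    by (rule C_k_on_SucI[OF assms(1), where f' = "\<lambda>x v. prod (f x) (frechet_derivative g (at x) v) + prod (frechet_derivative f (at x) v) (g x)"])
      (use Suc.prems C in \<open>auto intro!: FDERIV has_frechet_derivative C_k_on_add[OF assms(1)] Suc.IH\<close>)
qed

lemmas C_k_on_mult = bounded_bilinear.C_k_on_bilinear[OF bounded_bilinear_mult]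
lemmas C_k_on_scaleR = bounded_bilinear.C_k_on_bilinear[OF bounded_bilinear_scaleR]

lemma C_k_on_bounded_linear:
  assumes "bounded_linear h" "open S" "C_k_on k f S"
  shows "C_k_on k (\<lambda>x. h (f x)) S"
  using assms(3)
proof (induction k arbitrary: f)
  case 0
  then show ?case using bounded_linear.continuous_on[OF assms(1)] by auto
next
  case (Suc k)
  show ?case
    by (rule C_k_on_SucI[OF assms(2), where f' = "\<lambda>x v. h (frechet_derivative f (at x) v)"])
      (use Suc in \<open>auto intro!: bounded_linear.has_derivative[OF assms(1)] has_frechet_derivative\<close>)
qed

lemma C_k_on_diff:
  assumes "open S" "C_k_on k f S" "C_k_on k g S"
  shows "C_k_on k (\<lambda>x. f x - g x) S"
  using C_k_on_add[OF assms(1,2) C_k_on_bounded_linear[OF bounded_linear_minus[OF bounded_linear_ident] assms(1,3)]]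
  by simp

lemma C_k_on_sum:
  assumes "open S" "\<And>i. i \<in> I \<Longrightarrow> C_k_on k (f i) S"
  shows "C_k_on k (\<lambda>x. \<Sum>i\<in>I. f i x) S"
  using assms(2)
  by (induction I rule: infinite_finite_induct) (auto intro: C_k_on_const C_k_on_add[OF assms(1)])

lemma C_k_on_inverse:
  fixes f :: "'a::euclidean_space \<Rightarrow> 'b::real_normed_div_algebra"
  assumes "open S" "C_k_on k f S" "\<And>x. x \<in> S \<Longrightarrow> f x \<noteq> 0"
  shows "C_k_on k (\<lambda>x. inverse (f x)) S"
  using assms(2)
proof (induction k)
  case 0
  then show ?case using assms(3) by (auto intro: continuous_on_inverse)
next
  case (Suc k)
  have "C_k_on k (\<lambda>x. inverse (f x)) S" using Suc C_k_on_SucD by blast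
  then have "C_k_on k (\<lambda>x. 0 - inverse (f x) * frechet_derivative f (at x) v * inverse (f x)) S" for v
    using Suc.prems by (intro C_k_on_diff C_k_on_mult C_k_on_const assms(1)) auto
  then have "C_k_on k (\<lambda>x. - (inverse (f x) * frechet_derivative f (at x) v * inverse (f x))) S" for v
    by simp
  moreover have "((\<lambda>x. inverse (f x)) has_derivative (\<lambda>v. - (inverse (f x) * frechet_derivative f (at x) v * inverse (f x)))) (at x)"
    if "x \<in> S" for x
    by (rule Deriv.has_derivative_inverse[where f = f]) (use Suc.prems that assms(3) in \<open>auto intro: has_frechet_derivative\<close>)
  ultimately show ?case by (intro C_k_on_SucI[OF assms(1)])
qed

lemma C_k_on_compose:
  fixes g :: "'a::euclidean_space \<Rightarrow> 'b::euclidean_space"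
  assumes "open S" "open T" "C_k_on k g S" "C_k_on k f T" "g ` S \<subseteq> T"
  shows "C_k_on k (\<lambda>x. f (g x)) S"
  using assms(3,4)
proof (induction k arbitrary: f)
  case 0
  then show ?case using assms(5) by (auto intro: continuous_on_compose2)
next
  case (Suc k)
  \<comment> \<open>The induction hypothesis concerns derivatives of \<open>f\<close> in a fixed
    direction, but the chain rule produces the direction
    \<open>frechet_derivative g (at x) v\<close>, which moves with \<open>x\<close>. Expanding it in
    \<open>Basis\<close> leaves fixed directions with C^k coefficients.\<close>
  define D where "D = (\<lambda>x v. \<Sum>b\<in>Basis. (frechet_derivative g (at x) v \<bullet> b) *\<^sub>R frechet_derivative f (at (g x)) b)"
  have eq: "frechet_derivative f (at (g x)) (frechet_derivative g (at x) v) = D x v"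
    if "x \<in> S" for x v
  proof -
    have "f differentiable (at (g x))" using Suc.prems that assms(5) by auto
    then have "linear (frechet_derivative f (at (g x)))"
      using linear_frechet_derivative by blast
    then have "frechet_derivative f (at (g x)) (\<Sum>b\<in>Basis. (frechet_derivative g (at x) v \<bullet> b) *\<^sub>R b) = D x v"
      by (simp add: linear_sum linear_cmul D_def)
    then show ?thesis by (simp only: euclidean_representation)
  qed
  have "C_k_on k (\<lambda>x. D x v) S" for v
    unfolding D_def
    by (intro C_k_on_sum C_k_on_scaleR C_k_on_bounded_linear[OF bounded_linear_inner_left] assms(1) Suc.IH)
      (use Suc.prems C_k_on_SucD in auto)
  moreover have "((\<lambda>x. f (g x)) has_derivative D x) (at x)" if "x \<in> S" for x
  proof -
    have "((\<lambda>x. f (g x)) has_derivative (\<lambda>v. frechet_derivative f (at (g x)) (frechet_derivative g (at x) v))) (at x)"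
      by (rule has_derivative_compose[where g=f]) (use Suc.prems that assms(5) in \<open>auto intro!: has_frechet_derivative\<close>)
    then show ?thesis by (simp add: eq[OF that])
  qed
  ultimately show ?case by (intro C_k_on_SucI[OF assms(1)])
qed

lemma C_k_on_holomorphic:
  assumes "open S" "f holomorphic_on S"
  shows "C_k_on k f S"
  using assms(2)
proof (induction k arbitrary: f)
  case 0
  then show ?case by (simp add: holomorphic_on_imp_continuous_on)
next
  case (Suc k)
  show ?case
    by (rule C_k_on_SucI[OF assms(1), where f' = "\<lambda>x v. deriv f x * v"])
      (use Suc assms(1) in \<open>auto intro!: Suc.IH holomorphic_intros holomorphic_derivI has_field_derivative_imp_has_derivative\<close>)
qed

lemma smooth_on_cong: "open S \<Longrightarrow> (\<And>x. x \<in> S \<Longrightarrow> f x = g x) \<Longrightarrow> smooth_on f S \<Longrightarrow> smooth_on g S"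
  using C_k_on_cong unfolding smooth_on_def by blast

lemma smooth_on_diffble: "smooth_on f S \<Longrightarrow> x \<in> S \<Longrightarrow> f differentiable (at x)"
  unfolding smooth_on_def by (metis C_k_on.simps(2))

lemma smooth_on_frechet: "smooth_on f S \<Longrightarrow> smooth_on (\<lambda>x. frechet_derivative f (at x) v) S"
  unfolding smooth_on_def by (metis C_k_on.simps(2))

section \<open>Inverses of smooth bijections of the plane\<close>

lemma complex_linear_combination:
  assumes "linear L" shows "L h = Re h *\<^sub>R L 1 + Im h *\<^sub>R L \<i>"
proof -
  have "L h = L (Re h *\<^sub>R 1 + Im h *\<^sub>R \<i>)"
    by (metis complex_eq scaleR_conv_of_real mult.commute mult.right_neutral)
  then show ?thesis using assms by (simp only: linear_add linear_cmul)
qed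

text \<open>Cramer's rule in the real plane: \<open>Im (cnj p * q)\<close> is the determinant of the
  matrix with columns \<open>p\<close> and \<open>q\<close>.\<close>

lemma complex_cramer:
  assumes "v = Re h *\<^sub>R p + Im h *\<^sub>R q" "Im (cnj p * q) \<noteq> 0"
  shows "h = (of_real (Im (cnj v * q)) + \<i> * of_real (Im (cnj p * v))) * inverse (of_real (Im (cnj p * q)))"
proof -
  have "Im (cnj v * q) = Re h * Im (cnj p * q)" "Im (cnj p * v) = Im h * Im (cnj p * q)"
    unfolding assms(1) by (auto simp: algebra_simps)
  then have "of_real (Im (cnj v * q)) + \<i> * of_real (Im (cnj p * v))
      = (of_real (Re h) + \<i> * of_real (Im h)) * (of_real (Im (cnj p * q)) :: complex)"
    by (simp only: ring_distribs of_real_mult mult.assoc)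
  moreover have "of_real (Re h) + \<i> * of_real (Im h) = h" by (simp add: complex_eq_iff)
  ultimately have "of_real (Im (cnj v * q)) + \<i> * of_real (Im (cnj p * v)) = h * complex_of_real (Im (cnj p * q))"
    by simp
  then show ?thesis using assms(2)
    by (metis mult.assoc mult.right_neutral of_real_eq_0_iff right_inverse)
qed

lemma complex_det_nonzero:
  assumes "\<And>h. Re h *\<^sub>R p + Im h *\<^sub>R q = 0 \<Longrightarrow> h = (0::complex)"
  shows "Im (cnj p * q) \<noteq> 0"
proof
  assume d: "Im (cnj p * q) = 0"
  \<comment> \<open>If the determinant vanishes, the coefficient vectors (Im q, -Im p) and then (Re
    q, -Re p) lie in the kernel; triviality of the kernel makes all four entries zero, so that
    \<open>p = q = 0\<close>, which is absurd.\<close>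
  have "Re (Complex (Im q) (- Im p)) *\<^sub>R p + Im (Complex (Im q) (- Im p)) *\<^sub>R q = 0"
    using d by (simp add: complex_eq_iff algebra_simps)
  with assms have "Complex (Im q) (- Im p) = 0" by blast
  then have im: "Im q = 0" "Im p = 0" by (auto simp: complex_eq_iff)
  have "Re (Complex (Re q) (- Re p)) *\<^sub>R p + Im (Complex (Re q) (- Re p)) *\<^sub>R q = 0"
    using im by (simp add: complex_eq_iff algebra_simps)
  with assms have "Complex (Re q) (- Re p) = 0" by blast
  then have "Re q = 0" "Re p = 0" by (auto simp: complex_eq_iff)
  with im have "p = 0" "q = 0" by (auto simp: complex_eq_iff)
  then show False using assms[of 1] by simp
qed

text \<open>The map \<Theta> - id is Lipschitz with constant 1/2. This bounds distances of images
  from below, giving injectivity and a Lipschitz inverse, and makes x -> y - (\<Theta> x - x) a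
  contraction whose fixed point is a preimage of y.\<close>

lemma diffeomorphism_perturbed_id:
  fixes \<Theta> :: "complex \<Rightarrow> complex"
  assumes "smooth_on \<Theta> UNIV"
    and D: "\<And>x v. norm (frechet_derivative \<Theta> (at x) v - v) \<le> norm v / 2"
  shows "diffeomorphism \<Theta>"
proof -
  define T where "T = (\<lambda>x. frechet_derivative \<Theta> (at x))"
  have der: "(\<Theta> has_derivative T x) (at x)" for x
    unfolding T_def using assms(1) smooth_on_diffble has_frechet_derivative by blast
  have lip: "norm ((\<Theta> x - x) - (\<Theta> y - y)) \<le> norm (x - y) / 2" for x y
  proof -
    have "norm ((\<Theta> x - x) - (\<Theta> y - y)) \<le> 1/2 * norm (x - y)"
    proof (rule differentiable_bound[where S = UNIV and f' = "\<lambda>x v. T x v - v"])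
      show "onorm (\<lambda>v. T x v - v) \<le> 1 / 2" for x
        by (rule onorm_le) (use D in \<open>auto simp: T_def\<close>)
    qed (auto intro!: der has_derivative_diff)
    then show ?thesis by simp
  qed
  have lower: "norm (x - y) \<le> 2 * norm (\<Theta> x - \<Theta> y)" for x y
  proof -
    have "norm (x - y) \<le> norm (\<Theta> x - \<Theta> y) + norm ((\<Theta> x - x) - (\<Theta> y - y))"
      using norm_triangle_ineq4[of "\<Theta> x - \<Theta> y" "(\<Theta> x - x) - (\<Theta> y - y)"] by (simp add: algebra_simps)
    then show ?thesis using lip[of x y] by linarith
  qed
  have inj: "inj \<Theta>"
  proof (rule injI)
    fix x y assume "\<Theta> x = \<Theta> y"
    then show "x = y" using lower[of x y] by simp
  qed
  have surj: "surj \<Theta>"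
  proof -
    have "\<exists>x. \<Theta> x = y" for y
    proof -
      have "\<exists>!x\<in>UNIV. y - (\<Theta> x - x) = x"
      proof (rule Banach_fix[where c = "1/2"])
        fix x1 x2
        have "dist (y - (\<Theta> x1 - x1)) (y - (\<Theta> x2 - x2)) = norm ((\<Theta> x1 - x1) - (\<Theta> x2 - x2))"
          by (simp add: dist_norm norm_minus_commute algebra_simps)
        then show "dist (y - (\<Theta> x1 - x1)) (y - (\<Theta> x2 - x2)) \<le> 1 / 2 * dist x1 x2"
          using lip[of x1 x2] by (simp add: dist_norm)
      qed (auto simp: complete_UNIV)
      then obtain x where "y - (\<Theta> x - x) = x" by blast
      then have "\<Theta> x = y" by (simp add: algebra_simps)
      then show ?thesis ..
    qed
    then show ?thesis by (metis surjI)
  qed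
  have bij: "bij \<Theta>" using inj surj by (simp add: bij_def)
  define g where "g = inv \<Theta>"
  have \<Theta>g: "\<Theta> (g x) = x" for x
    using surj by (simp add: g_def surj_f_inv_f)
  have g_lip: "norm (g x - g y) \<le> 2 * norm (x - y)" for x y
    using lower[of "g x" "g y"] by (simp add: \<Theta>g)
  have g_cont: "continuous_on UNIV g"
    unfolding continuous_on_iff dist_norm
  proof (intro ballI allI impI)
    fix x and e :: real assume "e > 0"
    show "\<exists>d>0. \<forall>x'\<in>UNIV. norm (x' - x) < d \<longrightarrow> norm (g x' - g x) < e"
    proof (intro exI[of _ "e/2"] conjI ballI impI)
      fix x' assume "norm (x' - x) < e/2"
      then show "norm (g x' - g x) < e" using g_lip[of x' x] by linarith
    qed (use \<open>e > 0\<close> in auto)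
  qed
  define p q where "p = (\<lambda>x. T x 1)" and "q = (\<lambda>x. T x \<i>)"
  have lin: "linear (T x)" for x using der has_derivative_linear by blast
  have T_eq: "T x h = Re h *\<^sub>R p x + Im h *\<^sub>R q x" for x h
    unfolding p_def q_def by (rule complex_linear_combination[OF lin])
  have det: "Im (cnj (p x) * q x) \<noteq> 0" for x
  proof (rule complex_det_nonzero)
    fix h assume "Re h *\<^sub>R p x + Im h *\<^sub>R q x = 0"
    then have "T x h = 0" using T_eq by simp
    then show "h = 0" using D[of x h] by (simp add: T_def)
  qed
  define G where "G = (\<lambda>x v. (of_real (Im (cnj v * q x)) + \<i> * of_real (Im (cnj (p x) * v)))
      * inverse (of_real (Im (cnj (p x) * q x)) :: complex))"
  have GT: "G x (T x h) = h" for x h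
    unfolding G_def by (rule complex_cramer[symmetric, OF T_eq det])
  have ri: "bounded_linear (\<lambda>z. complex_of_real (Im z))"
    by (intro bounded_linear_compose[OF bounded_linear_of_real bounded_linear_Im])
  have blG: "bounded_linear (G x)" for x
    unfolding G_def
    by (intro bounded_linear_mult_const bounded_linear_add bounded_linear_const_mult
        bounded_linear_compose[OF ri] bounded_linear_cnj bounded_linear_ident)
  have der_g: "(g has_derivative G (g y)) (at y)" for y
    by (rule has_derivative_inverse_basic[where f = \<Theta> and f' = "T (g y)" and T = UNIV])
      (use der blG GT \<Theta>g g_cont in \<open>auto simp: fun_eq_iff continuous_on_eq_continuous_at\<close>)
  \<comment> \<open>Bootstrapping: the derivative of \<open>g\<close> at \<open>y\<close> is
    \<open>G (g y)\<close>, an explicit rational expression in the first partial derivatives of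
    \<Theta> at \<open>g y\<close>, so one order of regularity of \<open>g\<close> yields the
    next.\<close>
  have "C_k_on k g UNIV" for k
  proof (induction k)
    case 0
    then show ?case using g_cont by simp
  next
    case (Suc k)
    have sm: "C_k_on k p UNIV" "C_k_on k q UNIV"
      using assms(1) smooth_on_frechet unfolding p_def q_def T_def smooth_on_def by blast+
    have pq: "C_k_on k (\<lambda>x. p (g x)) UNIV" "C_k_on k (\<lambda>x. q (g x)) UNIV"
      using C_k_on_compose[OF open_UNIV open_UNIV Suc] sm by auto

    have "C_k_on k (\<lambda>y. G (g y) v) UNIV" for v
      unfolding G_def
      using pq det unfolding of_real_eq_0_iff[where 'a = complex, symmetric]
      by (intro C_k_on_mult C_k_on_inverse C_k_on_add C_k_on_const open_UNIV
          C_k_on_bounded_linear[OF ri] C_k_on_bounded_linear[OF bounded_linear_cnj])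
    then show ?case using der_g by (intro C_k_on_SucI) auto
  qed
  then show ?thesis
    using bij assms(1) unfolding diffeomorphism_def smooth_on_def g_def by blast
qed

section \<open>Iterated derivatives and limits of smooth functions\<close>

lemma smooth_on_add: "open S \<Longrightarrow> smooth_on f S \<Longrightarrow> smooth_on g S \<Longrightarrow> smooth_on (\<lambda>x. f x + g x) S"
  by (simp add: smooth_on_def C_k_on_add)

lemma smooth_on_diff: "open S \<Longrightarrow> smooth_on f S \<Longrightarrow> smooth_on g S \<Longrightarrow> smooth_on (\<lambda>x. f x - g x) S"
  by (simp add: smooth_on_def C_k_on_diff)

lemma smooth_on_scaleR:
  "open S \<Longrightarrow> smooth_on f S \<Longrightarrow> smooth_on g S \<Longrightarrow> smooth_on (\<lambda>x. f x *\<^sub>R g x) S"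
  by (simp add: smooth_on_def C_k_on_scaleR)

lemma smooth_on_mult:
  fixes f g :: "'a::euclidean_space \<Rightarrow> 'b::real_normed_algebra"
  shows "open S \<Longrightarrow> smooth_on f S \<Longrightarrow> smooth_on g S \<Longrightarrow> smooth_on (\<lambda>x. f x * g x) S"
  by (simp add: smooth_on_def C_k_on_mult)

lemma smooth_on_const: "smooth_on (\<lambda>_. c) S"
  by (simp add: smooth_on_def C_k_on_const)

lemma smooth_on_id: "open S \<Longrightarrow> smooth_on (\<lambda>x. x) S"
  by (simp add: smooth_on_def C_k_on_linear)

lemma smooth_on_holomorphic: "open S \<Longrightarrow> f holomorphic_on S \<Longrightarrow> smooth_on f S"
  by (simp add: smooth_on_def C_k_on_holomorphic)

lemma smooth_on_union:
  "open A \<Longrightarrow> open B \<Longrightarrow> smooth_on f A \<Longrightarrow> smooth_on f B \<Longrightarrow> smooth_on f (A \<union> B)"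
  by (simp add: smooth_on_def C_k_on_union)

lemma higher_deriv_eqs:
  "higher_deriv f [] = f"
  "higher_deriv f (v # vs) = (\<lambda>x. frechet_derivative (higher_deriv f vs) (at x) v)"
  by (rule ext, simp)+

lemma higher_deriv_append: "higher_deriv f (ws @ vs) = higher_deriv (higher_deriv f vs) ws"
  by (induction ws) (simp_all add: higher_deriv_eqs del: higher_deriv.simps)

text \<open>The last entry of the list is the direction of the innermost derivative. Peeling it off,
  rather than the head, replaces \<open>f\<close> by a directional derivative, as an induction over
  the function needs.\<close>

lemma higher_deriv_append_single:
  "higher_deriv f (vs @ [v]) = higher_deriv (\<lambda>x. frechet_derivative f (at x) v) vs"
  by (simp add: higher_deriv_append higher_deriv_eqs del: higher_deriv.simps)

lemma smooth_on_higher_deriv: "smooth_on f S \<Longrightarrow> smooth_on (higher_deriv f vs) S"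
proof (induction vs)
  case Nil
  then show ?case by simp
next
  case (Cons v vs)
  then show ?case using smooth_on_frechet[of "higher_deriv f vs"] by simp
qed

lemma higher_deriv_add:
  assumes "smooth_on f UNIV" "smooth_on g UNIV"
  shows "higher_deriv (\<lambda>x. f x + g x) vs = (\<lambda>x. higher_deriv f vs x + higher_deriv g vs x)"
proof (induction vs)
  case (Cons v vs)
  have "((\<lambda>x. higher_deriv f vs x + higher_deriv g vs x) has_derivative
      (\<lambda>h. frechet_derivative (higher_deriv f vs) (at x) h + frechet_derivative (higher_deriv g vs) (at x) h)) (at x)" for x
    by (intro has_derivative_add has_frechet_derivative smooth_on_diffble[where S = UNIV] smooth_on_higher_deriv assms) auto
  from frechet_derivative_at[OF this, symmetric] show ?case by (intro ext) (simp add: Cons.IH)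
qed auto

lemma higher_deriv_scaleR_const:
  assumes "smooth_on f UNIV"
  shows "higher_deriv (\<lambda>x. c *\<^sub>R f x) vs = (\<lambda>x. c *\<^sub>R higher_deriv f vs x)"
proof (induction vs)
  case (Cons v vs)
  have "((\<lambda>x. c *\<^sub>R higher_deriv f vs x) has_derivative
      (\<lambda>h. c *\<^sub>R frechet_derivative (higher_deriv f vs) (at x) h)) (at x)" for x
    by (intro has_derivative_scaleR_right has_frechet_derivative smooth_on_diffble[where S = UNIV] smooth_on_higher_deriv assms) auto
  from frechet_derivative_at[OF this, symmetric] show ?case by (intro ext) (simp add: Cons.IH)
qed auto

lemma higher_deriv_diff:
  assumes "smooth_on f UNIV" "smooth_on g UNIV"
  shows "higher_deriv (\<lambda>x. f x - g x) vs = (\<lambda>x. higher_deriv f vs x - higher_deriv g vs x)"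
  using higher_deriv_add[OF assms(1), of "\<lambda>x. (-1) *\<^sub>R g x" vs] higher_deriv_scaleR_const[OF assms(2), of "-1" vs]
    smooth_on_scaleR[OF open_UNIV smooth_on_const assms(2), of "-1"]
  by (simp add: fun_eq_iff)

lemma higher_deriv_zero: "higher_deriv (\<lambda>_. 0) vs = (\<lambda>_. 0)"
  by (induction vs) (simp_all add: higher_deriv_eqs del: higher_deriv.simps)

text \<open>\<open>has_derivative_sequence\<close> asks for an estimate uniform in the direction. As
  derivatives are real linear, uniform convergence in the directions 1 and \<i>, with error e/2
  each, is enough.\<close>

lemma frechet_derivative_limit:
  fixes s :: "nat \<Rightarrow> complex \<Rightarrow> complex"
  assumes d: "\<And>j x. s j differentiable (at x)"
    and l: "\<And>x. (\<lambda>j. s j x) \<longlonglongrightarrow> g x"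
    and u: "\<And>v. uniform_limit UNIV (\<lambda>j x. frechet_derivative (s j) (at x) v) (\<lambda>x. D x v) sequentially"
  shows "(g has_derivative D x) (at x)"
proof -
  have lin: "linear (frechet_derivative (s j) (at x))" for j x
    using d linear_frechet_derivative by blast
  have D: "(\<lambda>j. frechet_derivative (s j) (at x) v) \<longlonglongrightarrow> D x v" for x v
    using tendsto_uniform_limitI[OF u] by blast
  have linD: "linear (D x)" for x
  proof (rule linearI)
    show "D x (a + b) = D x a + D x b" for a b
      by (rule LIMSEQ_unique[OF D]) (use tendsto_add[OF D D] in \<open>simp add: linear_add[OF lin]\<close>)
    show "D x (r *\<^sub>R a) = r *\<^sub>R D x a" for r a
      by (rule LIMSEQ_unique[OF D]) (use tendsto_scaleR[OF tendsto_const D] in \<open>simp add: linear_cmul[OF lin]\<close>)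
  qed
  have "\<exists>h. \<forall>x\<in>UNIV. (\<lambda>n. s n x) \<longlonglongrightarrow> h x \<and> (h has_derivative D x) (at x within UNIV)"
  proof (rule has_derivative_sequence[where f' = "\<lambda>n x. frechet_derivative (s n) (at x)"])
    show "(s n has_derivative frechet_derivative (s n) (at x)) (at x within UNIV)" for n x
      using d has_frechet_derivative by blast
    fix e :: real assume "e > 0"
    then have "e/2 > 0" by simp
    then have "\<forall>\<^sub>F n in sequentially. (\<forall>x\<in>UNIV. dist (frechet_derivative (s n) (at x) 1) (D x 1) < e/2) \<and>
      (\<forall>x\<in>UNIV. dist (frechet_derivative (s n) (at x) \<i>) (D x \<i>) < e/2)"
      using uniform_limitD[OF u] by (intro eventually_conj) blast+
    then show "\<forall>\<^sub>F n in sequentially. \<forall>x\<in>UNIV. \<forall>h. norm (frechet_derivative (s n) (at x) h - D x h) \<le> e * norm h"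
    proof (rule eventually_mono, intro ballI allI)
      fix n x h
      let ?F = "frechet_derivative (s n) (at x)"
      assume A: "(\<forall>x\<in>UNIV. dist (frechet_derivative (s n) (at x) 1) (D x 1) < e/2) \<and>
      (\<forall>x\<in>UNIV. dist (frechet_derivative (s n) (at x) \<i>) (D x \<i>) < e/2)"
      have "?F h - D x h = Re h *\<^sub>R (?F 1 - D x 1) + Im h *\<^sub>R (?F \<i> - D x \<i>)"
        by (subst complex_linear_combination[OF lin[of n x], of h], subst complex_linear_combination[OF linD[of x], of h])
          (simp add: scaleR_diff_right)
      also have "norm \<dots> \<le> \<bar>Re h\<bar> * norm (?F 1 - D x 1) + \<bar>Im h\<bar> * norm (?F \<i> - D x \<i>)"
        by (rule order_trans[OF norm_triangle_ineq]) simp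
      also have "\<dots> \<le> norm h * (e/2) + norm h * (e/2)"
        using A abs_Re_le_cmod[of h] abs_Im_le_cmod[of h]
        by (intro add_mono mult_mono) (auto simp: dist_norm less_imp_le)
      finally show "norm (?F h - D x h) \<le> e * norm h" by (simp add: mult.commute)
    qed
  qed (use l in auto)
  then obtain h where h: "\<And>x. (\<lambda>n. s n x) \<longlonglongrightarrow> h x" "\<And>x. (h has_derivative D x) (at x)" by auto
  then have "h = g" using l LIMSEQ_unique by blast
  then show ?thesis using h by simp
qed

text \<open>Limits and derivatives are interchanged one order at a time. The auxiliary facts are
  stated for an arbitrary sequence because they are applied to the derivatives of \<open>s\<close>
  as well.\<close>

lemma smooth_limit:
  fixes s :: "nat \<Rightarrow> complex \<Rightarrow> complex"
  assumes "\<And>j. smooth_on (s j) UNIV"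
    and "\<And>vs. uniformly_convergent_on UNIV (\<lambda>j. higher_deriv (s j) vs)"
    and "\<And>x. (\<lambda>j. s j x) \<longlonglongrightarrow> g x"
  shows "smooth_on g UNIV \<and> (\<forall>vs x. (\<lambda>j. higher_deriv (s j) vs x) \<longlonglongrightarrow> higher_deriv g vs x)"
proof -
  have deriv: "\<exists>D. \<forall>x v. (g has_derivative D x) (at x) \<and> (\<lambda>j. frechet_derivative (s j) (at x) v) \<longlonglongrightarrow> D x v"
    if s: "\<And>j. smooth_on (s j) UNIV"
      and u: "\<And>vs. uniformly_convergent_on UNIV (\<lambda>j. higher_deriv (s j) vs)"
      and l: "\<And>x. (\<lambda>j. s j x) \<longlonglongrightarrow> g x"
    for s :: "nat \<Rightarrow> complex \<Rightarrow> complex" and g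
  proof -
    have "\<forall>v. \<exists>D. uniform_limit UNIV (\<lambda>j x. frechet_derivative (s j) (at x) v) D sequentially"
      using u[of "[_]"] by (auto simp: uniformly_convergent_on_def higher_deriv_eqs simp del: higher_deriv.simps)
    then obtain D where D: "\<And>v. uniform_limit UNIV (\<lambda>j x. frechet_derivative (s j) (at x) v) (D v) sequentially"
      by metis
    have "(g has_derivative (\<lambda>v. D v x)) (at x)" for x
      by (rule frechet_derivative_limit[where s = s and D = "\<lambda>x v. D v x"])
        (use smooth_on_diffble[OF s] l D in auto)
    moreover have "(\<lambda>j. frechet_derivative (s j) (at x) v) \<longlonglongrightarrow> D v x" for x v
      using tendsto_uniform_limitI[OF D] by blast
    ultimately show ?thesis by (intro exI[of _ "\<lambda>x v. D v x"]) blast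
  qed
  have deriv': "g differentiable (at x)" "(\<lambda>j. frechet_derivative (s j) (at x) v) \<longlonglongrightarrow> frechet_derivative g (at x) v"
    if A: "\<And>j. smooth_on (s j) UNIV" "\<And>vs. uniformly_convergent_on UNIV (\<lambda>j. higher_deriv (s j) vs)"
      "\<And>x. (\<lambda>j. s j x) \<longlonglongrightarrow> g x" for s :: "nat \<Rightarrow> complex \<Rightarrow> complex" and g x v
  proof -
    obtain D where D: "\<And>x v. (g has_derivative D x) (at x)" "\<And>x v. (\<lambda>j. frechet_derivative (s j) (at x) v) \<longlonglongrightarrow> D x v"
      using deriv[OF A] by blast
    then show "g differentiable (at x)" "(\<lambda>j. frechet_derivative (s j) (at x) v) \<longlonglongrightarrow> frechet_derivative g (at x) v"
      using frechet_derivative_at[OF D(1)[of x]] D(2)[of x v] by (auto simp: differentiable_def)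
  qed
  have C: "C_k_on k g UNIV"
    if "\<And>j. smooth_on (s j) UNIV" "\<And>vs. uniformly_convergent_on UNIV (\<lambda>j. higher_deriv (s j) vs)"
      "\<And>x. (\<lambda>j. s j x) \<longlonglongrightarrow> g x" for k and s :: "nat \<Rightarrow> complex \<Rightarrow> complex" and g
    using that
  proof (induction k arbitrary: s g)
    case 0
    show ?case using deriv'(1)[OF 0]
      by (simp add: continuous_at_imp_continuous_on differentiable_imp_continuous_within)
  next
    case (Suc k)
    have "C_k_on k (\<lambda>x. frechet_derivative g (at x) v) UNIV" for v
    proof (rule Suc.IH[where s = "\<lambda>j x. frechet_derivative (s j) (at x) v"])
      show "uniformly_convergent_on UNIV (\<lambda>j. higher_deriv (\<lambda>x. frechet_derivative (s j) (at x) v) vs)" for vs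
        using Suc.prems(2)[of "vs @ [v]"] by (simp add: higher_deriv_append_single)
    qed (use smooth_on_frechet[OF Suc.prems(1)] deriv'(2)[OF Suc.prems] in auto)
    then show ?case using deriv'(1)[OF Suc.prems] by simp
  qed
  have H: "(\<lambda>j. higher_deriv (s j) vs x) \<longlonglongrightarrow> higher_deriv g vs x" for vs x
  proof (induction vs arbitrary: x)
    case Nil
    then show ?case using assms(3) by simp
  next
    case (Cons v vs)
    have "uniformly_convergent_on UNIV (\<lambda>j. higher_deriv (higher_deriv (s j) vs) ws)" for ws
    proof -
      show ?thesis using assms(2)[of "ws @ vs"] by (simp add: higher_deriv_append)
    qed
    then have "(\<lambda>j. frechet_derivative (higher_deriv (s j) vs) (at x) v) \<longlonglongrightarrow> frechet_derivative (higher_deriv g vs) (at x) v"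
      by (rule deriv'(2)[OF smooth_on_higher_deriv[OF assms(1)] _ Cons])
    then show ?case by simp
  qed
  show ?thesis using C[OF assms] H by (auto simp: smooth_on_def)
qed

section \<open>Sequences with summable increments\<close>

lemma uniformly_convergent_on_telescope:
  fixes h :: "nat \<Rightarrow> 'a \<Rightarrow> 'b::banach"
  assumes inc: "\<And>i x. N \<le> i \<Longrightarrow> x \<in> S \<Longrightarrow> norm (h (Suc i) x - h i x) \<le> b i" and b: "summable b"
  shows "uniformly_convergent_on S h"
proof -
  have "uniformly_convergent_on S (\<lambda>n x. \<Sum>i<n. h (Suc (i + N)) x - h (i + N) x)"
    by (rule Weierstrass_m_test'[where M = "\<lambda>i. b (i + N)"]) (use inc b in \<open>auto simp: summable_iff_shift\<close>)
  then have "uniformly_convergent_on S (\<lambda>n x. h (n + N) x - h N x)"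
    by (simp add: sum_lessThan_telescope[of "\<lambda>i. h (i + N) _", simplified])
  then obtain l where "uniform_limit S (\<lambda>n x. h (n + N) x - h N x) l sequentially"
    by (auto simp: uniformly_convergent_on_def)
  then have "uniform_limit S (\<lambda>n x. (h (n + N) x - h N x) + h N x) (\<lambda>x. l x + h N x) sequentially"
    by (intro uniform_limit_add uniform_limit_const)
  then have "uniform_limit S (\<lambda>n. h (n + N)) (\<lambda>x. l x + h N x) sequentially" by simp
  then have "uniform_limit S h (\<lambda>x. l x + h N x) sequentially"
    unfolding uniform_limit_iff by (subst (asm) eventually_sequentially_seg)
  then show ?thesis by (auto simp: uniformly_convergent_on_def)
qed

text \<open>The order of the controlled derivatives grows with \<open>j\<close>. Each fixed
  derivative is thus controlled from some index on, and the limit is smooth rather than merely of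
  class C^m.\<close>

lemma smooth_telescope:
  fixes s :: "nat \<Rightarrow> complex \<Rightarrow> complex"
  assumes s: "\<And>j. smooth_on (s j) UNIV"
    and bd: "\<And>j vs x. length vs \<le> m + j \<Longrightarrow> (\<forall>v\<in>set vs. norm v \<le> 1) \<Longrightarrow>
      norm (higher_deriv (\<lambda>x. s (Suc j) x - s j x) vs x) \<le> b j"
    and b: "summable b"
  shows "\<exists>g. smooth_on g UNIV \<and> (\<forall>vs x. (\<lambda>j. higher_deriv (s j) vs x) \<longlonglongrightarrow> higher_deriv g vs x)"
proof -
  have bd': "norm (higher_deriv (s (Suc j)) vs x - higher_deriv (s j) vs x) \<le> b j"
    if "length vs \<le> m + j" "\<forall>v\<in>set vs. norm v \<le> 1" for j vs x
    using bd[OF that] by (simp add: higher_deriv_diff s)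
  \<comment> \<open>The bounds are available for directions of norm at most 1 only. Homogeneity
    reduces arbitrary directions to their \<open>sgn\<close>, with a factor that depends neither on
    \<open>j\<close> nor on \<open>x\<close>.\<close>
  have scale: "\<exists>c. \<forall>j x. higher_deriv (s j) vs x = c *\<^sub>R higher_deriv (s j) (map sgn vs) x" for vs
  proof (induction vs)
    case Nil
    show ?case by (rule exI[of _ 1]) simp
  next
    case (Cons v vs)
    then obtain c where c: "\<And>j x. higher_deriv (s j) vs x = c *\<^sub>R higher_deriv (s j) (map sgn vs) x" by blast
    define h where "h = (\<lambda>j. higher_deriv (s j) (map sgn vs))"
    have sm: "smooth_on (h j) UNIV" for j unfolding h_def by (intro smooth_on_higher_deriv s)
    have "frechet_derivative (higher_deriv (s j) vs) (at x) v = (c * norm v) *\<^sub>R frechet_derivative (h j) (at x) (sgn v)" for j x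
    proof -
      have d: "h j differentiable (at x)" using smooth_on_diffble[OF sm] by blast
      have eq: "higher_deriv (s j) vs = (\<lambda>x. c *\<^sub>R h j x)" using c by (auto simp: h_def)
      have "frechet_derivative (higher_deriv (s j) vs) (at x) = (\<lambda>v. c *\<^sub>R frechet_derivative (h j) (at x) v)"
        unfolding eq by (rule frechet_derivative_at[symmetric]) (intro has_derivative_scaleR_right has_frechet_derivative d)
      moreover have "frechet_derivative (h j) (at x) v = norm v *\<^sub>R frechet_derivative (h j) (at x) (sgn v)"
        using linear_cmul[OF linear_frechet_derivative[OF d], of "norm v" "sgn v"]
        by (cases "v = 0") (simp_all add: sgn_div_norm linear_0[OF linear_frechet_derivative[OF d]])
      ultimately show ?thesis by simp
    qed
    then show ?case unfolding h_def by (intro exI[of _ "c * norm v"]) simp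
  qed
  have conv: "uniformly_convergent_on UNIV (\<lambda>j. higher_deriv (s j) vs)" for vs
  proof -
    define h where "h = (\<lambda>j. higher_deriv (s j) (map sgn vs))"
    obtain c where c: "\<And>j x. higher_deriv (s j) vs x = c *\<^sub>R h j x"
      using scale[of vs] by (auto simp: h_def)
    define N where "N = length vs"
    have inc: "norm (h (Suc j) x - h j x) \<le> b j" if "N \<le> j" for j x
      unfolding h_def by (rule bd') (use that in \<open>auto simp: N_def norm_sgn\<close>)
    have "uniformly_convergent_on UNIV h"
      by (rule uniformly_convergent_on_telescope[OF _ b]) (rule inc)
    then obtain l where "uniform_limit UNIV h l sequentially"
      by (auto simp: uniformly_convergent_on_def)
    then have "uniform_limit UNIV (\<lambda>j x. c *\<^sub>R h j x) (\<lambda>x. c *\<^sub>R l x) sequentially"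
      by (rule bounded_linear.uniform_limit[OF bounded_linear_scaleR_right])
    moreover have "(\<lambda>j x. c *\<^sub>R h j x) = (\<lambda>j. higher_deriv (s j) vs)" using c by (auto simp: fun_eq_iff)
    ultimately show ?thesis by (auto simp: uniformly_convergent_on_def)
  qed
  obtain g where g: "uniform_limit UNIV s g sequentially"
    using conv[of "[]"] by (auto simp: uniformly_convergent_on_def higher_deriv_eqs simp del: higher_deriv.simps)
  have "(\<lambda>j. s j x) \<longlonglongrightarrow> g x" for x by (rule tendsto_uniform_limitI[OF g]) simp
  from smooth_limit[OF s conv this] show ?thesis by blast
qed

section \<open>Bump functions\<close>

text \<open>The powers of 1/t make the family closed under differentiation up to linear
  combinations, so one induction over all \<open>m\<close> proves smoothness.\<close>

definition flat :: "nat \<Rightarrow> real \<Rightarrow> real" where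
  "flat m t = (if t > 0 then inverse t ^ m * exp (- inverse t) else 0)"

lemma flat_nonneg: "0 \<le> flat m t"
  by (simp add: flat_def)

text \<open>One term of the exponential series bounds exp (1/t) from below. The square on the right
  makes the difference quotient at 0 vanish in the limit.\<close>

lemma flat_le: "flat m t \<le> fact (m + 2) * t\<^sup>2"
proof (cases "t > 0")
  case True
  define x where "x = inverse t"
  have x: "x > 0" using True by (simp add: x_def)
  have "x ^ (m + 2) / fact (m + 2) \<le> exp x"
    using sum_le_suminf[OF summable_exp[of x], of "{m + 2}"] x
    by (simp add: exp_def divide_inverse mult.commute)
  then have "x ^ m * x\<^sup>2 \<le> fact (m + 2) * exp x"
    by (simp add: pos_divide_le_eq power_add[symmetric] mult.commute del: fact_Suc)
  then have "x ^ m * x\<^sup>2 * exp (- x) \<le> fact (m + 2) * exp x * exp (- x)"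
    by (rule mult_right_mono) simp
  then have "x ^ m * x\<^sup>2 * exp (- x) \<le> fact (m + 2)"
    by (simp add: exp_minus_inverse mult.assoc del: fact_Suc)
  then have "x ^ m * x\<^sup>2 * exp (- x) * t\<^sup>2 \<le> fact (m + 2) * t\<^sup>2"
    by (rule mult_right_mono) simp
  moreover have "x\<^sup>2 * t\<^sup>2 = 1" using True by (simp add: x_def field_simps)
  then have "x ^ m * x\<^sup>2 * exp (- x) * t\<^sup>2 = x ^ m * exp (- x)"
    by (metis (no_types, lifting) mult.assoc mult.commute mult.right_neutral)
  moreover have "flat m t = x ^ m * exp (- x)" using True by (simp add: flat_def x_def)
  ultimately show ?thesis by (simp only:)
qed (simp add: flat_def)

lemma flat_has_derivative:
  "(flat m has_real_derivative (flat (m + 2) t - of_nat m * flat (m + 1) t)) (at t)"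
proof -
  consider "t > 0" | "t < 0" | "t = 0" by linarith
  then show ?thesis
  proof cases
    case 1
    have "((\<lambda>t. inverse t ^ m * exp (- inverse t)) has_real_derivative
        (flat (m + 2) t - of_nat m * flat (m + 1) t)) (at t)"
      using 1 by (auto intro!: derivative_eq_intros simp: flat_def)
        (cases m; simp add: field_simps power2_eq_square)
    then show ?thesis
      by (rule has_field_derivative_transform_within_open[where S = "{0<..}"]) (use 1 in \<open>auto simp: flat_def\<close>)
  next
    case 2
    have "((\<lambda>t. 0) has_real_derivative (flat (m + 2) t - of_nat m * flat (m + 1) t)) (at t)"
      using 2 by (simp add: flat_def)
    then show ?thesis
      by (rule has_field_derivative_transform_within_open[where S = "{..<0}"]) (use 2 in \<open>auto simp: flat_def\<close>)
  next
    case 3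
    have "((\<lambda>h. flat m h / h) \<longlongrightarrow> 0) (at 0)"
    proof (rule Lim_null_comparison)
      show "\<forall>\<^sub>F h in at 0. norm (flat m h / h) \<le> fact (m + 2) * \<bar>h\<bar>"
      proof (rule eventually_mono[OF eventually_neq_at_within[of 0]])
        fix h :: real assume "h \<noteq> 0"
        then show "norm (flat m h / h) \<le> fact (m + 2) * \<bar>h\<bar>"
          using flat_le[of m h] flat_nonneg[of m h]
          by (simp add: divide_le_eq power2_eq_square mult.assoc abs_mult[symmetric] del: fact_Suc)
      qed
      show "((\<lambda>h. fact (m + 2) * \<bar>h\<bar>) \<longlongrightarrow> (0::real)) (at 0)"
        by (rule tendsto_eq_intros refl | simp)+
    qed
    then show ?thesis using 3 by (simp add: DERIV_def flat_def)
  qed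
qed

lemma C_k_on_flat: "C_k_on k (flat m) UNIV"
proof (induction k arbitrary: m)
  case 0
  show ?case using DERIV_isCont[OF flat_has_derivative] by (simp add: continuous_at_imp_continuous_on)
next
  case (Suc k)
  show ?case
  proof (rule C_k_on_SucI[where f' = "\<lambda>t v. (flat (m + 2) t - of_nat m * flat (m + 1) t) * v"])
    show "(flat m has_derivative (*) (flat (m + 2) t - of_nat m * flat (m + 1) t)) (at t)" for t
      using flat_has_derivative by (simp add: has_field_derivative_def)
    show "C_k_on k (\<lambda>t. (flat (m + 2) t - of_nat m * flat (m + 1) t) * v) UNIV" for v
      by (intro C_k_on_mult C_k_on_diff C_k_on_const Suc open_UNIV)
  qed auto
qed

definition smooth_step :: "real \<Rightarrow> real" where
  "smooth_step t = flat 0 t * inverse (flat 0 t + flat 0 (1 - t))"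

lemma smooth_step_denom: "flat 0 t + flat 0 (1 - t) \<noteq> 0"
  by (cases "t > 0") (auto simp: flat_def add_nonneg_eq_0_iff)

lemma smooth_step_0: "t \<le> 0 \<Longrightarrow> smooth_step t = 0"
  and smooth_step_1: "t \<ge> 1 \<Longrightarrow> smooth_step t = 1"
  by (auto simp: smooth_step_def flat_def)

lemma C_k_on_smooth_step: "C_k_on k smooth_step UNIV"
proof -
  have "C_k_on k (\<lambda>t. flat 0 (1 - t)) UNIV"
    by (rule C_k_on_compose[OF open_UNIV open_UNIV C_k_on_diff[OF open_UNIV C_k_on_const C_k_on_linear] C_k_on_flat])
      (auto intro: bounded_linear_ident)
  then show ?thesis unfolding smooth_step_def[abs_def]
    by (intro C_k_on_mult C_k_on_inverse C_k_on_add C_k_on_flat open_UNIV smooth_step_denom)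
qed

text \<open>The argument of \<open>smooth_step\<close> is at least 1 up to distance r/2 from
  \<open>c\<close> and at most 0 from distance 3r/4 on. Using the squared distance keeps it smooth
  at the centre.\<close>

definition ball_bump :: "complex \<Rightarrow> real \<Rightarrow> complex \<Rightarrow> real" where
  "ball_bump c r z = smooth_step (9 / 5 - 16 / (5 * r\<^sup>2) * ((z - c) \<bullet> (z - c)))"

lemma smooth_on_ball_bump: "smooth_on (ball_bump c r) UNIV"
  unfolding smooth_on_def
proof
  fix k
  have "C_k_on k (\<lambda>z. (z - c) \<bullet> (z - c)) UNIV"
    by (intro bounded_bilinear.C_k_on_bilinear[OF bounded_bilinear_inner] C_k_on_diff
        C_k_on_const C_k_on_linear bounded_linear_ident open_UNIV)
  then have "C_k_on k (\<lambda>z. 9 / 5 - 16 / (5 * r\<^sup>2) * ((z - c) \<bullet> (z - c))) UNIV"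
    by (intro C_k_on_diff C_k_on_mult C_k_on_const open_UNIV)
  from C_k_on_compose[OF open_UNIV open_UNIV this C_k_on_smooth_step]
  show "C_k_on k (ball_bump c r) UNIV" by (simp add: ball_bump_def[abs_def])
qed

lemma ball_bump_1:
  assumes "r > 0" "dist c z < r / 2" shows "ball_bump c r z = 1"
proof -
  have "(norm (z - c))\<^sup>2 \<le> (r / 2)\<^sup>2"
    using assms by (intro power_mono) (auto simp: dist_norm norm_minus_commute)
  then show ?thesis unfolding ball_bump_def using assms(1)
    by (intro smooth_step_1) (simp add: power2_norm_eq_inner[symmetric] field_simps)
qed

lemma ball_bump_0:
  assumes "r > 0" "dist c z \<ge> r" shows "ball_bump c r z = 0"
proof -
  have "r\<^sup>2 \<le> (norm (z - c))\<^sup>2"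
    using assms by (intro power_mono) (auto simp: dist_norm norm_minus_commute)
  moreover have "r\<^sup>2 > 0" using assms by simp
  ultimately have "9 * r\<^sup>2 \<le> 16 * (norm (z - c))\<^sup>2" by linarith
  then show ?thesis unfolding ball_bump_def using assms(1)
    by (intro smooth_step_0) (simp add: power2_norm_eq_inner[symmetric] field_simps)
qed

lemma bump_function_exists:
  fixes K W :: "complex set"
  assumes "compact K" "open W" "K \<subseteq> W"
  obtains \<psi> :: "complex \<Rightarrow> real" and L N
  where "smooth_on \<psi> UNIV" "open N" "K \<subseteq> N" "\<And>z. z \<in> N \<Longrightarrow> \<psi> z = 1"
    "compact L" "L \<subseteq> W" "\<And>z. z \<notin> L \<Longrightarrow> \<psi> z = 0"
proof -
  have "\<forall>x\<in>K. \<exists>r>0. cball x r \<subseteq> W" using assms open_contains_cball by blast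
  then obtain r where r: "\<And>x. x \<in> K \<Longrightarrow> r x > 0 \<and> cball x (r x) \<subseteq> W" by metis
  obtain F where F: "F \<subseteq> K" "finite F" "K \<subseteq> (\<Union>x\<in>F. ball x (r x / 2))"
    by (rule compactE_image[OF assms(1), of K "\<lambda>x. ball x (r x / 2)"]) (use r in auto)
  \<comment> \<open>One vanishing factor, at a point of some half-size ball, gives the value 1; off
    all the closed balls every factor is 1 and the value is 0.\<close>
  define \<psi> where "\<psi> z = 1 - (\<Prod>x\<in>F. 1 - ball_bump x (r x) z)" for z
  have "smooth_on (\<lambda>z. \<Prod>x\<in>F'. 1 - ball_bump x (r x) z) UNIV" for F'
    by (induction F' rule: infinite_finite_induct)
      (auto intro!: smooth_on_const smooth_on_mult smooth_on_diff smooth_on_ball_bump)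
  then have "smooth_on \<psi> UNIV"
    unfolding \<psi>_def by (intro smooth_on_diff smooth_on_const open_UNIV)
  moreover have "\<psi> z = 1" if "z \<in> (\<Union>x\<in>F. ball x (r x / 2))" for z
  proof -
    from that obtain x where x: "x \<in> F" "z \<in> ball x (r x / 2)" ..
    then have "dist x z < r x / 2" by (simp only: mem_ball)
    then have "1 - ball_bump x (r x) z = 0" using ball_bump_1 r F(1) x(1) by auto
    then show ?thesis using x(1) F(2) by (auto simp: \<psi>_def)
  qed
  moreover have "\<psi> z = 0" if "z \<notin> (\<Union>x\<in>F. cball x (r x))" for z
  proof -
    have "(\<Prod>x\<in>F. 1 - ball_bump x (r x) z) = (\<Prod>x\<in>F. 1)"
      using that r F(1) by (intro prod.cong refl) (auto simp: ball_bump_0 not_le subset_iff)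
    then show ?thesis by (simp add: \<psi>_def)
  qed
  moreover have "compact (\<Union>x\<in>F. cball x (r x))" using F(2) by auto
  moreover have "(\<Union>x\<in>F. cball x (r x)) \<subseteq> W" using r F(1) by blast
  ultimately show ?thesis using F(3) by (intro that[of \<psi> "\<Union>x\<in>F. ball x (r x / 2)" "\<Union>x\<in>F. cball x (r x)"]) auto
qed

section \<open>Cutting off holomorphic functions\<close>

lemma compact_thickening:
  fixes L :: "'a::euclidean_space set"
  assumes "compact L" shows "compact (\<Union>x\<in>L. cball x r)"
proof -
  have "(\<Union>x\<in>L. cball x r) = {x + y |x y. x \<in> L \<and> y \<in> cball 0 r}"
  proof (intro set_eqI iffI)
    fix z assume "z \<in> (\<Union>x\<in>L. cball x r)"
    then obtain x where "x \<in> L" "dist x z \<le> r" by auto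
    then have "z = x + (z - x) \<and> x \<in> L \<and> z - x \<in> cball 0 r" by (simp add: dist_norm norm_minus_commute)
    then show "z \<in> {x + y |x y. x \<in> L \<and> y \<in> cball 0 r}" by blast
  next
    fix z assume "z \<in> {x + y |x y. x \<in> L \<and> y \<in> cball 0 r}"
    then obtain x y where "z = x + y" "x \<in> L" "norm y \<le> r" by auto
    then show "z \<in> (\<Union>x\<in>L. cball x r)" by (intro UN_I[of x]) (auto simp: dist_norm)
  qed
  then show ?thesis by (simp only: compact_sums[OF assms compact_cball])
qed

lemma cauchy_deriv_bound_compact:
  assumes "open U" "compact L" "L \<subseteq> U"
  obtains c where "c > 0"
    "\<And>e \<delta> z. e holomorphic_on U \<Longrightarrow> (\<And>z. z \<in> U \<Longrightarrow> norm (e z) \<le> \<delta>) \<Longrightarrow> z \<in> L \<Longrightarrow> norm (deriv e z) \<le> c * \<delta>"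
proof -
  obtain r where r: "r > 0" "(\<Union>x\<in>L. cball x r) \<subseteq> U"
    using compact_subset_open_imp_cball_epsilon_subset[OF assms(2,1,3)] by blast
  have "norm (deriv e z) \<le> inverse r * \<delta>"
    if e: "e holomorphic_on U" and b: "\<And>z. z \<in> U \<Longrightarrow> norm (e z) \<le> \<delta>" and z: "z \<in> L" for e \<delta> z
  proof -
    have sub: "cball z r \<subseteq> U" using r z by blast
    have "norm ((deriv ^^ 1) e z) \<le> fact 1 * \<delta> / r ^ 1"
    proof (rule Cauchy_inequality)
      show "e holomorphic_on ball z r" using holomorphic_on_subset[OF e] sub ball_subset_cball by blast
      show "continuous_on (cball z r) e"
        using holomorphic_on_imp_continuous_on holomorphic_on_subset[OF e] sub by blast
      show "norm (e x) \<le> \<delta>" if "norm (z - x) = r" for x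
        using that sub by (intro b) (auto simp: dist_norm subset_iff)
    qed (rule r)
    then show ?thesis by (simp add: divide_inverse mult.commute)
  qed
  then show ?thesis using that[of "inverse r"] r by simp
qed

text \<open>Nothing is known about \<open>e\<close> off \<open>W\<close>, so its values there must
  be discarded explicitly. The extension by zero is smooth as soon as the weight vanishes off a
  compact subset of \<open>W\<close>.\<close>

definition cutoff :: "complex set \<Rightarrow> (complex \<Rightarrow> real) \<Rightarrow> (complex \<Rightarrow> complex) \<Rightarrow> complex \<Rightarrow> complex" where
  "cutoff W \<psi> e z = (if z \<in> W then \<psi> z *\<^sub>R e z else 0)"

lemma smooth_on_cutoff:
  assumes "open W" "compact L" "L \<subseteq> W" "smooth_on \<psi> UNIV" "\<And>z. z \<notin> L \<Longrightarrow> \<psi> z = 0" "smooth_on e W"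
  shows "smooth_on (cutoff W \<psi> e) UNIV"
proof -
  have "smooth_on \<psi> W"
    using assms(4) C_k_on_subset[OF _ subset_UNIV] unfolding smooth_on_def by blast
  then have "smooth_on (\<lambda>z. \<psi> z *\<^sub>R e z) W"
    by (intro smooth_on_scaleR assms)
  then have 1: "smooth_on (cutoff W \<psi> e) W"
    by (rule smooth_on_cong[OF assms(1), rotated]) (simp add: cutoff_def)
  have cl: "open (- L)" using assms(2) by (simp add: compact_imp_closed open_Compl)
  have 2: "smooth_on (cutoff W \<psi> e) (- L)"
    by (rule smooth_on_cong[OF cl _ smooth_on_const[of 0]]) (simp add: cutoff_def assms(5))
  have "W \<union> - L = UNIV" using assms(3) by auto
  then show ?thesis using smooth_on_union[OF assms(1) cl 1 2] by simp
qed

text \<open>Derivatives of cut-off holomorphic functions are combinations of such functions, with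
  the partial derivatives of the weight or with \<open>deriv e\<close>. This drives the induction on
  the order below.\<close>

lemma cutoff_frechet_derivative:
  assumes "open W" "compact L" "L \<subseteq> W" "smooth_on \<psi> UNIV" "\<And>z. z \<notin> L \<Longrightarrow> \<psi> z = 0" "e holomorphic_on W"
  shows "frechet_derivative (cutoff W \<psi> e) (at z) v =
    Re v *\<^sub>R cutoff W (\<lambda>z. frechet_derivative \<psi> (at z) 1) e z
    + Im v *\<^sub>R cutoff W (\<lambda>z. frechet_derivative \<psi> (at z) \<i>) e z
    + v * cutoff W \<psi> (deriv e) z"
proof (cases "z \<in> W")
  case True
  have d\<psi>: "\<psi> differentiable (at z)" using smooth_on_diffble[OF assms(4)] by blast
  have "((\<lambda>z. \<psi> z *\<^sub>R e z) has_derivative (\<lambda>v. \<psi> z *\<^sub>R (deriv e z * v) + frechet_derivative \<psi> (at z) v *\<^sub>R e z)) (at z)"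
    by (intro has_derivative_scaleR has_frechet_derivative[OF d\<psi>] has_field_derivative_imp_has_derivative
        holomorphic_derivI[OF assms(6,1) True])
  then have "(cutoff W \<psi> e has_derivative (\<lambda>v. \<psi> z *\<^sub>R (deriv e z * v) + frechet_derivative \<psi> (at z) v *\<^sub>R e z)) (at z)"
    by (rule has_derivative_transform_within_open[OF _ assms(1) True]) (simp add: cutoff_def)
  then have "frechet_derivative (cutoff W \<psi> e) (at z) v = \<psi> z *\<^sub>R (deriv e z * v) + frechet_derivative \<psi> (at z) v *\<^sub>R e z"
    by (simp add: frechet_derivative_at[symmetric])
  moreover have "frechet_derivative \<psi> (at z) v = Re v * frechet_derivative \<psi> (at z) 1 + Im v * frechet_derivative \<psi> (at z) \<i>"
    using complex_linear_combination[OF linear_frechet_derivative[OF d\<psi>], of v] by simp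
  ultimately show ?thesis using True by (simp add: cutoff_def algebra_simps)
next
  case False
  have cl: "open (- L)" using assms(2) by (simp add: compact_imp_closed open_Compl)
  have "frechet_derivative (cutoff W \<psi> e) (at z) = frechet_derivative (\<lambda>_. 0) (at z)"
    by (rule frechet_derivative_cong_open[OF cl]) (use False assms(3,5) in \<open>auto simp: cutoff_def\<close>)
  then show ?thesis using False by (simp add: cutoff_def)
qed

text \<open>The constant depends on the weight, the set and the order, but not on \<open>e\<close>:
  smallness of a holomorphic function in the sup norm becomes smallness of its cut-off in every C^k
  norm.\<close>

lemma cutoff_higher_deriv_bound:
  assumes "compact L" "\<And>z. z \<notin> L \<Longrightarrow> \<psi> z = 0" "smooth_on \<psi> UNIV" "open W" "L \<subseteq> W"
  shows "\<exists>A>0. \<forall>e \<eta> vs z. e holomorphic_on W \<longrightarrow> (\<forall>z\<in>W. norm (e z) \<le> \<eta>) \<longrightarrow>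
    length vs = k \<longrightarrow> (\<forall>v\<in>set vs. norm v \<le> 1) \<longrightarrow> 0 \<le> \<eta> \<longrightarrow> norm (higher_deriv (cutoff W \<psi> e) vs z) \<le> A * \<eta>"
  using assms(2-5)
proof (induction k arbitrary: \<psi> W)
  case 0
  have "bounded ((\<lambda>z. norm (\<psi> z)) ` L)"
    using 0(2) assms(1) unfolding smooth_on_def
    by (intro compact_imp_bounded compact_continuous_image continuous_on_norm C_k_on_continuous[OF C_k_on_subset[OF _ subset_UNIV]]) auto
  then obtain B where B: "\<And>z. z \<in> L \<Longrightarrow> \<bar>\<psi> z\<bar> \<le> B" by (auto simp: bounded_iff)
  have "norm (cutoff W \<psi> e z) \<le> (\<bar>B\<bar> + 1) * \<eta>"
    if "\<forall>z\<in>W. norm (e z) \<le> \<eta>" "0 \<le> \<eta>" for e z and \<eta> :: real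
  proof (cases "z \<in> L")
    case True
    then show ?thesis using B[OF True] that 0(4) by (auto simp: cutoff_def intro!: mult_mono)
  qed (use 0(1) that in \<open>auto simp: cutoff_def\<close>)
  then show ?case by (intro exI[of _ "\<bar>B\<bar> + 1"]) auto
next
  case (Suc k)
  note supp = Suc.prems(1) and sm = Suc.prems(2) and W = Suc.prems(3,4)
  obtain r where r: "r > 0" "(\<Union>x\<in>L. cball x r) \<subseteq> W"
    using compact_subset_open_imp_cball_epsilon_subset[OF assms(1) W] by blast
  \<comment> \<open>Cauchy's estimate controls \<open>deriv e\<close> only on compact parts of
    \<open>W\<close>. The induction hypothesis is therefore applied on the smaller set
    \<open>V\<close>, whose compact hull \<open>K\<close> lies in \<open>W\<close>; the cut-off
    itself does not change, since the weight vanishes off \<open>L\<close>.\<close>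
  define V where "V = (\<Union>x\<in>L. ball x (r/2))"
  have V: "open V" "L \<subseteq> V" "V \<subseteq> W"
  proof -
    show "open V" unfolding V_def by blast
    show "L \<subseteq> V" using r(1) by (force simp: V_def)
    have "ball x (r/2) \<subseteq> cball x r" for x using r(1) by (auto simp: subset_iff)
    then show "V \<subseteq> W" using r(2) unfolding V_def by blast
  qed
  define K where "K = (\<Union>x\<in>L. cball x (r/2))"
  have K: "compact K" "V \<subseteq> K" "K \<subseteq> W"
  proof -
    show "compact K" unfolding K_def by (rule compact_thickening[OF assms(1)])
    show "V \<subseteq> K" unfolding V_def K_def by (intro UN_mono ball_subset_cball) simp
    have "cball x (r/2) \<subseteq> cball x r" for x using r(1) by (intro subset_cball) simp
    then show "K \<subseteq> W" using r(2) unfolding K_def by blast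
  qed
  obtain c where c: "c > 0" "\<And>e \<delta> z. e holomorphic_on W \<Longrightarrow> (\<And>z. z \<in> W \<Longrightarrow> norm (e z) \<le> \<delta>) \<Longrightarrow> z \<in> K \<Longrightarrow> norm (deriv e z) \<le> c * \<delta>"
    using cauchy_deriv_bound_compact[OF W(1) K(1,3)] by blast
  have D0: "frechet_derivative \<psi> (at z) v = 0" if "z \<notin> L" for z v
  proof -
    have "open (- L)" using assms(1) by (simp add: compact_imp_closed open_Compl)
    then have "frechet_derivative \<psi> (at z) = frechet_derivative (\<lambda>_. 0) (at z)"
      by (rule frechet_derivative_cong_open) (use that supp in auto)
    then show ?thesis by simp
  qed
  define \<psi>1 \<psi>2 where "\<psi>1 = (\<lambda>z. frechet_derivative \<psi> (at z) 1)" and "\<psi>2 = (\<lambda>z. frechet_derivative \<psi> (at z) \<i>)"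
  have sm12: "smooth_on \<psi>1 UNIV" "smooth_on \<psi>2 UNIV" unfolding \<psi>1_def \<psi>2_def by (intro smooth_on_frechet sm)+
  obtain A where A: "A > 0" "\<And>e \<eta> vs z. e holomorphic_on V \<Longrightarrow> (\<forall>z\<in>V. norm (e z) \<le> \<eta>) \<Longrightarrow>
    length vs = k \<Longrightarrow> (\<forall>v\<in>set vs. norm v \<le> 1) \<Longrightarrow> 0 \<le> \<eta> \<Longrightarrow> norm (higher_deriv (cutoff V \<psi> e) vs z) \<le> A * \<eta>"
    using Suc.IH[OF supp sm V(1,2)] by blast
  obtain A1 where A1: "A1 > 0" "\<And>e \<eta> vs z. e holomorphic_on V \<Longrightarrow> (\<forall>z\<in>V. norm (e z) \<le> \<eta>) \<Longrightarrow>
    length vs = k \<Longrightarrow> (\<forall>v\<in>set vs. norm v \<le> 1) \<Longrightarrow> 0 \<le> \<eta> \<Longrightarrow> norm (higher_deriv (cutoff V \<psi>1 e) vs z) \<le> A1 * \<eta>"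
    using Suc.IH[OF _ sm12(1) V(1,2)] D0 unfolding \<psi>1_def by blast
  obtain A2 where A2: "A2 > 0" "\<And>e \<eta> vs z. e holomorphic_on V \<Longrightarrow> (\<forall>z\<in>V. norm (e z) \<le> \<eta>) \<Longrightarrow>
    length vs = k \<Longrightarrow> (\<forall>v\<in>set vs. norm v \<le> 1) \<Longrightarrow> 0 \<le> \<eta> \<Longrightarrow> norm (higher_deriv (cutoff V \<psi>2 e) vs z) \<le> A2 * \<eta>"
    using Suc.IH[OF _ sm12(2) V(1,2)] D0 unfolding \<psi>2_def by blast
  have "norm (higher_deriv (cutoff W \<psi> e) ws z) \<le> (A1 + A2 + A * c) * \<eta>"
    if e: "e holomorphic_on W" and b: "\<forall>z\<in>W. norm (e z) \<le> \<eta>" and l: "length ws = Suc k"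
      and n: "\<forall>v\<in>set ws. norm v \<le> 1" and \<eta>: "0 \<le> \<eta>" for e \<eta> ws z
  proof -
    obtain vs v where ws: "ws = vs @ [v]" using l by (metis length_Suc_conv_rev)
    have lv: "length vs = k" "\<forall>v\<in>set vs. norm v \<le> 1" "norm v \<le> 1" using ws l n by auto
    have eV: "e holomorphic_on V" using e V(3) holomorphic_on_subset by blast
    have dV: "deriv e holomorphic_on V" using holomorphic_deriv[OF eV V(1)] .
    have VW: "cutoff W \<psi> e = cutoff V \<psi> e"
      using supp V by (auto simp: cutoff_def fun_eq_iff)
    have sme: "smooth_on (cutoff V \<psi>' f) UNIV"
      if "smooth_on \<psi>' UNIV" "\<And>z. z \<notin> L \<Longrightarrow> \<psi>' z = 0" "f holomorphic_on V" for \<psi>' f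
      using smooth_on_cutoff[OF V(1) assms(1) V(2) that(1,2)] smooth_on_holomorphic[OF V(1) that(3)] by blast
    define g1 g2 g3 where "g1 = cutoff V \<psi>1 e" and "g2 = cutoff V \<psi>2 e" and "g3 = cutoff V \<psi> (\<lambda>z. v * deriv e z)"
    have g: "smooth_on g1 UNIV" "smooth_on g2 UNIV" "smooth_on g3 UNIV"
      unfolding g1_def g2_def g3_def
      using sm12 sm supp D0 eV dV by (auto simp: \<psi>1_def \<psi>2_def intro!: sme holomorphic_intros)
    have fd: "(\<lambda>z. frechet_derivative (cutoff W \<psi> e) (at z) v) = (\<lambda>z. (Re v *\<^sub>R g1 z + Im v *\<^sub>R g2 z) + g3 z)"
    proof
      fix z
      have "frechet_derivative (cutoff V \<psi> e) (at z) v =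
          Re v *\<^sub>R g1 z + Im v *\<^sub>R g2 z + v * cutoff V \<psi> (deriv e) z"
        unfolding g1_def g2_def \<psi>1_def \<psi>2_def
        by (rule cutoff_frechet_derivative[OF V(1) assms(1) V(2) sm _ eV]) (rule supp)
      then show "frechet_derivative (cutoff W \<psi> e) (at z) v = (Re v *\<^sub>R g1 z + Im v *\<^sub>R g2 z) + g3 z"
        by (simp add: VW g3_def cutoff_def)
    qed
    have sr: "smooth_on (\<lambda>z. t *\<^sub>R h z) UNIV" if "smooth_on h UNIV" for t :: real and h :: "complex \<Rightarrow> complex"
      using smooth_on_scaleR[OF open_UNIV smooth_on_const that] .
    have "higher_deriv (cutoff W \<psi> e) ws z = Re v *\<^sub>R higher_deriv g1 vs z + Im v *\<^sub>R higher_deriv g2 vs z + higher_deriv g3 vs z"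
      unfolding ws higher_deriv_append_single fd
      by (simp add: higher_deriv_add higher_deriv_scaleR_const smooth_on_add sr g)
    also have "norm \<dots> \<le> \<bar>Re v\<bar> * norm (higher_deriv g1 vs z) + \<bar>Im v\<bar> * norm (higher_deriv g2 vs z) + norm (higher_deriv g3 vs z)"
      by (intro norm_triangle_le add_mono) auto
    also have "\<dots> \<le> 1 * (A1 * \<eta>) + 1 * (A2 * \<eta>) + A * (c * \<eta>)"
    proof (intro add_mono mult_mono)
      show "\<bar>Re v\<bar> \<le> 1" "\<bar>Im v\<bar> \<le> 1" using abs_Re_le_cmod[of v] abs_Im_le_cmod[of v] lv(3) by linarith+
      show "norm (higher_deriv g1 vs z) \<le> A1 * \<eta>" unfolding g1_def
        by (rule A1(2)[OF eV _ lv(1,2) \<eta>]) (use b V(3) in auto)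
      show "norm (higher_deriv g2 vs z) \<le> A2 * \<eta>" unfolding g2_def
        by (rule A2(2)[OF eV _ lv(1,2) \<eta>]) (use b V(3) in auto)
      show "norm (higher_deriv g3 vs z) \<le> A * (c * \<eta>)" unfolding g3_def
      proof (rule A(2)[OF _ _ lv(1,2)])
        show "(\<lambda>z. v * deriv e z) holomorphic_on V" by (intro holomorphic_on_mult holomorphic_on_const dV)
        show "\<forall>z\<in>V. cmod (v * deriv e z) \<le> c * \<eta>"
        proof
          fix z assume "z \<in> V"
          then have d: "norm (deriv e z) \<le> c * \<eta>" using c(2)[OF e, of \<eta> z] b K(2) by auto
          show "cmod (v * deriv e z) \<le> c * \<eta>"
            using mult_mono[OF lv(3) d] by (simp add: norm_mult)
        qed
        show "0 \<le> c * \<eta>" using c \<eta> by simp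
      qed
    qed auto
    finally show ?thesis by (simp add: algebra_simps)
  qed
  then show ?case using A(1) A1(1) A2(1) c(1) by (intro exI[of _ "A1 + A2 + A * c"] conjI) (auto intro!: add_pos_pos)
qed

lemma cutoff_higher_deriv_bound_upto:
  assumes "compact L" "\<And>z. z \<notin> L \<Longrightarrow> \<psi> z = 0" "smooth_on \<psi> UNIV" "open W" "L \<subseteq> W"
  obtains A where "A > 0" "\<And>e \<eta> vs z. e holomorphic_on W \<Longrightarrow> (\<forall>z\<in>W. norm (e z) \<le> \<eta>) \<Longrightarrow> 0 \<le> \<eta> \<Longrightarrow>
    length vs \<le> k \<Longrightarrow> (\<forall>v\<in>set vs. norm v \<le> 1) \<Longrightarrow> norm (higher_deriv (cutoff W \<psi> e) vs z) \<le> A * \<eta>"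
proof -
  have "\<forall>k. \<exists>A>0. \<forall>e \<eta> vs z. e holomorphic_on W \<longrightarrow> (\<forall>z\<in>W. norm (e z) \<le> \<eta>) \<longrightarrow>
    length vs = k \<longrightarrow> (\<forall>v\<in>set vs. norm v \<le> 1) \<longrightarrow> 0 \<le> \<eta> \<longrightarrow> norm (higher_deriv (cutoff W \<psi> e) vs z) \<le> A * \<eta>"
    using cutoff_higher_deriv_bound[OF assms] by blast
  then obtain A where A: "\<And>k. A k > 0" "\<And>e \<eta> vs z. e holomorphic_on W \<Longrightarrow> (\<forall>z\<in>W. norm (e z) \<le> \<eta>) \<Longrightarrow>
    (\<forall>v\<in>set vs. norm v \<le> 1) \<Longrightarrow> 0 \<le> \<eta> \<Longrightarrow> norm (higher_deriv (cutoff W \<psi> e) vs z) \<le> A (length vs) * \<eta>"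
    by metis
  have le: "A i \<le> (\<Sum>j\<le>k. A j)" if "i \<le> k" for i
    using that A(1) by (intro member_le_sum) (auto intro: less_imp_le)
  have "(\<Sum>j\<le>k. A j) > 0" using A(1) by (intro sum_pos) auto
  moreover have "norm (higher_deriv (cutoff W \<psi> e) vs z) \<le> (\<Sum>j\<le>k. A j) * \<eta>"
    if "e holomorphic_on W" "\<forall>z\<in>W. norm (e z) \<le> \<eta>" "0 \<le> \<eta>" "length vs \<le> k" "\<forall>v\<in>set vs. norm v \<le> 1" for e \<eta> vs z
    using A(2)[OF that(1,2,5,3), of z] mult_right_mono[OF le[OF that(4)] that(3)] by linarith
  ultimately show ?thesis by (rule that)
qed

section \<open>Perturbing solutions of functional equations\<close>

lemma finite_isolating_radius:
  fixes C A :: "complex set"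
  assumes "finite C" "open A" "C \<subseteq> A"
  obtains R where "R > 0" "\<And>c. c \<in> C \<Longrightarrow> ball c R \<subseteq> A" "\<And>c c'. c \<in> C \<Longrightarrow> c' \<in> C \<Longrightarrow> c \<noteq> c' \<Longrightarrow> R \<le> dist c c'"
proof -
  have "\<forall>c\<in>C. \<exists>\<rho>>0. ball c \<rho> \<subseteq> A - (C - {c})"
  proof
    fix c assume "c \<in> C"
    have "open (A - (C - {c}))" using assms by (intro open_Diff) (auto intro: finite_imp_closed)
    then show "\<exists>\<rho>>0. ball c \<rho> \<subseteq> A - (C - {c})"
      using \<open>c \<in> C\<close> assms(3) unfolding open_contains_ball by blast
  qed
  then obtain \<rho> where \<rho>: "\<And>c. c \<in> C \<Longrightarrow> \<rho> c > 0 \<and> ball c (\<rho> c) \<subseteq> A - (C - {c})" by metis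
  define R where "R = Min (insert 1 (\<rho> ` C))"
  have "R > 0" unfolding R_def using assms(1) \<rho> by (subst Min_gr_iff) auto
  have R: "ball c R \<subseteq> A - (C - {c})" if "c \<in> C" for c
  proof -
    have "R \<le> \<rho> c" unfolding R_def using that assms(1) by (intro Min_le) auto
    then show ?thesis using \<rho>[OF that] by (meson subset_ball subset_trans)
  qed
  show ?thesis
  proof (rule that[OF \<open>R > 0\<close>])
    show "ball c R \<subseteq> A" if "c \<in> C" for c using R[OF that] by blast
    show "R \<le> dist c c'" if "c \<in> C" "c' \<in> C" "c \<noteq> c'" for c c'
    proof (rule ccontr)
      assume "\<not> R \<le> dist c c'"
      then have "c' \<in> ball c R" by simp
      then show False using R[OF that(1)] that by blast
    qed
  qed
qed

text \<open>The maximum principle on small discs around the zeros of \<open>D\<close> makes the bound for \<open>e / D\<close>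
  linear in the supremum of \<open>e\<close>.\<close>

lemma quotient_bound:
  assumes A: "open A" "compact (closure A)" and C: "finite C" "C \<subseteq> A"
    and D: "continuous_on (closure A) D" "D holomorphic_on A" "\<And>z. z \<in> closure A - C \<Longrightarrow> D z \<noteq> 0"
  obtains \<kappa> where "\<kappa> > 0"
    "\<And>e \<delta> z. e holomorphic_on A \<Longrightarrow> (\<And>z. z \<in> A \<Longrightarrow> norm (e z) \<le> \<delta>) \<Longrightarrow> (\<And>c. c \<in> C \<Longrightarrow> e \<in> O[at c](D)) \<Longrightarrow>
      z \<in> A - C \<Longrightarrow> norm (e z) \<le> \<kappa> * \<delta> * norm (D z)"
proof -
  obtain R where R: "R > 0" "\<And>c. c \<in> C \<Longrightarrow> ball c R \<subseteq> A" "\<And>c c'. c \<in> C \<Longrightarrow> c' \<in> C \<Longrightarrow> c \<noteq> c' \<Longrightarrow> R \<le> dist c c'"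
    using finite_isolating_radius[OF C(1) A(1) C(2)] by blast
  \<comment> \<open>Half the separation radius: the circle of radius \<open>r\<close> about one
    point of \<open>C\<close> then avoids the open discs of radius \<open>r\<close> about the others
    and lies in \<open>S\<close>, where \<open>D\<close> is bounded below.\<close>
  define r where "r = R / 2"
  define S where "S = closure A - (\<Union>c\<in>C. ball c r)"
  have S: "compact S" unfolding S_def by (intro compact_diff A open_UN) auto
  have "\<exists>m>0. \<forall>z\<in>S. m \<le> norm (D z)"
  proof (cases "S = {}")
    case False
    have "continuous_on S (\<lambda>z. norm (D z))"
      unfolding S_def by (intro continuous_on_norm continuous_on_subset[OF D(1)]) auto
    then obtain x where x: "x \<in> S" "\<And>z. z \<in> S \<Longrightarrow> norm (D x) \<le> norm (D z)"
      using continuous_attains_inf[OF S False] by blast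
    have "x \<in> closure A - C" using x(1) R(1) by (auto simp: S_def r_def)
    then show ?thesis using x(2) D(3) by (intro exI[of _ "norm (D x)"]) auto
  qed (auto intro: exI[of _ 1])
  then obtain m where m: "m > 0" "\<And>z. z \<in> S \<Longrightarrow> m \<le> norm (D z)" by blast
  have "norm (e z) \<le> inverse m * \<delta> * norm (D z)"
    if e: "e holomorphic_on A" and b: "\<And>z. z \<in> A \<Longrightarrow> norm (e z) \<le> \<delta>"
      and O: "\<And>c. c \<in> C \<Longrightarrow> e \<in> O[at c](D)" and z: "z \<in> A - C" for e \<delta> z
  proof -
    have \<delta>: "0 \<le> \<delta>" using b[of z] z norm_ge_zero order_trans by blast
    have inS: "norm (e w) \<le> inverse m * \<delta> * norm (D w)" if "w \<in> S" "w \<in> A" for w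
    proof -
      have "norm (e w) \<le> inverse m * \<delta> * m" using b[OF that(2)] m(1) by (simp add: field_simps)
      also have "\<dots> \<le> inverse m * \<delta> * norm (D w)"
        using m \<delta> that by (intro mult_left_mono) auto
      finally show ?thesis .
    qed
    show ?thesis
    proof (cases "z \<in> S")
      case True
      then show ?thesis using inS z by blast
    next
      case False
      moreover have "z \<in> closure A" using z closure_subset by blast
      ultimately obtain c where c: "c \<in> C" "z \<in> ball c r" by (auto simp: S_def)
      have pball: "ball c R - {c} \<subseteq> A - C"
      proof
        fix w assume w: "w \<in> ball c R - {c}"
        then have "w \<notin> C" using R(3)[OF c(1), of w] by auto
        then show "w \<in> A - C" using w R(2)[OF c(1)] by blast
      qed
      have nz: "D w \<noteq> 0" if "w \<in> ball c R - {c}" for w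
        using that pball D(3) closure_subset by blast
      have "(\<lambda>w. e w / D w) holomorphic_on (ball c R - {c})"
        by (intro holomorphic_on_divide) (use nz pball e D(2) in \<open>auto elim: holomorphic_on_subset\<close>)
      \<comment> \<open>The order hypothesis is used only to bound e / D near \<open>c\<close> and
        so remove the singularity. Its constant \<open>B\<close> does not enter the final bound,
        which comes from the circle.\<close>
      moreover obtain B where B: "\<forall>\<^sub>F w in at c. norm (e w) \<le> B * norm (D w)"
        using O[OF c(1)] by (elim landau_o.bigE)
      have "\<forall>\<^sub>F w in at c. w \<in> ball c R - {c}"
        using eventually_at_in_open[of "ball c R" c] R(1) by simp
      with B have "\<forall>\<^sub>F w in at c. norm (e w / D w) \<le> B"
        by eventually_elim (use nz in \<open>auto simp: norm_divide divide_le_eq\<close>)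
      ultimately obtain q where q: "q holomorphic_on ball c R" "\<And>w. w \<in> ball c R - {c} \<Longrightarrow> q w = e w / D w"
        using holomorphic_on_extend_bounded[of "\<lambda>w. e w / D w" "ball c R" c] R(1) by auto
      have "norm (q z) \<le> inverse m * \<delta>"
      proof (rule maximum_modulus_frontier[of q "ball c r"])
        show "q holomorphic_on interior (ball c r)"
          by (rule holomorphic_on_subset[OF q(1)]) (use R(1) in \<open>auto simp: interior_open r_def\<close>)
        show "continuous_on (closure (ball c r)) q"
          by (rule continuous_on_subset[OF holomorphic_on_imp_continuous_on[OF q(1)]]) (use R(1) in \<open>auto simp: r_def\<close>)
        show "norm (q w) \<le> inverse m * \<delta>" if "w \<in> frontier (ball c r)" for w
        proof -
          have w: "dist c w = r" using that R(1) by (simp add: r_def)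
          then have w': "w \<in> ball c R - {c}" using R(1) by (auto simp: r_def)
          have "w \<notin> ball c' r" if "c' \<in> C" for c'
          proof (cases "c' = c")
            case False
            then have "R \<le> dist c w + dist w c'"
              using R(3)[OF c(1) that] dist_triangle[of c c' w] by force
            then show ?thesis using w by (simp add: r_def dist_commute)
          qed (use w in simp)
          moreover have "w \<in> closure A" using w' pball closure_subset by blast
          ultimately have "w \<in> S" by (auto simp: S_def)
          then have "norm (e w) \<le> inverse m * \<delta> * norm (D w)" using inS w' pball by blast
          then show ?thesis using q(2)[OF w'] nz[OF w'] by (simp add: norm_divide divide_le_eq)
        qed
      qed (use c(2) in auto)
      moreover have "z \<in> ball c R - {c}" using c(2) z c(1) R(1) by (auto simp: r_def)
      ultimately show ?thesis using q(2)[of z] nz[of z] by (simp add: norm_divide divide_le_eq)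
    qed
  qed
  then show ?thesis using that[of "inverse m"] m(1) by simp
qed

section \<open>Orders of vanishing as Landau bounds\<close>

lemma bigo_at_imp_nhds:
  fixes f g :: "complex \<Rightarrow> complex"
  assumes "f \<in> O[at c](g)" "isCont f c" "isCont g c"
  shows "f \<in> O[nhds c](g)"
proof -
  obtain B where B: "\<forall>\<^sub>F w in at c. norm (f w) \<le> B * norm (g w)" using assms(1) by (elim landau_o.bigE)
  have "((\<lambda>w. norm (f w)) \<longlongrightarrow> norm (f c)) (at c)" "((\<lambda>w. B * norm (g w)) \<longlongrightarrow> B * norm (g c)) (at c)"
    using assms(2,3) by (auto simp: isCont_def intro!: tendsto_intros)
  then have "norm (f c) \<le> B * norm (g c)"
    using B by (intro tendsto_le[of "at c" "\<lambda>w. B * norm (g w)"]) auto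
  then have "\<forall>\<^sub>F w in nhds c. norm (f w) \<le> B * norm (g w)"
    using B unfolding eventually_nhds_conv_at by simp
  then show ?thesis by (rule bigoI)
qed

lemma bigo_nhds_imp_at: "f \<in> O[nhds c](g) \<Longrightarrow> f \<in> O[at c](g)"
  using landau_o.big.filter_mono[of "at c" "nhds c"] by (auto simp: at_within_def)

text \<open>The reason for stating orders along \<open>nhds c\<close> instead of
  \<open>at c\<close>: a continuous map sends \<open>nhds c\<close> to the neighbourhoods of its
  value without having to avoid that value, so Landau bounds can be composed with it.\<close>

lemma isCont_filterlim_nhds: "isCont f c \<Longrightarrow> filterlim f (nhds (f c)) (nhds c)"
  by (simp add: isCont_def tendsto_at_iff_tendsto_nhds)

lemma difference_bigo:
  fixes f :: "complex \<Rightarrow> complex"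
  assumes "(f has_field_derivative f') (at c)"
  shows "(\<lambda>z. f z - f c) \<in> O[nhds c](\<lambda>z. z - c)"
    and "f' \<noteq> 0 \<Longrightarrow> (\<lambda>z. z - c) \<in> O[nhds c](\<lambda>z. f z - f c)"
proof -
  have lim: "((\<lambda>z. (f z - f c) / (z - c)) \<longlongrightarrow> f') (at c)"
    using assms by (simp add: has_field_derivative_iff)
  have cont: "isCont (\<lambda>z. f z - f c) c" "isCont (\<lambda>z. z - c) c"
    using DERIV_isCont[OF assms] by (auto intro!: continuous_intros)
  have ne: "\<forall>\<^sub>F z in at c. z - c \<noteq> 0" by (simp add: eventually_at_filter)
  have "(\<lambda>z. f z - f c) \<in> O[at c](\<lambda>z. z - c)"
    by (rule bigoI_tendsto[OF lim ne])
  then show "(\<lambda>z. f z - f c) \<in> O[nhds c](\<lambda>z. z - c)"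
    using bigo_at_imp_nhds cont by blast
  assume "f' \<noteq> 0"
  have "((\<lambda>z. inverse ((f z - f c) / (z - c))) \<longlongrightarrow> inverse f') (at c)"
    by (intro tendsto_inverse lim \<open>f' \<noteq> 0\<close>)
  then have "((\<lambda>z. (z - c) / (f z - f c)) \<longlongrightarrow> inverse f') (at c)" by simp
  moreover have "\<forall>\<^sub>F z in at c. f z - f c \<noteq> 0"
    using tendsto_imp_eventually_ne[OF lim \<open>f' \<noteq> 0\<close>] by eventually_elim auto
  ultimately have "(\<lambda>z. z - c) \<in> O[at c](\<lambda>z. f z - f c)" by (rule bigoI_tendsto)
  then show "(\<lambda>z. z - c) \<in> O[nhds c](\<lambda>z. f z - f c)"
    using bigo_at_imp_nhds cont by blast
qed

text \<open>Cauchy's inequality on the disc about \<open>w\<close> whose radius is the distance from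
  \<open>w\<close> to \<open>c\<close>. Its points are at most twice that far from \<open>c\<close>,
  whence the factor \<open>2 ^ Suc d\<close>, and division by the radius lowers the exponent by
  one.\<close>

lemma deriv_bigo:
  fixes F :: "complex \<Rightarrow> complex"
  assumes F: "F holomorphic_on U" "open U" "c \<in> U"
    and O: "(\<lambda>w. F w - F c) \<in> O[nhds c](\<lambda>w. (w - c) ^ Suc d)"
  shows "deriv F \<in> O[nhds c](\<lambda>w. (w - c) ^ d)"
proof (rule bigo_at_imp_nhds)
  show "isCont (deriv F) c"
    using holomorphic_on_imp_continuous_on[OF holomorphic_deriv[OF F(1,2)]] F(2,3) continuous_on_eq_continuous_at by blast
  obtain B where B: "\<forall>\<^sub>F w in nhds c. norm (F w - F c) \<le> B * norm ((w - c) ^ Suc d)"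
    using O by (elim landau_o.bigE)
  then have "\<forall>\<^sub>F w in nhds c. w \<in> U \<and> norm (F w - F c) \<le> B * norm ((w - c) ^ Suc d)"
    using eventually_nhds_in_open[OF F(2,3)] by eventually_elim auto
  then obtain r where r: "r > 0" "\<And>w. dist w c < r \<Longrightarrow> w \<in> U \<and> norm (F w - F c) \<le> B * norm ((w - c) ^ Suc d)"
    unfolding eventually_nhds_metric by blast
  have "norm (deriv F w) \<le> (\<bar>B\<bar> * 2 ^ Suc d) * norm ((w - c) ^ d)" if w: "w \<in> ball c (r / 2) - {c}" for w
  proof -
    define \<rho> where "\<rho> = norm (w - c)"
    have \<rho>: "0 < \<rho>" "\<rho> < r / 2" using w by (auto simp: \<rho>_def dist_norm norm_minus_commute)
    have near: "norm (v - c) \<le> 2 * \<rho>" if "v \<in> cball w \<rho>" for v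
      using that norm_triangle_ineq[of "v - w" "w - c"] by (simp add: \<rho>_def dist_norm norm_minus_commute)
    then have sub: "v \<in> U" "norm (F v - F c) \<le> B * norm ((v - c) ^ Suc d)" if "v \<in> cball w \<rho>" for v
      using r(2)[of v] near[OF that] \<rho>(2) by (auto simp: dist_norm)
    have "norm ((deriv ^^ 1) (\<lambda>v. F v - F c) w) \<le> fact 1 * (\<bar>B\<bar> * (2 * \<rho>) ^ Suc d) / \<rho> ^ 1"
    proof (rule Cauchy_inequality)
      show "(\<lambda>v. F v - F c) holomorphic_on ball w \<rho>"
        using F(1) sub(1) by (auto intro!: holomorphic_intros elim: holomorphic_on_subset)
      show "continuous_on (cball w \<rho>) (\<lambda>v. F v - F c)"
        using holomorphic_on_imp_continuous_on[OF F(1)] sub(1)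
        by (auto intro!: continuous_intros elim: continuous_on_subset)
      show "norm (F v - F c) \<le> \<bar>B\<bar> * (2 * \<rho>) ^ Suc d" if "norm (w - v) = \<rho>" for v
      proof -
        have v: "v \<in> cball w \<rho>" using that by (simp add: dist_norm)
        have "norm (F v - F c) \<le> \<bar>B\<bar> * norm (v - c) ^ Suc d"
          using sub(2)[OF v] mult_right_mono[OF abs_ge_self[of B], of "norm (v - c) ^ Suc d"]
          by (simp add: norm_power norm_mult)
        also have "\<dots> \<le> \<bar>B\<bar> * (2 * \<rho>) ^ Suc d"
          using near[OF v] by (intro mult_left_mono power_mono) auto
        finally show ?thesis .
      qed
    qed (rule \<rho>(1))
    moreover have "deriv (\<lambda>v. F v - F c) w = deriv F w"
      using sub(1)[of w] \<rho>(1) F by (subst deriv_diff) (auto simp: holomorphic_on_imp_differentiable_at)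
    ultimately show ?thesis using \<rho>(1) by (simp add: \<rho>_def[symmetric] norm_power power_mult_distrib)
  qed
  then have "\<forall>\<^sub>F w in at c. norm (deriv F w) \<le> (\<bar>B\<bar> * 2 ^ Suc d) * norm ((w - c) ^ d)"
    using eventually_at_in_open[of "ball c (r/2)" c] r(1) by (auto elim!: eventually_mono)
  then show "deriv F \<in> O[at c](\<lambda>w. (w - c) ^ d)" by (rule bigoI)
qed (intro continuous_intros)

text \<open>The map s -> s - G s contracts by 1/2 and sends the closed disc into the one of radius
  (1/2 + 1/4) s1. So the root lies strictly inside, while uniqueness holds on the closed
  disc.\<close>

lemma near_identity_root:
  fixes G :: "complex \<Rightarrow> complex"
  assumes "s1 > 0" "\<And>s. s \<in> cball 0 s1 \<Longrightarrow> (G has_field_derivative G' s) (at s)"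
    "\<And>s. s \<in> cball 0 s1 \<Longrightarrow> norm (1 - G' s) \<le> 1/2" "norm (G 0) \<le> s1 / 4"
  shows "\<exists>s. norm s < s1 \<and> G s = 0 \<and> (\<forall>t\<in>cball 0 s1. G t = 0 \<longrightarrow> t = s)"
proof -
  define T where "T s = s - G s" for s
  have lip: "norm (T x - T y) \<le> 1/2 * norm (x - y)" if "x \<in> cball 0 s1" "y \<in> cball 0 s1" for x y
  proof (rule field_differentiable_bound[where S = "cball 0 s1" and f' = "\<lambda>s. 1 - G' s"])
    show "(T has_field_derivative 1 - G' z) (at z within cball 0 s1)" if "z \<in> cball 0 s1" for z
      unfolding T_def by (intro derivative_intros has_field_derivative_at_within[OF assms(2)[OF that]])
  qed (use assms(3) that in auto)
  have T0: "norm (T s) \<le> 3/4 * s1" if "s \<in> cball 0 s1" for s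
  proof -
    have "norm (T s) \<le> norm (T s - T 0) + norm (T 0)" by norm
    also have "\<dots> \<le> 1/2 * norm s + s1 / 4"
      using lip[OF that, of 0] assms(1,4) by (auto simp: T_def)
    finally show ?thesis using that by simp
  qed
  have "\<exists>!s\<in>cball 0 s1. T s = s"
  proof (rule Banach_fix[where c = "1/2"])
    show "T ` cball 0 s1 \<subseteq> cball 0 s1" using T0 assms(1) by fastforce
  qed (use lip assms(1) in \<open>auto simp: dist_norm compact_imp_complete\<close>)
  then obtain s where s: "s \<in> cball 0 s1 \<and> T s = s" "\<forall>t. t \<in> cball 0 s1 \<and> T t = t \<longrightarrow> t = s"
    by (rule ex1E)
  have "norm s < s1" using T0[of s] s(1) assms(1) by simp
  moreover have "G s = 0" using s(1) by (simp add: T_def)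
  moreover have "t = s" if "t \<in> cball 0 s1" "G t = 0" for t using s(2) that by (simp add: T_def)
  ultimately show ?thesis by blast
qed

lemma holomorphic_local_inverse:
  assumes "F holomorphic_on U" "open U" "w \<in> U" "deriv F w \<noteq> 0"
  obtains V q where "open V" "F w \<in> V" "q holomorphic_on V" "q (F w) = w" "\<And>y. y \<in> V \<Longrightarrow> q y \<in> U \<and> F (q y) = y"
proof -
  obtain r where r: "r > 0" "ball w r \<subseteq> U" "inj_on F (ball w r)"
    using has_complex_derivative_locally_injective[OF assms(1,3,2,4)] by blast
  have F: "F holomorphic_on ball w r" using assms(1) r(2) holomorphic_on_subset by blast
  obtain q where q: "q holomorphic_on F ` ball w r" "\<And>z. z \<in> ball w r \<Longrightarrow> q (F z) = z"
    using holomorphic_has_inverse[OF F open_ball r(3)] by metis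
  show ?thesis
  proof (rule that[of "F ` ball w r" q])
    show "open (F ` ball w r)"
      using open_mapping_thm3[OF F open_ball r(3)] .
  qed (use q r in auto)
qed

text \<open>With \<open>p z = (\<Prod>c\<in>C. z - c)\<close> and \<open>w = g0 z + p z * s\<close>, the equation \<open>F w = h z\<close> divided by
  \<open>deriv F0 (g0 z) * p z\<close> is, uniformly in \<open>z\<close> even near the critical points, a small perturbation of
  \<open>s = 0\<close>.\<close>

lemma perturbation_lemma:
  fixes F0 g0 :: "complex \<Rightarrow> complex"
  assumes U: "open U" "F0 holomorphic_on U"
    and A: "open A" "compact (closure A)" "open W" "closure A \<subseteq> W" "g0 holomorphic_on W" "g0 ` closure A \<subseteq> U"
    and C: "finite C" "C \<subseteq> A" "\<And>c. c \<in> C \<Longrightarrow> g0 c = c" "\<And>c. c \<in> C \<Longrightarrow> deriv g0 c \<noteq> 0"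
    and nz: "\<And>z. z \<in> closure A - C \<Longrightarrow> deriv F0 (g0 z) \<noteq> 0"
    and deg: "\<And>c. c \<in> C \<Longrightarrow> (\<lambda>w. (w - c) ^ d c) \<in> O[nhds c](deriv F0)"
    and "\<eta> > 0"
  obtains \<delta> where "\<delta> > 0"
    "\<And>F h. F holomorphic_on U \<Longrightarrow> h holomorphic_on A \<Longrightarrow> (\<And>z. z \<in> U \<Longrightarrow> norm (F z - F0 z) \<le> \<delta>) \<Longrightarrow>
      (\<And>z. z \<in> A \<Longrightarrow> norm (h z - F0 (g0 z)) \<le> \<delta>) \<Longrightarrow>
      (\<And>c. c \<in> C \<Longrightarrow> h c = F c \<and> (\<lambda>w. F w - F c) \<in> O[nhds c](\<lambda>w. (w - c) ^ Suc (d c)) \<and>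
         (\<lambda>z. h z - h c) \<in> O[nhds c](\<lambda>w. (w - c) ^ Suc (d c))) \<Longrightarrow>
      \<exists>g. g holomorphic_on A \<and> (\<forall>z\<in>A. g z \<in> U \<and> F (g z) = h z \<and> norm (g z - g0 z) < \<eta>) \<and> (\<forall>c\<in>C. g c = c)"
proof -
  define p where "p z = (\<Prod>c\<in>C. z - c)" for z
  have p0: "p z = 0 \<longleftrightarrow> z \<in> C" for z using C(1) by (auto simp: p_def)
  have p_hol: "p holomorphic_on S" for S unfolding p_def by (intro holomorphic_intros)
  have p_ord: "(\<lambda>z. z - c) \<in> O[nhds c](p)" if c: "c \<in> C" for c
  proof -
    define p' where "p' z = (\<Prod>c'\<in>C - {c}. z - c')" for z
    have eq: "p z = (z - c) * p' z" for z unfolding p_def p'_def using C(1) c by (simp add: prod.remove)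
    have "(p has_field_derivative p' c) (at c)"
    proof -
      have "p' field_differentiable (at c)"
        unfolding p'_def by (rule holomorphic_on_imp_differentiable_at[OF _ open_UNIV]) (auto intro!: holomorphic_intros)
      then obtain D where "(p' has_field_derivative D) (at c)" by (auto simp: field_differentiable_def)
      then have "((\<lambda>z. (z - c) * p' z) has_field_derivative p' c) (at c)"
        by (auto intro!: derivative_eq_intros)
      moreover have "p = (\<lambda>z. (z - c) * p' z)" by (rule ext) (rule eq)
      ultimately show ?thesis by simp
    qed
    moreover have "p' c \<noteq> 0" using C(1) by (simp add: p'_def)
    moreover have "p c = 0" using c p0 by simp
    ultimately show ?thesis using difference_bigo(2)[of p "p' c" c] by simp
  qed
  have g0A: "g0 holomorphic_on A" using A(4,5) closure_subset by (meson holomorphic_on_subset)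
  have g0c: "continuous_on (closure A) g0"
    using A(4,5) holomorphic_on_imp_continuous_on continuous_on_subset by blast
  have dF0: "deriv F0 holomorphic_on U" using U holomorphic_deriv by blast
  define L0 where "L0 = g0 ` closure A"
  have L0: "compact L0" "L0 \<subseteq> U" unfolding L0_def using A(2,6) compact_continuous_image[OF g0c] by auto
  obtain \<rho>0 where \<rho>0: "\<rho>0 > 0" "(\<Union>x\<in>L0. cball x \<rho>0) \<subseteq> U"
    using compact_subset_open_imp_cball_epsilon_subset[OF L0(1) U(1) L0(2)] by blast
  define L where "L = (\<Union>x\<in>L0. cball x \<rho>0)"
  have L: "compact L" "L \<subseteq> U" unfolding L_def using \<rho>0 compact_thickening[OF L0(1)] by auto
  \<comment> \<open>\<open>D2 z\<close> is the derivative of s -> F0 (g0 z + p z * s) at s = 0. It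
    normalises the equation, whereas \<open>D1\<close> normalises the derivative of \<open>F\<close>
    after the factor \<open>p z\<close> has cancelled.\<close>
  define D1 where "D1 z = deriv F0 (g0 z)" for z
  define D2 where "D2 z = D1 z * p z" for z
  have g0U: "g0 ` A \<subseteq> U" using A(6) closure_subset by blast
  have D1A: "D1 holomorphic_on A" unfolding D1_def
    using holomorphic_on_compose_gen[OF g0A dF0 g0U] by (simp add: o_def)
  have D1c: "continuous_on (closure A) D1" unfolding D1_def
    using A(6) by (intro continuous_on_compose2[OF holomorphic_on_imp_continuous_on[OF dF0] g0c]) auto
  have D1nz: "D1 z \<noteq> 0" if "z \<in> closure A - C" for z using nz[OF that] by (simp add: D1_def)
  obtain \<kappa>1 where \<kappa>1: "\<kappa>1 > 0"
    "\<And>e \<delta> z. e holomorphic_on A \<Longrightarrow> (\<And>z. z \<in> A \<Longrightarrow> norm (e z) \<le> \<delta>) \<Longrightarrow> (\<And>c. c \<in> C \<Longrightarrow> e \<in> O[at c](D1)) \<Longrightarrow>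
      z \<in> A - C \<Longrightarrow> norm (e z) \<le> \<kappa>1 * \<delta> * norm (D1 z)"
    using quotient_bound[OF A(1,2) C(1,2) D1c D1A D1nz] by blast
  have D2A: "D2 holomorphic_on A" unfolding D2_def by (intro holomorphic_intros D1A p_hol)
  have D2c: "continuous_on (closure A) D2" unfolding D2_def
    by (intro continuous_intros D1c holomorphic_on_imp_continuous_on p_hol)
  have D2nz: "D2 z \<noteq> 0" if "z \<in> closure A - C" for z using D1nz[OF that] p0 that by (simp add: D2_def)
  obtain \<kappa>2 where \<kappa>2: "\<kappa>2 > 0"
    "\<And>e \<delta> z. e holomorphic_on A \<Longrightarrow> (\<And>z. z \<in> A \<Longrightarrow> norm (e z) \<le> \<delta>) \<Longrightarrow> (\<And>c. c \<in> C \<Longrightarrow> e \<in> O[at c](D2)) \<Longrightarrow>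
      z \<in> A - C \<Longrightarrow> norm (e z) \<le> \<kappa>2 * \<delta> * norm (D2 z)"
    using quotient_bound[OF A(1,2) C(1,2) D2c D2A D2nz] by blast
  have "uniformly_continuous_on L (deriv F0)"
    using L dF0 by (intro compact_uniformly_continuous) (auto intro: continuous_on_subset holomorphic_on_imp_continuous_on)
  moreover have "1 / (4 * \<kappa>1) > 0" using \<kappa>1 by simp
  ultimately obtain \<rho>1 where \<rho>1: "\<rho>1 > 0"
    "\<And>x x'. x \<in> L \<Longrightarrow> x' \<in> L \<Longrightarrow> dist x' x < \<rho>1 \<Longrightarrow> dist (deriv F0 x') (deriv F0 x) < 1 / (4 * \<kappa>1)"
    unfolding uniformly_continuous_on_def by metis
  have "bounded (p ` closure A)"
    by (intro compact_imp_bounded compact_continuous_image A holomorphic_on_imp_continuous_on p_hol)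
  then obtain P where P: "P > 0" "\<And>z. z \<in> closure A \<Longrightarrow> norm (p z) \<le> P" by (auto simp: bounded_pos)
  \<comment> \<open>\<open>P\<close> bounds \<open>p\<close>, so for norm s at most
    \<open>s1\<close> the shift \<open>p z * s\<close> stays within \<open>\<rho>0\<close> (the
    point remains in \<open>L\<close>), below \<open>\<rho>1\<close> (\<open>deriv F0\<close> varies
    little) and below \<eta> (the required closeness).\<close>
  define s1 where "s1 = min \<rho>0 (min (\<rho>1 / 2) (\<eta> / 2)) / P"
  have s1: "s1 > 0" using P \<rho>0 \<rho>1 \<open>\<eta> > 0\<close> by (simp add: s1_def)
  have ps: "norm (p z) * s1 \<le> \<rho>0" "norm (p z) * s1 < \<rho>1" "norm (p z) * s1 < \<eta>" if "z \<in> closure A" for z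
  proof -
    have "norm (p z) * s1 \<le> P * s1" using P(2)[OF that] s1 by simp
    also have "\<dots> = min \<rho>0 (min (\<rho>1 / 2) (\<eta> / 2))" using P(1) by (simp add: s1_def)
    finally show "norm (p z) * s1 \<le> \<rho>0" "norm (p z) * s1 < \<rho>1" "norm (p z) * s1 < \<eta>"
      using \<rho>1(1) \<open>\<eta> > 0\<close> by auto
  qed
  obtain k where k: "k > 0"
    "\<And>e \<delta> z. e holomorphic_on U \<Longrightarrow> (\<And>z. z \<in> U \<Longrightarrow> norm (e z) \<le> \<delta>) \<Longrightarrow> z \<in> L \<Longrightarrow> norm (deriv e z) \<le> k * \<delta>"
    using cauchy_deriv_bound_compact[OF U(1) L] by blast
  \<comment> \<open>The two entries serve the two hypotheses of \<open>near_identity_root\<close>: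
    1/4 from the change of F plus 1/4 from the oscillation of \<open>deriv F0\<close> gives 1/2, and
    the defect at s = 0 is at most s1 / 4.\<close>
  define \<delta> where "\<delta> = min (1 / (4 * \<kappa>1 * k)) (s1 / (8 * \<kappa>2))"
  have \<delta>: "\<delta> > 0" "\<kappa>1 * (k * \<delta>) \<le> 1/4" "\<kappa>2 * (2 * \<delta>) \<le> s1 / 4"
  proof -
    show "\<delta> > 0" using \<kappa>1 \<kappa>2 k s1 by (simp add: \<delta>_def)
    have "\<delta> \<le> 1 / (4 * \<kappa>1 * k)" "\<delta> \<le> s1 / (8 * \<kappa>2)" by (auto simp: \<delta>_def)
    then show "\<kappa>1 * (k * \<delta>) \<le> 1/4" "\<kappa>2 * (2 * \<delta>) \<le> s1 / 4"
      using \<kappa>1(1) \<kappa>2(1) k(1) by (simp_all add: field_simps)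
  qed
  have "\<exists>g. g holomorphic_on A \<and> (\<forall>z\<in>A. g z \<in> U \<and> F (g z) = h z \<and> norm (g z - g0 z) < \<eta>) \<and> (\<forall>c\<in>C. g c = c)"
    if F: "F holomorphic_on U" and h: "h holomorphic_on A" and FF0: "\<And>z. z \<in> U \<Longrightarrow> norm (F z - F0 z) \<le> \<delta>"
      and hF0: "\<And>z. z \<in> A \<Longrightarrow> norm (h z - F0 (g0 z)) \<le> \<delta>"
      and H: "\<And>c. c \<in> C \<Longrightarrow> h c = F c \<and> (\<lambda>w. F w - F c) \<in> O[nhds c](\<lambda>w. (w - c) ^ Suc (d c)) \<and>
         (\<lambda>z. h z - h c) \<in> O[nhds c](\<lambda>w. (w - c) ^ Suc (d c))" for F h
  proof -
    have dF: "deriv F holomorphic_on U" using U F holomorphic_deriv by blast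
    have CU: "c \<in> U" if "c \<in> C" for c using C(2) C(3)[OF that] that g0U by (metis image_subset_iff subsetD)
    have near: "g0 z + p z * s \<in> L" if "z \<in> closure A" "norm s \<le> s1" for z s
    proof -
      have "norm (p z * s) \<le> norm (p z) * s1" using that(2) by (simp add: norm_mult mult_left_mono)
      also have "\<dots> \<le> \<rho>0" using ps that by blast
      finally show ?thesis using that(1) unfolding L_def L0_def by (auto simp: dist_norm intro!: bexI[of _ z])
    qed
    have AC: "z \<in> closure A" if "z \<in> A" for z using that closure_subset by blast
    \<comment> \<open>\<open>D1\<close> vanishes at \<open>c\<close> at most to order
      \<open>d c\<close>, as \<open>deriv F0\<close> does, because \<open>g0\<close> fixes
      \<open>c\<close> with nonzero derivative.\<close>
    have ordD1: "(\<lambda>z. (z - c) ^ d c) \<in> O[nhds c](D1)" if c: "c \<in> C" for c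
    proof -
      have der: "(g0 has_field_derivative deriv g0 c) (at c)"
        using holomorphic_derivI[OF g0A A(1)] C(2) c by blast
      have "(\<lambda>z. z - c) \<in> O[nhds c](\<lambda>z. g0 z - c)"
        using difference_bigo(2)[OF der C(4)[OF c]] C(3)[OF c] by simp
      then have "(\<lambda>z. (z - c) ^ d c) \<in> O[nhds c](\<lambda>z. (g0 z - c) ^ d c)" by (rule landau_o.big_power)
      also have "(\<lambda>z. (g0 z - c) ^ d c) \<in> O[nhds c](D1)"
      proof -
        have "filterlim g0 (nhds c) (nhds c)"
          using isCont_filterlim_nhds[OF DERIV_isCont[OF der]] C(3)[OF c] by simp
        from landau_o.big.compose[OF deg[OF c] this] show ?thesis by (simp add: D1_def[abs_def])
      qed
      finally show ?thesis .
    qed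
    \<comment> \<open>For fixed \<open>s\<close> the map x -> g0 x + p x * s still fixes every point
      of \<open>C\<close>, because \<open>p\<close> vanishes there. Hence the numerator vanishes at
      least to order \<open>d c\<close>, and \<open>quotient_bound\<close> gives an estimate uniform
      up to the critical points.\<close>
    have contr: "norm (1 - deriv F (g0 z + p z * s) / D1 z) \<le> 1/2" if z: "z \<in> A - C" and s: "norm s \<le> s1" for z s
    proof -
      define e where "e x = deriv F (g0 x + p x * s) - D1 x" for x
      have "norm (e z) \<le> \<kappa>1 * (k * \<delta> + 1 / (4 * \<kappa>1)) * norm (D1 z)"
      proof (rule \<kappa>1(2))
        show "e holomorphic_on A" unfolding e_def
        proof (intro holomorphic_on_diff D1A)
          have "(\<lambda>x. g0 x + p x * s) holomorphic_on A" by (intro holomorphic_intros g0A p_hol)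
          moreover have "(\<lambda>x. g0 x + p x * s) ` A \<subseteq> U" using near[OF AC s] L(2) by blast
          ultimately show "(\<lambda>x. deriv F (g0 x + p x * s)) holomorphic_on A"
            using holomorphic_on_compose_gen[OF _ dF] by (fastforce simp: o_def)
        qed
        show "norm (e x) \<le> k * \<delta> + 1 / (4 * \<kappa>1)" if x: "x \<in> A" for x
        proof -
          define w where "w = g0 x + p x * s"
          have w: "w \<in> L" "w \<in> U" using near[OF AC[OF x] s] L by (auto simp: w_def)
          have gx: "g0 x \<in> L" using near[OF AC[OF x], of 0] s1 by simp
          have "norm (deriv (\<lambda>v. F v - F0 v) w) \<le> k * \<delta>"
            by (rule k(2)) (use F U FF0 w in \<open>auto intro!: holomorphic_intros\<close>)
          moreover have "deriv (\<lambda>v. F v - F0 v) w = deriv F w - deriv F0 w"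
            using F U w by (intro deriv_diff) (auto simp: holomorphic_on_imp_differentiable_at)
          moreover have "dist (deriv F0 w) (deriv F0 (g0 x)) < 1 / (4 * \<kappa>1)"
          proof (rule \<rho>1(2)[OF gx w(1)])
            have "norm (p x * s) \<le> norm (p x) * s1" using s by (simp add: norm_mult mult_left_mono)
            then show "dist w (g0 x) < \<rho>1" using ps(2)[OF AC[OF x]] by (simp add: w_def dist_norm)
          qed
          moreover have "e x = (deriv F w - deriv F0 w) + (deriv F0 w - deriv F0 (g0 x))"
            by (simp add: e_def w_def D1_def)
          ultimately show ?thesis
            using norm_triangle_ineq[of "deriv F w - deriv F0 w" "deriv F0 w - deriv F0 (g0 x)"]
            by (simp add: dist_norm)
        qed
        show "e \<in> O[at c](D1)" if c: "c \<in> C" for c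
        proof -
          define k where "k x = g0 x + p x * s" for x
          have "k holomorphic_on A" unfolding k_def by (intro holomorphic_intros g0A p_hol)
          then have der: "(k has_field_derivative deriv k c) (at c)"
            using holomorphic_derivI A(1) C(2) c by blast
          have kc: "k c = c" using C(3)[OF c] c p0 by (simp add: k_def)
          have "deriv F \<in> O[nhds c](\<lambda>w. (w - c) ^ d c)"
            by (rule deriv_bigo[OF F U(1) CU[OF c]]) (use H[OF c] in blast)
          moreover have "filterlim k (nhds c) (nhds c)"
            using isCont_filterlim_nhds[OF DERIV_isCont[OF der]] kc by simp
          ultimately have "(\<lambda>x. deriv F (k x)) \<in> O[nhds c](\<lambda>x. (k x - c) ^ d c)"
            by (rule landau_o.big.compose)
          also have "(\<lambda>x. (k x - c) ^ d c) \<in> O[nhds c](\<lambda>x. (x - c) ^ d c)"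
            by (rule landau_o.big_power) (use difference_bigo(1)[OF der] kc in simp)
          also note ordD1[OF c]
          finally have "e \<in> O[nhds c](D1)"
            unfolding e_def k_def by (intro sum_in_bigo(2)) auto
          then show ?thesis by (rule bigo_nhds_imp_at)
        qed
      qed (rule z)
      also have "\<dots> \<le> 1/2 * norm (D1 z)"
        using \<delta>(2) \<kappa>1(1) by (intro mult_right_mono) (auto simp: algebra_simps)
      finally have e: "norm (e z) \<le> 1/2 * norm (D1 z)" .
      have nz: "D1 z \<noteq> 0" using D1nz[of z] z AC by blast
      then have "1 - deriv F (g0 z + p z * s) / D1 z = - e z / D1 z" by (simp add: e_def field_simps)
      then show ?thesis using e nz by (simp add: norm_divide divide_le_eq)
    qed
    \<comment> \<open>\<open>F (g0 z)\<close> and \<open>h z\<close> share their value at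
      \<open>c\<close> and both approach it to order at least \<open>d c + 1\<close>. The extra
      factor \<open>p\<close> raises the order of \<open>D2\<close> to at most
      \<open>d c + 1\<close>, so the quotient remains bounded.\<close>
    have small: "norm (F (g0 z) - h z) \<le> s1 / 4 * norm (D2 z)" if z: "z \<in> A - C" for z
    proof -
      define e where "e x = F (g0 x) - h x" for x
      have "norm (e z) \<le> \<kappa>2 * (2 * \<delta>) * norm (D2 z)"
      proof (rule \<kappa>2(2))
        have "(\<lambda>x. F (g0 x)) holomorphic_on A"
          using holomorphic_on_compose_gen[OF g0A F g0U] by (simp add: o_def)
        then show "e holomorphic_on A" unfolding e_def by (intro holomorphic_on_diff h)
        show "norm (e x) \<le> 2 * \<delta>" if x: "x \<in> A" for x
        proof -
          have "g0 x \<in> U" using A(6) AC[OF x] by blast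
          have "e x = (F (g0 x) - F0 (g0 x)) - (h x - F0 (g0 x))" by (simp add: e_def)
          also have "norm \<dots> \<le> \<delta> + \<delta>"
            by (intro order_trans[OF norm_triangle_ineq4] add_mono FF0 hF0 x \<open>g0 x \<in> U\<close>)
          finally show ?thesis by simp
        qed
        show "e \<in> O[at c](D2)" if c: "c \<in> C" for c
        proof -
          have der: "(g0 has_field_derivative deriv g0 c) (at c)"
            using holomorphic_derivI[OF g0A A(1)] C(2) c by blast
          have "filterlim g0 (nhds c) (nhds c)"
            using isCont_filterlim_nhds[OF DERIV_isCont[OF der]] C(3)[OF c] by simp
          from landau_o.big.compose[OF _ this] H[OF c]
          have "(\<lambda>x. F (g0 x) - F c) \<in> O[nhds c](\<lambda>x. (g0 x - c) ^ Suc (d c))" by blast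
          also have "(\<lambda>x. (g0 x - c) ^ Suc (d c)) \<in> O[nhds c](\<lambda>x. (x - c) ^ Suc (d c))"
            by (rule landau_o.big_power) (use difference_bigo(1)[OF der] C(3)[OF c] in simp)
          finally have "(\<lambda>x. (F (g0 x) - F c) - (h x - h c)) \<in> O[nhds c](\<lambda>x. (x - c) ^ Suc (d c))"
            by (rule sum_in_bigo(2)) (use H[OF c] in blast)
          also have "(\<lambda>x. (x - c) ^ Suc (d c)) \<in> O[nhds c](D2)"
            unfolding D2_def power_Suc2 by (intro landau_o.big.mult ordD1 p_ord c)
          finally have "e \<in> O[nhds c](D2)" using H[OF c] by (simp add: e_def[abs_def])
          then show ?thesis by (rule bigo_nhds_imp_at)
        qed
      qed (rule z)
      also have "\<dots> \<le> s1 / 4 * norm (D2 z)" by (intro mult_right_mono \<delta>) auto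
      finally show ?thesis by (simp add: e_def)
    qed
    \<comment> \<open>Uniqueness in the closed disc and the nonzero derivative are recorded because
      \<open>g1\<close> below is chosen point by point, with no regularity in
      \<open>z\<close>.\<close>
    have root: "\<exists>w. norm (w - g0 z) < norm (p z) * s1 \<and> F w = h z \<and> w \<in> U \<and> deriv F w \<noteq> 0 \<and>
        (\<forall>w'. norm (w' - g0 z) \<le> norm (p z) * s1 \<and> F w' = h z \<longrightarrow> w' = w)" if z: "z \<in> A - C" for z
    proof -
      have nzD: "D1 z \<noteq> 0" "D2 z \<noteq> 0" "p z \<noteq> 0" using D1nz[of z] D2nz[of z] p0 z AC by auto
      define G where "G s = (F (g0 z + p z * s) - h z) / D2 z" for s
      have "\<exists>s. norm s < s1 \<and> G s = 0 \<and> (\<forall>t\<in>cball 0 s1. G t = 0 \<longrightarrow> t = s)"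
      proof (rule near_identity_root[OF s1])
        show "(G has_field_derivative deriv F (g0 z + p z * s) / D1 z) (at s)" if "s \<in> cball 0 s1" for s
        proof -
          have "g0 z + p z * s \<in> U" using near[of z s] L(2) z AC that by auto
          then have "(F has_field_derivative deriv F (g0 z + p z * s)) (at (g0 z + p z * s))"
            using holomorphic_derivI[OF F U(1)] by blast
          then have "((\<lambda>s. F (g0 z + p z * s)) has_field_derivative deriv F (g0 z + p z * s) * p z) (at s)"
            by (rule DERIV_chain2) (auto intro!: derivative_eq_intros)
          then have "(G has_field_derivative deriv F (g0 z + p z * s) * p z / D2 z) (at s)"
            unfolding G_def by (intro DERIV_cdivide) (auto intro!: derivative_eq_intros)
          then show ?thesis using nzD by (simp add: D2_def)
        qed
        show "norm (1 - deriv F (g0 z + p z * s) / D1 z) \<le> 1/2" if "s \<in> cball 0 s1" for s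
          by (rule contr[OF z]) (use that in simp)
        show "norm (G 0) \<le> s1 / 4" using small[OF z] nzD by (simp add: G_def norm_divide divide_le_eq)
      qed
      then obtain s where s: "norm s < s1" "G s = 0" "\<And>t. t \<in> cball 0 s1 \<Longrightarrow> G t = 0 \<Longrightarrow> t = s" by blast
      have "deriv F (g0 z + p z * s) \<noteq> 0" using contr[OF z, of s] s(1) by auto
      moreover have "F (g0 z + p z * s) = h z" using s(2) nzD by (simp add: G_def)
      moreover have "g0 z + p z * s \<in> U" using near[of z s] L(2) z AC s(1) by auto
      moreover have "norm ((g0 z + p z * s) - g0 z) < norm (p z) * s1" using s(1) nzD by (simp add: norm_mult)
      moreover have "w' = g0 z + p z * s" if w': "norm (w' - g0 z) \<le> norm (p z) * s1 \<and> F w' = h z" for w'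
      proof -
        define t where "t = (w' - g0 z) / p z"
        have "norm t \<le> s1" using w' nzD by (simp add: t_def norm_divide divide_le_eq mult.commute)
        moreover have "g0 z + p z * t = w'" using nzD by (simp add: t_def)
        ultimately have "t = s" using s(3)[of t] w' by (simp add: G_def)
        then show ?thesis using \<open>g0 z + p z * t = w'\<close> by simp
      qed
      ultimately show ?thesis by blast
    qed
    then obtain g1 where g1: "\<And>z. z \<in> A - C \<Longrightarrow> norm (g1 z - g0 z) < norm (p z) * s1 \<and> F (g1 z) = h z \<and> g1 z \<in> U \<and> deriv F (g1 z) \<noteq> 0 \<and>
        (\<forall>w'. norm (w' - g0 z) \<le> norm (p z) * s1 \<and> F w' = h z \<longrightarrow> w' = g1 z)"
      by metis
    define g where "g z = (if z \<in> C then z else g1 z)" for z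
    have bound: "norm (g z - g0 z) \<le> norm (p z) * s1" if "z \<in> A" for z
      using g1[of z] that C(3) s1 by (cases "z \<in> C") (auto simp: g_def)
    have openAC: "open (A - C)" using A(1) C(1) by (intro open_Diff finite_imp_closed)
    \<comment> \<open>With \<open>q\<close> a local inverse of \<open>F\<close> at
      \<open>g1 z\<close>, the function x -> q (h x) solves the equation and, by continuity, stays
      in the disc of uniqueness for \<open>x\<close> near \<open>z\<close>. So it coincides with
      \<open>g\<close> there.\<close>
    have hol: "g field_differentiable (at z)" if z: "z \<in> A - C" for z
    proof -
      obtain V q where V: "open V" "F (g1 z) \<in> V" "q holomorphic_on V" "q (F (g1 z)) = g1 z" "\<And>y. y \<in> V \<Longrightarrow> q y \<in> U \<and> F (q y) = y"
        using holomorphic_local_inverse[OF F U(1), of "g1 z"] g1[OF z] by metis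
      have hz: "h z \<in> V" "q (h z) = g1 z" using V(2,4) g1[OF z] by auto
      define Z where "Z = {x \<in> A - C. h x \<in> V}"
      have hc: "continuous_on (A - C) h"
        by (rule continuous_on_subset[OF holomorphic_on_imp_continuous_on[OF h]]) auto
      have "Z = (A - C) \<inter> h -` V" by (auto simp: Z_def)
      then have Z: "open Z" using continuous_open_preimage[OF hc openAC V(1)] by simp
      have qh: "(\<lambda>x. q (h x)) holomorphic_on Z"
        using holomorphic_on_compose_gen[OF holomorphic_on_subset[OF h] V(3), of Z] by (auto simp: Z_def o_def)
      define Y where "Y = {x \<in> Z. norm (q (h x) - g0 x) - norm (p x) * s1 < 0}"
      have "continuous_on Z (\<lambda>x. norm (q (h x) - g0 x) - norm (p x) * s1)"
        by (intro continuous_intros holomorphic_on_imp_continuous_on qh p_hol holomorphic_on_subset[OF g0A])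
          (auto simp: Z_def)
      from continuous_open_preimage[OF this Z, of "{..<0}"]
      have "open (Z \<inter> (\<lambda>x. norm (q (h x) - g0 x) - norm (p x) * s1) -` {..<0})" by simp
      moreover have "Y = Z \<inter> (\<lambda>x. norm (q (h x) - g0 x) - norm (p x) * s1) -` {..<0}" by (auto simp: Y_def)
      ultimately have Y: "open Y" by simp
      have zY: "z \<in> Y" using g1[OF z] hz z by (auto simp: Y_def Z_def)
      have "q (h x) = g x" if "x \<in> Y" for x
        using that g1[of x] V(5) by (auto simp: Y_def Z_def g_def)
      moreover obtain D where "((\<lambda>x. q (h x)) has_field_derivative D) (at z)"
        using holomorphic_on_imp_differentiable_at[OF qh Z] zY by (auto simp: Y_def field_differentiable_def)
      ultimately have "(g has_field_derivative D) (at z)"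
        using has_field_derivative_transform_within_open[OF _ Y zY] by blast
      then show ?thesis by (auto simp: field_differentiable_def)
    qed
    have holAC: "g holomorphic_on A - C"
      using hol field_differentiable_at_within by (auto simp: holomorphic_on_def)
    \<comment> \<open>At a point of \<open>C\<close> continuity follows from the bound by
      \<open>norm (p x) * s1\<close>, which tends to 0. The points of \<open>C\<close> are then
      removable singularities.\<close>
    have contA: "continuous_on A g"
    proof -
      have "isCont g z" if z: "z \<in> A" for z
      proof (cases "z \<in> C")
        case False
        then show ?thesis using hol[of z] z field_differentiable_imp_continuous_at by blast
      next
        case True
        have ct: "isCont g0 z" "isCont p z"
          using holomorphic_on_imp_continuous_on[OF g0A] holomorphic_on_imp_continuous_on[OF p_hol[of UNIV]] z A(1)
          by (auto simp: continuous_on_eq_continuous_at)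
        have "((\<lambda>x. g x - g0 x) \<longlongrightarrow> 0) (at z)"
        proof (rule Lim_null_comparison)
          show "\<forall>\<^sub>F x in at z. norm (g x - g0 x) \<le> norm (p x) * s1"
            using eventually_at_in_open'[OF A(1) z] by eventually_elim (rule bound)
          have "((\<lambda>x. norm (p x) * s1) \<longlongrightarrow> norm (p z) * s1) (at z)"
            using ct by (intro tendsto_intros) (auto simp: isCont_def)
          moreover have "p z = 0" using True p0 by simp
          ultimately show "((\<lambda>x. norm (p x) * s1) \<longlongrightarrow> 0) (at z)" by simp
        qed
        moreover have "g z = z" using True by (simp add: g_def)
        ultimately show ?thesis
          using tendsto_add[OF _ ct(1)[unfolded isCont_def], of "\<lambda>x. g x - g0 x" 0] C(3)[OF True] by (simp add: isCont_def)
      qed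
      then show ?thesis by (simp add: continuous_at_imp_continuous_on)
    qed
    have "g holomorphic_on A" by (rule no_isolated_singularity[OF contA holAC A(1) C(1)])
    moreover have "g z \<in> U \<and> F (g z) = h z \<and> norm (g z - g0 z) < \<eta>" if z: "z \<in> A" for z
      using g1[of z] H[of z] CU[of z] z bound[OF z] ps(3)[OF AC[OF z]] by (cases "z \<in> C") (auto simp: g_def)
    ultimately show ?thesis by (intro exI[of _ g]) (auto simp: g_def)
  qed
  then show ?thesis by (rule that[OF \<delta>(1)])
qed

section \<open>Lifting along maps with the same local degrees\<close>

lemma local_degree_infinite_iff: "local_degree f c = \<infinity> \<longleftrightarrow> (\<forall>\<^sub>F w in nhds c. f w = f c)"
  by (simp add: local_degree_def)

text \<open>Factor f w - f c as g w * (w - c)^(d+1) with g c nonzero. Then deriv f w = (w - c)^d * u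
  w, where u c = (d+1) * g c is nonzero. This gives the upper bound for \<open>f\<close> and the
  lower bound for its derivative.\<close>

lemma local_degree_finite:
  assumes f: "f holomorphic_on U" "open U" "c \<in> U" and nc: "\<not> (\<forall>\<^sub>F w in nhds c. f w = f c)"
  obtains d where "local_degree f c = enat (Suc d)"
    "(\<lambda>w. f w - f c) \<in> O[nhds c](\<lambda>w. (w - c) ^ Suc d)"
    "(\<lambda>w. (w - c) ^ d) \<in> O[nhds c](deriv f)"
proof -
  obtain r0 where r0: "r0 > 0" "ball c r0 \<subseteq> U" using f(2,3) open_contains_ball by blast
  define k where "k w = f w - f c" for w
  have k: "k holomorphic_on ball c r0"
    unfolding k_def using f(1) r0(2) by (auto intro!: holomorphic_intros elim: holomorphic_on_subset)
  have "\<exists>w\<in>ball c r0. k w \<noteq> 0"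
  proof (rule ccontr)
    assume "\<not> ?thesis"
    then have fc: "f w = f c" if "w \<in> ball c r0" for w using that by (auto simp: k_def)
    have "\<forall>\<^sub>F w in nhds c. w \<in> ball c r0" using r0(1) by (intro eventually_nhds_in_open) auto
    then have "\<forall>\<^sub>F w in nhds c. f w = f c" by (rule eventually_mono) (rule fc)
    then show False using nc by blast
  qed
  then have ex: "\<exists>w\<in>ball c r0. k w \<noteq> 0" .
  have c0: "c \<in> ball c r0" using r0(1) by simp
  have zz: "(if k c = 0 then 0 < zorder k c else zorder k c = 0) \<and> (\<exists>r. 0 < r \<and> cball c r \<subseteq> ball c r0 \<and> zor_poly k c holomorphic_on cball c r \<and>
      (\<forall>w\<in>cball c r. k w = zor_poly k c w * (w - c) ^ nat (zorder k c) \<and> zor_poly k c w \<noteq> 0))"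
    by (rule zorder_exist_zero[OF k open_ball connected_ball c0 ex])
  moreover have "k c = 0" by (simp add: k_def)
  ultimately have z: "zorder k c > 0" by simp
  from zz have "\<exists>r. 0 < r \<and> cball c r \<subseteq> ball c r0 \<and> zor_poly k c holomorphic_on cball c r \<and>
      (\<forall>w\<in>cball c r. k w = zor_poly k c w * (w - c) ^ nat (zorder k c) \<and> zor_poly k c w \<noteq> 0)"
    by (rule conjunct2)
  then obtain r where r: "r > 0" "cball c r \<subseteq> ball c r0" "zor_poly k c holomorphic_on cball c r"
      "\<And>w. w \<in> cball c r \<Longrightarrow> k w = zor_poly k c w * (w - c) ^ nat (zorder k c) \<and> zor_poly k c w \<noteq> 0" by blast
  define g where "g = zor_poly k c"
  obtain d where d: "nat (zorder k c) = Suc d" using z by (metis gr0_implies_Suc zero_less_nat_eq)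
  have g: "g holomorphic_on ball c r" using r(3) by (auto simp: g_def elim: holomorphic_on_subset)
  have fg: "f w = f c + g w * (w - c) ^ Suc d" "g w \<noteq> 0" if "w \<in> ball c r" for w
    using r(4)[of w] that d by (auto simp: k_def g_def algebra_simps)
  have contg: "isCont g c"
    using holomorphic_on_imp_continuous_on[OF g] r(1) by (simp add: continuous_on_eq_continuous_at)
  have ball: "\<forall>\<^sub>F w in nhds c. w \<in> ball c r" using r(1) by (intro eventually_nhds_in_open) auto
  show ?thesis
  proof (rule that)
    show "local_degree f c = enat (Suc d)" using nc d by (simp add: local_degree_def k_def[abs_def])
    have "(g \<longlongrightarrow> g c) (nhds c)" using isCont_filterlim_nhds[OF contg] .
    then have "\<forall>\<^sub>F w in nhds c. dist (g w) (g c) < 1" by (rule tendstoD) simp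
    with ball have "\<forall>\<^sub>F w in nhds c. norm (f w - f c) \<le> (norm (g c) + 1) * norm ((w - c) ^ Suc d)"
    proof eventually_elim
      case (elim w)
      have "norm (g w) \<le> norm (g c) + 1" using elim(2) norm_triangle_sub[of "g w" "g c"] by (simp add: dist_norm)
      then show ?case using fg(1)[OF elim(1)] mult_right_mono[of "norm (g w)" "norm (g c) + 1" "norm ((w - c) ^ Suc d)"]
        by (simp add: norm_mult)
    qed
    then show "(\<lambda>w. f w - f c) \<in> O[nhds c](\<lambda>w. (w - c) ^ Suc d)" by (rule bigoI)
    define u where "u w = deriv g w * (w - c) + of_nat (Suc d) * g w" for w
    have dg: "deriv g holomorphic_on ball c r" using g holomorphic_deriv by blast
    have df: "deriv f w = (w - c) ^ d * u w" if w: "w \<in> ball c r" for w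
    proof -
      have "(g has_field_derivative deriv g w) (at w)" using holomorphic_derivI[OF g open_ball w] .
      then have "((\<lambda>w. f c + g w * (w - c) ^ Suc d) has_field_derivative (w - c) ^ d * u w) (at w)"
        by (auto intro!: derivative_eq_intros simp: u_def algebra_simps simp del: power_Suc) (simp add: algebra_simps)
      then have "(f has_field_derivative (w - c) ^ d * u w) (at w)"
        by (rule has_field_derivative_transform_within_open[OF _ open_ball w]) (use fg in auto)
      then show ?thesis by (rule DERIV_imp_deriv)
    qed
    have "isCont u c"
      using holomorphic_on_imp_continuous_on[OF dg] r(1) contg unfolding u_def
      by (auto simp: continuous_on_eq_continuous_at intro!: continuous_intros)
    then have "(u \<longlongrightarrow> u c) (nhds c)" using isCont_filterlim_nhds by blast
    moreover have uc: "norm (u c) > 0" using fg(2)[of c] r(1) by (simp add: u_def del: of_nat_Suc)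
    ultimately have "\<forall>\<^sub>F w in nhds c. dist (u w) (u c) < norm (u c) / 2" by (intro tendstoD) auto
    with ball have "\<forall>\<^sub>F w in nhds c. norm ((w - c) ^ d) \<le> (2 / norm (u c)) * norm (deriv f w)"
    proof eventually_elim
      case (elim w)
      have "norm (u c) / 2 \<le> norm (u w)"
        using elim(2) norm_triangle_sub[of "u c" "u w"] by (simp add: dist_norm norm_minus_commute)
      then have "1 \<le> 2 / norm (u c) * norm (u w)" using uc by (simp add: field_simps)
      then have "norm ((w - c) ^ d) * 1 \<le> norm ((w - c) ^ d) * (2 / norm (u c) * norm (u w))"
        by (intro mult_left_mono) auto
      then show ?case by (simp add: df[OF elim(1)] norm_mult mult_ac)
    qed
    then show "(\<lambda>w. (w - c) ^ d) \<in> O[nhds c](deriv f)" by (rule bigoI)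
  qed
qed

text \<open>The zeros of \<open>deriv \<phi>\<close> are isolated unless it vanishes identically
  near \<open>x\<close>. Closed discs are used so that the closure of a finite union of discs is
  still controlled.\<close>

lemma critical_point_dichotomy:
  assumes "\<phi> holomorphic_on W" "open W" "x \<in> W"
  shows "\<exists>r>0. cball x r \<subseteq> W \<and> ((\<forall>w\<in>cball x r - {x}. deriv \<phi> w \<noteq> 0) \<or> (\<forall>w\<in>cball x r. deriv \<phi> w = 0))"
proof -
  have d: "deriv \<phi> holomorphic_on W" using assms holomorphic_deriv by blast
  obtain R where R: "R > 0" "ball x R \<subseteq> W" using assms(2,3) open_contains_ball by blast
  have dR: "deriv \<phi> holomorphic_on ball x R" using d R(2) holomorphic_on_subset by blast
  have half: "cball x (s / 2) \<subseteq> ball x s" if "s > 0" for s using that by auto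
  consider "\<forall>w\<in>ball x R. deriv \<phi> w = 0" | "deriv \<phi> x \<noteq> 0" | \<beta> where "deriv \<phi> x = 0" "\<beta> \<in> ball x R" "deriv \<phi> \<beta> \<noteq> 0"
    by blast
  then show ?thesis
  proof cases
    case 1
    then show ?thesis using R half[OF R(1)] by (intro exI[of _ "R / 2"]) auto
  next
    case 2
    have "isCont (deriv \<phi>) x"
      using holomorphic_on_imp_continuous_on[OF d] assms(2,3) continuous_on_eq_continuous_at by blast
    from continuous_at_avoid[OF this 2] obtain e where e: "e > 0" "\<And>y. dist x y < e \<Longrightarrow> deriv \<phi> y \<noteq> 0" by blast
    define s where "s = min e R"
    have s: "s > 0" "ball x s \<subseteq> W" using e(1) R by (auto simp: s_def)
    have "deriv \<phi> w \<noteq> 0" if "w \<in> cball x (s / 2)" for w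
      using half[OF s(1)] that e(2)[of w] by (auto simp: s_def)
    then show ?thesis using s half[OF s(1)] by (intro exI[of _ "s / 2"]) auto
  next
    case 3
    obtain r where r: "r > 0" "ball x r \<subseteq> ball x R" "\<And>z. z \<in> ball x r - {x} \<Longrightarrow> deriv \<phi> z \<noteq> 0"
      using isolated_zeros[OF dR open_ball connected_ball _ 3] R(1) by (metis centre_in_ball)
    then show ?thesis using R(2) half[OF r(1)] by (intro exI[of _ "r / 2"]) auto
  qed
qed

text \<open>\<open>A2\<close> takes care of the marked points near which \<open>\<phi>\<close> is constant; by \<open>crit\<close> these are
  isolated in \<open>X\<close>.\<close>

lemma adapted_neighbourhood:
  assumes \<phi>: "\<phi> holomorphic_on W" "open W" and X: "compact X" "X \<subseteq> W" and C: "finite C"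
    and crit: "\<And>z. z \<in> X \<Longrightarrow> deriv \<phi> z = 0 \<Longrightarrow> z \<in> C"
  obtains A1 A2 where "open A1" "open A2" "A1 \<inter> A2 = {}" "X \<subseteq> A1 \<union> A2" "compact (closure A1)"
    "closure A1 \<subseteq> W" "A2 \<subseteq> W" "\<And>z. z \<in> closure A1 - C \<Longrightarrow> deriv \<phi> z \<noteq> 0"
    "\<And>c. c \<in> A1 \<Longrightarrow> \<not> (\<forall>\<^sub>F w in nhds c. \<phi> w = \<phi> c)"
    "\<And>z. z \<in> A2 \<Longrightarrow> \<exists>c\<in>C. \<exists>r>0. z \<in> ball c r \<and> ball c r \<subseteq> A2 \<and> (\<forall>w\<in>ball c r. \<phi> w = \<phi> c)"
proof -
  have "\<forall>x\<in>X. \<exists>r>0. cball x r \<subseteq> W \<and> ((\<forall>w\<in>cball x r - {x}. deriv \<phi> w \<noteq> 0) \<or> (\<forall>w\<in>cball x r. deriv \<phi> w = 0))"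
    using critical_point_dichotomy[OF \<phi>] X(2) by blast
  then obtain r where r: "\<And>x. x \<in> X \<Longrightarrow> r x > 0 \<and> cball x (r x) \<subseteq> W \<and>
      ((\<forall>w\<in>cball x (r x) - {x}. deriv \<phi> w \<noteq> 0) \<or> (\<forall>w\<in>cball x (r x). deriv \<phi> w = 0))"
    by metis
  obtain E where E: "E \<subseteq> X" "finite E" "X \<subseteq> (\<Union>x\<in>E. ball x (r x))"
    by (rule compactE_image[OF X(1), of X "\<lambda>x. ball x (r x)"]) (use r in auto)
  define E1 where "E1 = {x \<in> E. \<forall>w\<in>cball x (r x) - {x}. deriv \<phi> w \<noteq> 0}"
  define E2 where "E2 = E - E1"
  have E2: "\<forall>w\<in>cball x (r x). deriv \<phi> w = 0" if "x \<in> E2" for x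
    using r[of x] E(1) that by (auto simp: E1_def E2_def)
  define A1 where "A1 = (\<Union>x\<in>E1. ball x (r x))"
  define A2 where "A2 = (\<Union>x\<in>E2. ball x (r x))"
  define B1 where "B1 = (\<Union>x\<in>E1. cball x (r x))"
  have "finite E1" using E(2) by (simp add: E1_def)
  then have B1: "compact B1" unfolding B1_def by (intro compact_UN) auto
  have "A1 \<subseteq> B1" unfolding A1_def B1_def by (intro UN_mono ball_subset_cball) simp
  then have clA1: "closure A1 \<subseteq> B1" using B1 by (simp add: closure_minimal compact_imp_closed)
  have B1W: "B1 \<subseteq> W" unfolding B1_def using r E(1) by (auto simp: E1_def)
  have B1z: "z \<in> C" if "z \<in> B1" "deriv \<phi> z = 0" for z
  proof -
    obtain x where x: "x \<in> E1" "z \<in> cball x (r x)" using \<open>z \<in> B1\<close> unfolding B1_def by blast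
    then have "z = x" using \<open>deriv \<phi> z = 0\<close> by (auto simp: E1_def)
    then show ?thesis using crit[of z] \<open>deriv \<phi> z = 0\<close> x(1) E(1) by (auto simp: E1_def)
  qed
  \<comment> \<open>Zeros of \<open>deriv \<phi>\<close> in \<open>B1\<close> belong to the finite
    set \<open>C\<close>, so they cannot fill a nonempty open set. This yields both the disjointness
    of \<open>A1\<close> and \<open>A2\<close> and the fact that \<phi> is nowhere locally constant
    on \<open>A1\<close>.\<close>
  have nowhere: False if N: "open N" "N \<noteq> {}" "N \<subseteq> A1" "\<And>z. z \<in> N \<Longrightarrow> deriv \<phi> z = 0" for N
  proof -
    have "N \<subseteq> C" using B1z N(3,4) \<open>A1 \<subseteq> B1\<close> by blast
    then show False using finite_imp_not_open[of N] N(1,2) C finite_subset by blast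
  qed
  have op: "open A1" "open A2" by (auto simp: A1_def A2_def)
  show ?thesis
  proof (rule that[of A1 A2])
    show "A1 \<inter> A2 = {}"
    proof (rule ccontr)
      assume "A1 \<inter> A2 \<noteq> {}"
      moreover have "deriv \<phi> z = 0" if "z \<in> A2" for z
      proof -
        from that obtain x where "x \<in> E2" "z \<in> ball x (r x)" unfolding A2_def by blast
        then show ?thesis using E2[of x] by simp
      qed
      ultimately show False using nowhere[of "A1 \<inter> A2"] op by auto
    qed
    show "X \<subseteq> A1 \<union> A2" using E(3) by (auto simp: A1_def A2_def E2_def)
    show "compact (closure A1)" using clA1 B1 by (meson bounded_subset closed_closure compact_eq_bounded_closed)
    show "closure A1 \<subseteq> W" using clA1 B1W by blast
    show "A2 \<subseteq> W" unfolding A2_def E2_def using r E(1) ball_subset_cball by blast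
    show "deriv \<phi> z \<noteq> 0" if "z \<in> closure A1 - C" for z using that clA1 B1z by blast
    show "\<not> (\<forall>\<^sub>F w in nhds c. \<phi> w = \<phi> c)" if c: "c \<in> A1" for c
    proof
      assume "\<forall>\<^sub>F w in nhds c. \<phi> w = \<phi> c"
      then obtain S where S: "open S" "c \<in> S" "\<And>w. w \<in> S \<Longrightarrow> \<phi> w = \<phi> c"
        unfolding eventually_nhds by blast
      have "deriv \<phi> w = 0" if "w \<in> S" for w
      proof -
        have "((\<lambda>_. \<phi> c) has_field_derivative 0) (at w)" by simp
        then have "(\<phi> has_field_derivative 0) (at w)"
          by (rule has_field_derivative_transform_within_open[OF _ S(1) that]) (rule S(3)[symmetric])
        then show ?thesis by (rule DERIV_imp_deriv)
      qed
      then show False using nowhere[of "S \<inter> A1"] S(1,2) c op by auto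
    qed
    show "\<exists>c\<in>C. \<exists>r>0. z \<in> ball c r \<and> ball c r \<subseteq> A2 \<and> (\<forall>w\<in>ball c r. \<phi> w = \<phi> c)" if "z \<in> A2" for z
    proof -
      from that obtain x where x: "x \<in> E2" "z \<in> ball x (r x)" unfolding A2_def by blast
      have xX: "x \<in> X" using x(1) E(1) by (auto simp: E2_def)
      have rx: "r x > 0" "cball x (r x) \<subseteq> W" using r[OF xX] by auto
      have "\<phi> w = \<phi> x" if w: "w \<in> ball x (r x)" for w
      proof -
        have "\<exists>k. \<forall>w\<in>ball x (r x). \<phi> w = k"
        proof (rule has_field_derivative_zero_constant)
          fix v assume v: "v \<in> ball x (r x)"
          then have "v \<in> W" "deriv \<phi> v = 0" using rx(2) E2[OF x(1)] ball_subset_cball by blast+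
          then have "(\<phi> has_field_derivative 0) (at v)" using holomorphic_derivI[OF \<phi>, of v] by simp
          then show "(\<phi> has_field_derivative 0) (at v within ball x (r x))" by (rule has_field_derivative_at_within)
        qed simp
        then show ?thesis using w rx(1) by (metis centre_in_ball)
      qed
      moreover have "x \<in> C" using crit[OF xX] E2[OF x(1)] rx(1) by simp
      moreover have "ball x (r x) \<subseteq> A2" using x(1) by (auto simp: A2_def)
      ultimately show ?thesis using x(2) rx(1) by blast
    qed
  qed (rule op)+
qed

text \<open>The neighbourhood \<open>A\<close> comes from \<phi> and is fixed before \<eta>, so a
  bump function and its derivative bounds can be attached to it before the tolerance is
  chosen.\<close>

lemma lift_perturbation:
  fixes F0 g0 \<phi> \<Psi> :: "complex \<Rightarrow> complex"
  assumes U: "open U" "F0 holomorphic_on U"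
    and W: "open W" "\<phi> holomorphic_on W" "g0 holomorphic_on W" "g0 ` W \<subseteq> U" "\<And>z. z \<in> W \<Longrightarrow> deriv g0 z \<noteq> 0"
    and V: "open V" "\<phi> ` W \<subseteq> V" "\<Psi> holomorphic_on V" "\<And>z. z \<in> V \<Longrightarrow> deriv \<Psi> z \<noteq> 0"
    and eq: "\<And>z. z \<in> W \<Longrightarrow> F0 (g0 z) = \<Psi> (\<phi> z)"
    and X: "compact X" "X \<subseteq> W" and C: "finite C" "C \<subseteq> X" "\<And>c. c \<in> C \<Longrightarrow> g0 c = c" 
    and crit: "\<And>z. z \<in> X \<Longrightarrow> deriv \<phi> z = 0 \<Longrightarrow> z \<in> C"
    and deg: "\<And>c. c \<in> C \<Longrightarrow> local_degree F0 c = local_degree \<phi> c"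
  obtains A where "open A" "X \<subseteq> A" "A \<subseteq> W"
    "\<And>\<eta>. \<eta> > 0 \<Longrightarrow> \<exists>\<delta>>0. \<forall>F \<Psi>'. F holomorphic_on U \<longrightarrow> \<Psi>' holomorphic_on V \<longrightarrow>
      (\<forall>z\<in>U. norm (F z - F0 z) \<le> \<delta>) \<longrightarrow> (\<forall>z\<in>V. norm (\<Psi>' z - \<Psi> z) \<le> \<delta>) \<longrightarrow>
      (\<forall>c\<in>C. F c = \<phi> c \<and> local_degree F c = local_degree \<phi> c \<and> \<Psi>' (\<phi> c) = \<phi> c) \<longrightarrow>
      (\<exists>g. g holomorphic_on A \<and> (\<forall>z\<in>A. F (g z) = \<Psi>' (\<phi> z) \<and> norm (g z - g0 z) < \<eta>) \<and> (\<forall>c\<in>C. g c = c))"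
proof -
  obtain A1 A2 where A: "open A1" "open A2" "A1 \<inter> A2 = {}" "X \<subseteq> A1 \<union> A2" "compact (closure A1)"
    "closure A1 \<subseteq> W" "A2 \<subseteq> W" and A1: "\<And>z. z \<in> closure A1 - C \<Longrightarrow> deriv \<phi> z \<noteq> 0"
    "\<And>c. c \<in> A1 \<Longrightarrow> \<not> (\<forall>\<^sub>F w in nhds c. \<phi> w = \<phi> c)"
    and A2: "\<And>z. z \<in> A2 \<Longrightarrow> \<exists>c\<in>C. \<exists>r>0. z \<in> ball c r \<and> ball c r \<subseteq> A2 \<and> (\<forall>w\<in>ball c r. \<phi> w = \<phi> c)"
    using adapted_neighbourhood[OF W(2,1) X C(1) crit] by metis
  have A1W: "A1 \<subseteq> W" using A(6) closure_subset by blast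
  define C1 where "C1 = C \<inter> A1"
  have "\<exists>d. local_degree \<phi> c = enat (Suc d) \<and>
      (\<forall>F. F holomorphic_on U \<longrightarrow> local_degree F c = local_degree \<phi> c \<longrightarrow>
        (\<lambda>w. F w - F c) \<in> O[nhds c](\<lambda>w. (w - c) ^ Suc d) \<and> (\<lambda>w. (w - c) ^ d) \<in> O[nhds c](deriv F)) \<and>
      (\<lambda>w. \<phi> w - \<phi> c) \<in> O[nhds c](\<lambda>w. (w - c) ^ Suc d)" if c: "c \<in> C1" for c
  proof -
    have cW: "c \<in> W" "c \<in> A1" "c \<in> C" using c A1W by (auto simp: C1_def)
    have cU: "c \<in> U" using W(4) C(3)[OF cW(3)] cW(1) by (metis image_subset_iff)
    obtain d where d: "local_degree \<phi> c = enat (Suc d)" "(\<lambda>w. \<phi> w - \<phi> c) \<in> O[nhds c](\<lambda>w. (w - c) ^ Suc d)"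
      using local_degree_finite[OF W(2,1) cW(1) A1(2)[OF cW(2)]] by metis
    have "(\<lambda>w. F w - F c) \<in> O[nhds c](\<lambda>w. (w - c) ^ Suc d) \<and> (\<lambda>w. (w - c) ^ d) \<in> O[nhds c](deriv F)"
      if F: "F holomorphic_on U" "local_degree F c = local_degree \<phi> c" for F
    proof -
      have "\<not> (\<forall>\<^sub>F w in nhds c. F w = F c)" using F(2) d(1) local_degree_infinite_iff[of F c] by auto
      then obtain d' where d': "local_degree F c = enat (Suc d')"
          "(\<lambda>w. F w - F c) \<in> O[nhds c](\<lambda>w. (w - c) ^ Suc d')" "(\<lambda>w. (w - c) ^ d') \<in> O[nhds c](deriv F)"
        using local_degree_finite[OF F(1) U(1) cU] by metis
      then have "d' = d" using F(2) d(1) by simp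
      then show ?thesis using d'(2,3) by simp
    qed
    then show ?thesis using d by blast
  qed
  then obtain d where d: "\<And>c F. c \<in> C1 \<Longrightarrow> F holomorphic_on U \<Longrightarrow> local_degree F c = local_degree \<phi> c \<Longrightarrow>
      (\<lambda>w. F w - F c) \<in> O[nhds c](\<lambda>w. (w - c) ^ Suc (d c)) \<and> (\<lambda>w. (w - c) ^ d c) \<in> O[nhds c](deriv F)"
    "\<And>c. c \<in> C1 \<Longrightarrow> (\<lambda>w. \<phi> w - \<phi> c) \<in> O[nhds c](\<lambda>w. (w - c) ^ Suc (d c))"
    by metis
  \<comment> \<open>Differentiating \<open>eq\<close> writes the derivative of F0 at
    \<open>g0 z\<close> times that of \<open>g0\<close> as a product of two nonzero factors.\<close>
  have nz: "deriv F0 (g0 z) \<noteq> 0" if z: "z \<in> closure A1 - C1" for z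
  proof -
    have zW: "z \<in> W" using z A(6) by blast
    \<comment> \<open>A marked point outside \<open>A1\<close> lies in the open set
      \<open>A2\<close>, which is disjoint from \<open>A1\<close> and hence from its
      closure.\<close>
    have "z \<notin> C"
    proof
      assume "z \<in> C"
      then have "z \<in> A2" using z C(2) A(4) by (auto simp: C1_def)
      moreover have "A2 \<inter> closure A1 = {}" using A(1-3) open_Int_closure_eq_empty[of A2 A1] by blast
      ultimately show False using z by blast
    qed
    then have p: "deriv \<phi> z \<noteq> 0" using A1(1) z by blast
    have d1: "(\<phi> has_field_derivative deriv \<phi> z) (at z)" using holomorphic_derivI[OF W(2,1) zW] .
    have "\<phi> z \<in> V" using zW V(2) by blast
    then have "(\<Psi> has_field_derivative deriv \<Psi> (\<phi> z)) (at (\<phi> z))" "deriv \<Psi> (\<phi> z) \<noteq> 0"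
      using holomorphic_derivI[OF V(3,1)] V(4) by auto
    from DERIV_chain2[OF this(1) d1] this(2)
    have l: "((\<lambda>z. \<Psi> (\<phi> z)) has_field_derivative deriv \<Psi> (\<phi> z) * deriv \<phi> z) (at z)" "deriv \<Psi> (\<phi> z) * deriv \<phi> z \<noteq> 0"
      using p by auto
    have "g0 z \<in> U" using zW W(4) by blast
    from DERIV_chain2[OF holomorphic_derivI[OF U(2,1) this] holomorphic_derivI[OF W(3,1) zW]]
    have "((\<lambda>z. \<Psi> (\<phi> z)) has_field_derivative deriv F0 (g0 z) * deriv g0 z) (at z)"
      by (rule has_field_derivative_transform_within_open[OF _ W(1) zW]) (rule eq)
    from DERIV_unique[OF this l(1)] l(2) show ?thesis by auto
  qed
  have im1: "g0 ` closure A1 \<subseteq> U" using A(6) W(4) by blast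
  show ?thesis
  proof (rule that[of "A1 \<union> A2"])
    fix \<eta> :: real assume "\<eta> > 0"
    have C1: "finite C1" "C1 \<subseteq> A1" "\<And>c. c \<in> C1 \<Longrightarrow> g0 c = c" "\<And>c. c \<in> C1 \<Longrightarrow> deriv g0 c \<noteq> 0"
      using C W(5) A1W by (auto simp: C1_def)
    have C1d: "(\<lambda>w. (w - c) ^ d c) \<in> O[nhds c](deriv F0)" if "c \<in> C1" for c
      using d(1)[OF that U(2)] deg that by (auto simp: C1_def)
    obtain \<delta> where \<delta>: "\<delta> > 0"
      "\<And>F h. F holomorphic_on U \<Longrightarrow> h holomorphic_on A1 \<Longrightarrow> (\<And>z. z \<in> U \<Longrightarrow> norm (F z - F0 z) \<le> \<delta>) \<Longrightarrow>
      (\<And>z. z \<in> A1 \<Longrightarrow> norm (h z - F0 (g0 z)) \<le> \<delta>) \<Longrightarrow>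
      (\<And>c. c \<in> C1 \<Longrightarrow> h c = F c \<and> (\<lambda>w. F w - F c) \<in> O[nhds c](\<lambda>w. (w - c) ^ Suc (d c)) \<and>
         (\<lambda>z. h z - h c) \<in> O[nhds c](\<lambda>w. (w - c) ^ Suc (d c))) \<Longrightarrow>
      \<exists>g. g holomorphic_on A1 \<and> (\<forall>z\<in>A1. g z \<in> U \<and> F (g z) = h z \<and> norm (g z - g0 z) < \<eta>) \<and> (\<forall>c\<in>C1. g c = c)"
      using perturbation_lemma[OF U A(1,5) W(1) A(6) W(3) im1 C1 nz C1d \<open>\<eta> > 0\<close>] by blast
    show "\<exists>\<delta>>0. \<forall>F \<Psi>'. F holomorphic_on U \<longrightarrow> \<Psi>' holomorphic_on V \<longrightarrow>
      (\<forall>z\<in>U. norm (F z - F0 z) \<le> \<delta>) \<longrightarrow> (\<forall>z\<in>V. norm (\<Psi>' z - \<Psi> z) \<le> \<delta>) \<longrightarrow>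
      (\<forall>c\<in>C. F c = \<phi> c \<and> local_degree F c = local_degree \<phi> c \<and> \<Psi>' (\<phi> c) = \<phi> c) \<longrightarrow>
      (\<exists>g. g holomorphic_on A1 \<union> A2 \<and> (\<forall>z\<in>A1 \<union> A2. F (g z) = \<Psi>' (\<phi> z) \<and> norm (g z - g0 z) < \<eta>) \<and> (\<forall>c\<in>C. g c = c))"
    proof (intro exI[of _ \<delta>] conjI allI impI \<delta>(1))
      fix F \<Psi>' assume F: "F holomorphic_on U" and \<Psi>': "\<Psi>' holomorphic_on V"
        and FF0: "\<forall>z\<in>U. norm (F z - F0 z) \<le> \<delta>" and \<Psi>\<Psi>: "\<forall>z\<in>V. norm (\<Psi>' z - \<Psi> z) \<le> \<delta>"
        and FC: "\<forall>c\<in>C. F c = \<phi> c \<and> local_degree F c = local_degree \<phi> c \<and> \<Psi>' (\<phi> c) = \<phi> c"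
      have "\<exists>g. g holomorphic_on A1 \<and> (\<forall>z\<in>A1. g z \<in> U \<and> F (g z) = \<Psi>' (\<phi> z) \<and> norm (g z - g0 z) < \<eta>) \<and> (\<forall>c\<in>C1. g c = c)"
      proof (rule \<delta>(2)[OF F])
        have "\<phi> ` A1 \<subseteq> V" using V(2) A1W by blast
        from holomorphic_on_compose_gen[OF holomorphic_on_subset[OF W(2) A1W] \<Psi>' this]
        show "(\<lambda>z. \<Psi>' (\<phi> z)) holomorphic_on A1" by (simp add: o_def)
        show "norm (\<Psi>' (\<phi> z) - F0 (g0 z)) \<le> \<delta>" if "z \<in> A1" for z
        proof -
          have "z \<in> W" "\<phi> z \<in> V" using that A1W V(2) by auto
          then show ?thesis using \<Psi>\<Psi> eq[of z] by simp
        qed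
        show "\<Psi>' (\<phi> c) = F c \<and> (\<lambda>w. F w - F c) \<in> O[nhds c](\<lambda>w. (w - c) ^ Suc (d c)) \<and>
          (\<lambda>z. \<Psi>' (\<phi> z) - \<Psi>' (\<phi> c)) \<in> O[nhds c](\<lambda>w. (w - c) ^ Suc (d c))" if c: "c \<in> C1" for c
        proof (intro conjI)
          have cC: "c \<in> C" "c \<in> W" using c A1W by (auto simp: C1_def)
          show "\<Psi>' (\<phi> c) = F c" using FC cC by auto
          show "(\<lambda>w. F w - F c) \<in> O[nhds c](\<lambda>w. (w - c) ^ Suc (d c))" using d(1)[OF c F] FC cC by blast
          have "\<phi> c \<in> V" using cC V(2) by blast
          then have "(\<lambda>w. \<Psi>' w - \<Psi>' (\<phi> c)) \<in> O[nhds (\<phi> c)](\<lambda>w. w - \<phi> c)"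
            by (intro difference_bigo(1)[OF holomorphic_derivI[OF \<Psi>' V(1)]])
          moreover have "filterlim \<phi> (nhds (\<phi> c)) (nhds c)"
            using isCont_filterlim_nhds[OF DERIV_isCont[OF holomorphic_derivI[OF W(2,1) cC(2)]]] .
          ultimately have "(\<lambda>z. \<Psi>' (\<phi> z) - \<Psi>' (\<phi> c)) \<in> O[nhds c](\<lambda>z. \<phi> z - \<phi> c)"
            by (rule landau_o.big.compose)
          also note d(2)[OF c]
          finally show "(\<lambda>z. \<Psi>' (\<phi> z) - \<Psi>' (\<phi> c)) \<in> O[nhds c](\<lambda>w. (w - c) ^ Suc (d c))" .
        qed
      qed (use FF0 in auto)
      then obtain g1 where g1: "g1 holomorphic_on A1" "\<And>z. z \<in> A1 \<Longrightarrow> F (g1 z) = \<Psi>' (\<phi> z) \<and> norm (g1 z - g0 z) < \<eta>"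
          "\<And>c. c \<in> C1 \<Longrightarrow> g1 c = c" by blast
      \<comment> \<open>On \<open>A2\<close> the old lift needs no change. There \<phi> is constant
        on a disc about a marked point \<open>c\<close>, so \<open>F\<close> has infinite degree at
        \<open>c\<close> and is constant near it; by analytic continuation \<open>F (g0 w)\<close>
        is constant on the whole disc, with the required value \<open>F c\<close>.\<close>
      define g where "g z = (if z \<in> A1 then g1 z else g0 z)" for z
      have "g holomorphic_on A1 \<union> A2"
      proof (rule holomorphic_on_Un)
        show "g holomorphic_on A1" by (rule holomorphic_transform[OF g1(1)]) (simp add: g_def)
        show "g holomorphic_on A2"
          by (rule holomorphic_transform[OF holomorphic_on_subset[OF W(3) A(7)]]) (use A(3) in \<open>auto simp: g_def\<close>)
      qed (use A in auto)
      moreover have "F (g z) = \<Psi>' (\<phi> z) \<and> norm (g z - g0 z) < \<eta>" if z: "z \<in> A1 \<union> A2" for z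
      proof (cases "z \<in> A1")
        case True
        then show ?thesis using g1(2) by (simp add: g_def)
      next
        case False
        then have "z \<in> A2" using z by blast
        from A2[OF this] obtain c r where c: "c \<in> C" "r > 0" "z \<in> ball c r" "ball c r \<subseteq> A2" "\<And>w. w \<in> ball c r \<Longrightarrow> \<phi> w = \<phi> c" by blast
        have "\<forall>\<^sub>F w in nhds c. w \<in> ball c r" using c(2) by (intro eventually_nhds_in_open) auto
        then have "\<forall>\<^sub>F w in nhds c. \<phi> w = \<phi> c" by (rule eventually_mono) (rule c(5))
        then have "local_degree \<phi> c = \<infinity>" by (simp add: local_degree_infinite_iff)
        then have "\<forall>\<^sub>F w in nhds c. F w = F c" using FC c(1) local_degree_infinite_iff[of F c] by auto
        moreover have cW: "ball c r \<subseteq> W" using c(4) A(7) by blast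
        have cW': "c \<in> W" using cW c(2) by auto
        have "filterlim g0 (nhds c) (nhds c)"
          using isCont_filterlim_nhds[OF DERIV_isCont[OF holomorphic_derivI[OF W(3,1) cW']]] C(3)[OF c(1)] by simp
        ultimately have "\<forall>\<^sub>F w in nhds c. F (g0 w) = F c" by (rule eventually_compose_filterlim)
        then obtain S where S: "open S" "c \<in> S" "\<And>w. w \<in> S \<Longrightarrow> F (g0 w) = F c" unfolding eventually_nhds by blast
        have "g0 ` ball c r \<subseteq> U" using W(4) cW by blast
        from holomorphic_on_compose_gen[OF holomorphic_on_subset[OF W(3) cW] F this]
        have "(\<lambda>w. F (g0 w)) holomorphic_on ball c r" by (simp add: o_def)
        then have "F (g0 z) = F c"
          by (rule analytic_continuation_open[of "S \<inter> ball c r" "ball c r" "\<lambda>w. F (g0 w)" "\<lambda>_. F c" z, rotated 5])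
            (use S c(1-4) in auto)
        moreover have "F c = \<Psi>' (\<phi> z)" using FC c(1) c(5)[OF c(3)] by simp
        moreover have "g z = g0 z" using False by (simp add: g_def)
        ultimately show ?thesis using \<open>\<eta> > 0\<close> by simp
      qed
      moreover have "g c = c" if "c \<in> C" for c using that g1(3) C(3) by (auto simp: g_def C1_def)
      ultimately show "\<exists>g. g holomorphic_on A1 \<union> A2 \<and> (\<forall>z\<in>A1 \<union> A2. F (g z) = \<Psi>' (\<phi> z) \<and> norm (g z - g0 z) < \<eta>) \<and> (\<forall>c\<in>C. g c = c)"
        by blast
    qed
  qed (use A A1W in auto)
qed

section \<open>Approximate conjugacies for finite triangles\<close>

text \<open>The margin \<open>(1/2) ^ j\<close> in the derivative bound is used up by the corrections made at the
  levels after \<open>j\<close>; the limit still differs from the identity by a contraction.\<close>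

definition shadowing_state ::
    "nonautonomous \<Rightarrow> triangle \<Rightarrow> nat \<Rightarrow> (nat \<Rightarrow> complex \<Rightarrow> complex) \<times> (nat \<Rightarrow> complex set) \<Rightarrow> bool" where
  "shadowing_state \<Phi> T j = (\<lambda>(\<Theta>, W).
     (\<forall>n. smooth_on (\<Theta> n) UNIV \<and> open (W n) \<and> space_at \<Phi> n \<subseteq> W n \<and> \<Theta> n holomorphic_on W n \<and>
        (\<forall>z\<in>marked_at \<Phi> n. \<Theta> n z = z) \<and>
        (\<forall>x v. norm (frechet_derivative (\<Theta> n) (at x) v - v) \<le> (1 - (1/2) ^ j) / 2 * norm v)) \<and>
     (\<forall>n\<ge>j. \<Theta> n = (\<lambda>z. z) \<and> W n = UNIV) \<and>
     (\<forall>n<j. W n \<subseteq> tri_dom T n \<and> (\<forall>z. z \<notin> tri_dom T n \<longrightarrow> \<Theta> n z = z) \<and>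
        (\<forall>z\<in>W n. map_at \<Phi> n z \<in> W (Suc n) \<and> tri_map T n j (\<Theta> n z) = \<Theta> (Suc n) (map_at \<Phi> n z))))"

text \<open>The bound holds for each order separately, not for the sum over the orders; the number
  of orders is paid for once, in the main proof.\<close>

definition close_to_order ::
    "nat \<Rightarrow> real \<Rightarrow> (complex \<Rightarrow> complex) \<Rightarrow> (complex \<Rightarrow> complex) \<Rightarrow> bool" where
  "close_to_order m b f g \<longleftrightarrow> (\<forall>vs x. length vs \<le> m \<longrightarrow> (\<forall>v\<in>set vs. norm v \<le> 1) \<longrightarrow>
     norm (higher_deriv (\<lambda>x. f x - g x) vs x) \<le> b)"

lemma close_to_order_frechet_bound:
  assumes "smooth_on f UNIV" "smooth_on g UNIV" "close_to_order m b f g" "1 \<le> m"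
    and q: "norm (frechet_derivative g (at x) v - v) \<le> q * norm v"
  shows "norm (frechet_derivative f (at x) v - v) \<le> (q + b) * norm v"
proof -
  have d: "f differentiable (at x)" "g differentiable (at x)"
    using assms(1,2) smooth_on_diffble by blast+
  have D: "frechet_derivative (\<lambda>x. f x - g x) (at x) = (\<lambda>v. frechet_derivative f (at x) v - frechet_derivative g (at x) v)"
    by (intro frechet_derivative_at[symmetric] has_derivative_diff has_frechet_derivative d)
  have lin: "linear (frechet_derivative (\<lambda>x. f x - g x) (at x))"
    by (intro linear_frechet_derivative differentiable_diff d)
  have "norm (higher_deriv (\<lambda>x. f x - g x) [sgn v] x) \<le> b"
    using assms(3,4) unfolding close_to_order_def by (auto simp: norm_sgn simp del: higher_deriv.simps)
  then have "norm (frechet_derivative (\<lambda>x. f x - g x) (at x) (sgn v)) \<le> b" by (simp add: higher_deriv_eqs)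
  moreover have "frechet_derivative (\<lambda>x. f x - g x) (at x) v = norm v *\<^sub>R frechet_derivative (\<lambda>x. f x - g x) (at x) (sgn v)"
    using linear_cmul[OF lin, of "norm v" "sgn v"] linear_0[OF lin]
    by (cases "v = 0") (simp_all add: sgn_div_norm)
  ultimately have "norm (frechet_derivative (\<lambda>x. f x - g x) (at x) v) \<le> norm v * b"
    by (simp add: mult_left_mono)
  then have "norm (frechet_derivative f (at x) v - frechet_derivative g (at x) v) \<le> norm v * b" by (simp add: D)
  moreover have "norm (frechet_derivative f (at x) v - v) \<le>
      norm (frechet_derivative f (at x) v - frechet_derivative g (at x) v) + norm (frechet_derivative g (at x) v - v)"
    by norm
  ultimately show ?thesis using q by (simp add: algebra_simps)
qed

lemma frechet_derivative_holomorphic: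
  assumes "f holomorphic_on S" "open S" "z \<in> S"
  shows "frechet_derivative f (at z) = (\<lambda>v. deriv f z * v)"
  using holomorphic_derivI[OF assms] by (simp add: has_field_derivative_def frechet_derivative_at[symmetric])

text \<open>A vanishing derivative would give 1 <= 1/2 in the direction v = 1.\<close>

lemma near_id_deriv_nonzero:
  assumes "f holomorphic_on S" "open S" "z \<in> S" "\<And>v. norm (frechet_derivative f (at z) v - v) \<le> norm v / 2"
  shows "deriv f z \<noteq> 0"
  using assms(4)[of 1] by (auto simp: frechet_derivative_holomorphic[OF assms(1-3)])

text \<open>If \<Theta> z were outside \<open>U\<close>, it would be a fixed point, and injectivity
  would force z = \<Theta> z. The lemma ensures that \<Theta> may be followed by a map defined on
  \<open>U\<close> only.\<close>

lemma near_id_maps_into: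
  fixes \<Theta> :: "complex \<Rightarrow> complex"
  assumes "smooth_on \<Theta> UNIV" "\<And>x v. norm (frechet_derivative \<Theta> (at x) v - v) \<le> norm v / 2"
    and "\<And>z. z \<notin> U \<Longrightarrow> \<Theta> z = z" "z \<in> U"
  shows "\<Theta> z \<in> U"
proof (rule ccontr)
  assume a: "\<Theta> z \<notin> U"
  have "inj \<Theta>" using diffeomorphism_perturbed_id[OF assms(1,2)] by (simp add: diffeomorphism_def bij_def)
  moreover have "\<Theta> (\<Theta> z) = \<Theta> z" using assms(3)[OF a] .
  ultimately have "\<Theta> z = z" by (simp add: inj_eq)
  then show False using a assms(4) by simp
qed

lemma nonautonomous_systemD:
  assumes "nonautonomous_system \<Phi>"
  shows "compact (space_at \<Phi> n)" "open (dom_at \<Phi> n)" "space_at \<Phi> n \<subseteq> dom_at \<Phi> n"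
    "map_at \<Phi> n holomorphic_on dom_at \<Phi> n" "map_at \<Phi> n ` space_at \<Phi> n \<subseteq> space_at \<Phi> (Suc n)"
    "finite (marked_at \<Phi> n)" "marked_at \<Phi> n \<subseteq> space_at \<Phi> n"
    "map_at \<Phi> n ` marked_at \<Phi> n \<subseteq> marked_at \<Phi> (Suc n)"
    "z \<in> space_at \<Phi> n \<Longrightarrow> deriv (map_at \<Phi> n) z = 0 \<Longrightarrow> z \<in> marked_at \<Phi> n"
  using assms unfolding nonautonomous_system_def critical_points_def by blast+

lemma finite_trianglesD:
  assumes "T \<in> finite_triangles \<Phi> k" "n < j" "j \<le> k"
  shows "open (tri_dom T n)" "space_at \<Phi> n \<subseteq> tri_dom T n" "tri_dom T n \<subseteq> dom_at \<Phi> n"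
    "tri_map T n j holomorphic_on tri_dom T n"
    "z \<in> marked_at \<Phi> n \<Longrightarrow> tri_map T n j z = map_at \<Phi> n z"
    "z \<in> marked_at \<Phi> n \<Longrightarrow> local_degree (tri_map T n j) z = local_degree (map_at \<Phi> n) z"
proof -
  have "tri_dom T n \<in> nbhds_at \<Phi> n"
    using assms unfolding finite_triangles_def by auto
  then show "open (tri_dom T n)" "space_at \<Phi> n \<subseteq> tri_dom T n" "tri_dom T n \<subseteq> dom_at \<Phi> n"
    by (auto simp: nbhds_at_def)
qed (use assms in \<open>unfold finite_triangles_def, blast+\<close>)

lemma open_holomorphic_preimage:
  assumes "f holomorphic_on D" "S \<subseteq> D" "open S" "open T"
  shows "open {z \<in> S. f z \<in> T}"
proof -
  have "continuous_on S f"
    by (rule continuous_on_subset[OF holomorphic_on_imp_continuous_on[OF assms(1)] assms(2)])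
  from continuous_open_preimage[OF this assms(3,4)] show ?thesis by (simp add: vimage_def Int_def)
qed

text \<open>The bound is obtained from \<open>T\<close>, \<open>U\<close> and the given state before
  the new maps into level j+1 are known; that is what the dependence of \<delta> in the theorem
  requires.\<close>

lemma shadowing_state_extend:
  assumes sys: "nonautonomous_system \<Phi>" and T: "T \<in> finite_triangles \<Phi> j" and U: "U \<in> nbhds_at \<Phi> j"
    and st: "shadowing_state \<Phi> T j (\<Theta>, W)" and \<epsilon>: "\<And>n. 0 < \<epsilon> n" "\<And>n. \<epsilon> n \<le> 1/2"
  shows "\<exists>\<delta>>0. \<forall>T'\<in>finite_triangles \<Phi> (Suc j). truncate_triangle j T' = T \<longrightarrow> tri_dom T' j = U \<longrightarrow>
    (\<forall>z\<in>U. norm (tri_map T' j (Suc j) z - map_at \<Phi> j z) < \<delta>) \<longrightarrow>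
    (\<forall>n<j. \<forall>z\<in>tri_dom T' n. norm (tri_map T' n (Suc j) z - tri_map T' n j z) < \<delta>) \<longrightarrow>
    (\<exists>\<Theta>' W'. shadowing_state \<Phi> T' (Suc j) (\<Theta>', W') \<and>
      (\<forall>n. close_to_order (M n + Suc j) (\<epsilon> n * (1/2) ^ Suc j) (\<Theta>' n) (\<Theta> n)))"
proof -
  note S = nonautonomous_systemD[OF sys]
  have \<Theta>: "smooth_on (\<Theta> n) UNIV" "open (W n)" "space_at \<Phi> n \<subseteq> W n" "\<Theta> n holomorphic_on W n"
    "\<And>z. z \<in> marked_at \<Phi> n \<Longrightarrow> \<Theta> n z = z"
    "\<And>x v. norm (frechet_derivative (\<Theta> n) (at x) v - v) \<le> (1 - (1/2) ^ j) / 2 * norm v" for n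
    using st by (auto simp: shadowing_state_def)
  have \<Theta>id: "\<Theta> n = (\<lambda>z. z)" "W n = UNIV" if "j \<le> n" for n
    using st that by (auto simp: shadowing_state_def)
  have \<Theta>lt: "W n \<subseteq> tri_dom T n" "\<And>z. z \<notin> tri_dom T n \<Longrightarrow> \<Theta> n z = z"
    "\<And>z. z \<in> W n \<Longrightarrow> map_at \<Phi> n z \<in> W (Suc n)"
    "\<And>z. z \<in> W n \<Longrightarrow> tri_map T n j (\<Theta> n z) = \<Theta> (Suc n) (map_at \<Phi> n z)" if "n < j" for n
    using st that by (auto simp: shadowing_state_def)
  have \<Theta>half: "norm (frechet_derivative (\<Theta> n) (at x) v - v) \<le> norm v / 2" for n x v
  proof -
    have "(1 - (1/2) ^ j) / 2 * norm v \<le> 1 / 2 * norm v" by (intro mult_right_mono) auto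
    then show ?thesis using \<Theta>(6)[of n x v] by simp
  qed
  have Uj: "open U" "space_at \<Phi> j \<subseteq> U" "U \<subseteq> dom_at \<Phi> j" using U by (auto simp: nbhds_at_def)
  \<comment> \<open>At the new index n = j the triangle \<open>T\<close> contains no map yet. The
    map of the system on \<open>U\<close> takes its place, with \<Theta> equal to the identity, so
    all indices up to \<open>j\<close> can be treated alike.\<close>
  define Uf where "Uf n = (if n < j then tri_dom T n else U)" for n
  define F0 where "F0 n = (if n < j then tri_map T n j else map_at \<Phi> n)" for n
  define V where "V n = (if n < j then W n else if n = j then U else UNIV)" for n
  have Uf: "open (Uf n)" "Uf n \<subseteq> dom_at \<Phi> n" "F0 n holomorphic_on Uf n"
    "\<And>c. c \<in> marked_at \<Phi> n \<Longrightarrow> local_degree (F0 n) c = local_degree (map_at \<Phi> n) c"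
    "\<And>z. z \<notin> Uf n \<Longrightarrow> \<Theta> n z = z" if n: "n \<le> j" for n
  proof -
    consider "n < j" | "n = j" using n by linarith
    then have "open (Uf n) \<and> Uf n \<subseteq> dom_at \<Phi> n \<and> F0 n holomorphic_on Uf n \<and>
      (\<forall>c\<in>marked_at \<Phi> n. local_degree (F0 n) c = local_degree (map_at \<Phi> n) c) \<and> (\<forall>z. z \<notin> Uf n \<longrightarrow> \<Theta> n z = z)"
    proof cases
      case 1
      then show ?thesis using finite_trianglesD[OF T 1 order_refl] \<Theta>lt(2)[OF 1] by (simp add: Uf_def F0_def)
    next
      case 2
      have "map_at \<Phi> j holomorphic_on U" using S(4) Uj(3) holomorphic_on_subset by blast
      then show ?thesis using 2 Uj \<Theta>id(1)[of j] by (simp add: Uf_def F0_def)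
    qed
    then show "open (Uf n)" "Uf n \<subseteq> dom_at \<Phi> n" "F0 n holomorphic_on Uf n"
      "\<And>c. c \<in> marked_at \<Phi> n \<Longrightarrow> local_degree (F0 n) c = local_degree (map_at \<Phi> n) c"
      "\<And>z. z \<notin> Uf n \<Longrightarrow> \<Theta> n z = z" by blast+
  qed
  have Vhol: "open (V n)" "\<Theta> n holomorphic_on V n" "space_at \<Phi> n \<subseteq> V n" for n
    using \<Theta>(2-4)[of n] \<Theta>id(1)[of n] Uj by (auto simp: V_def intro!: holomorphic_on_ident)
  have VU: "V n \<subseteq> Uf n" "\<And>z. z \<in> V n \<Longrightarrow> F0 n (\<Theta> n z) = \<Theta> (Suc n) (map_at \<Phi> n z)" if n: "n \<le> j" for n
    using \<Theta>lt[of n] \<Theta>id(1)[of n] \<Theta>id(1)[of "Suc n"] n by (cases "n < j"; auto simp: V_def Uf_def F0_def)+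
  \<comment> \<open>What the next triangle provides, stated for a bare family of maps: the induction
    over the index never sees a triangle.\<close>
  define adm where "adm F \<delta> \<longleftrightarrow> (\<forall>n\<le>j. F n holomorphic_on Uf n \<and>
      (\<forall>c\<in>marked_at \<Phi> n. F n c = map_at \<Phi> n c \<and> local_degree (F n) c = local_degree (map_at \<Phi> n) c) \<and>
      (\<forall>z\<in>Uf n. norm (F n z - F0 n z) \<le> \<delta>))" for F :: "nat \<Rightarrow> complex \<Rightarrow> complex" and \<delta> :: real
  define good where "good F N \<Theta>' n \<longleftrightarrow> smooth_on (\<Theta>' n) UNIV \<and> open (N n) \<and> space_at \<Phi> n \<subseteq> N n \<and>
      \<Theta>' n holomorphic_on N n \<and> (\<forall>c\<in>marked_at \<Phi> n. \<Theta>' n c = c) \<and>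
      close_to_order (M n + Suc j) (\<epsilon> n * (1/2) ^ Suc j) (\<Theta>' n) (\<Theta> n) \<and>
      (n \<le> j \<longrightarrow> N n \<subseteq> Uf n \<and> (\<forall>z. z \<notin> Uf n \<longrightarrow> \<Theta>' n z = z) \<and>
         (\<forall>z\<in>N n. map_at \<Phi> n z \<in> N (Suc n) \<and> F n (\<Theta>' n z) = \<Theta>' (Suc n) (map_at \<Phi> n z))) \<and>
      (j < n \<longrightarrow> \<Theta>' n = (\<lambda>z. z) \<and> N n = UNIV)"
    for F \<Theta>' :: "nat \<Rightarrow> complex \<Rightarrow> complex" and N :: "nat \<Rightarrow> complex set" and n
  \<comment> \<open>\<open>A\<close> and \<open>N\<close> precede \<eta> and \<open>F\<close>. The
    function \<open>g\<close> is the uncut lift on \<open>A\<close>, used for lifting at the next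
    lower index; \<Theta>' is its globally defined version, equal to \<open>g\<close> only on
    \<open>N m\<close>.\<close>
  define claim where "claim m \<longleftrightarrow> (\<exists>A N. open A \<and> space_at \<Phi> m \<subseteq> A \<and> A \<subseteq> V m \<and> open (N m) \<and> space_at \<Phi> m \<subseteq> N m \<and>
      (\<forall>\<eta>>0. \<exists>\<delta>>0. \<forall>F. adm F \<delta> \<longrightarrow>
        (\<exists>g \<Theta>'. g holomorphic_on A \<and> (\<forall>z\<in>A. norm (g z - \<Theta> m z) \<le> \<eta>) \<and> (\<forall>c\<in>marked_at \<Phi> m. g c = c) \<and>
           (\<forall>z\<in>N m. \<Theta>' m z = g z) \<and> (\<forall>n\<ge>m. good F N \<Theta>' n))))" for m
  have "claim 0"
  proof (rule inc_induct[of 0 "Suc j"])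
    have "good F (\<lambda>_. UNIV) (\<lambda>_ z. z) n" if "Suc j \<le> n" for F n
      using that \<Theta>id(1)[of n] less_imp_le[OF \<epsilon>(1)[of n]]
      by (auto simp: good_def close_to_order_def higher_deriv_zero intro!: smooth_on_id holomorphic_on_ident)
    moreover have "\<Theta> (Suc j) = (\<lambda>z. z)" "V (Suc j) = UNIV" using \<Theta>id(1)[of "Suc j"] by (auto simp: V_def)
    ultimately show "claim (Suc j)"
      unfolding claim_def
      by (intro exI[of _ UNIV] exI[of _ "\<lambda>_. UNIV"] conjI allI impI exI[of _ "1::real"] exI[of _ "\<lambda>z. z"] exI[of _ "\<lambda>_ z. z"])
        auto
  next
    fix m assume m: "m < Suc j" and "claim (Suc m)"
    then obtain A' N where A': "open A'" "space_at \<Phi> (Suc m) \<subseteq> A'" "A' \<subseteq> V (Suc m)" "open (N (Suc m))" "space_at \<Phi> (Suc m) \<subseteq> N (Suc m)"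
      and IH: "\<And>\<eta>. \<eta> > 0 \<Longrightarrow> \<exists>\<delta>>0. \<forall>F. adm F \<delta> \<longrightarrow>
        (\<exists>g \<Theta>'. g holomorphic_on A' \<and> (\<forall>z\<in>A'. norm (g z - \<Theta> (Suc m) z) \<le> \<eta>) \<and> (\<forall>c\<in>marked_at \<Phi> (Suc m). g c = c) \<and>
           (\<forall>z\<in>N (Suc m). \<Theta>' (Suc m) z = g z) \<and> (\<forall>n\<ge>Suc m. good F N \<Theta>' n))"
      unfolding claim_def by blast
    have mj: "m \<le> j" using m by simp
    have Vdom: "V m \<subseteq> dom_at \<Phi> m" using VU(1)[OF mj] Uf(2)[OF mj] by blast
    define W' where "W' = {z \<in> V m. map_at \<Phi> m z \<in> A'}"
    have W': "open W'" unfolding W'_def by (rule open_holomorphic_preimage[OF S(4) Vdom Vhol(1) A'(1)])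
    have XW': "space_at \<Phi> m \<subseteq> W'" using Vhol(3)[of m] A'(2) S(5)[of m] by (auto simp: W'_def)
    have W'V: "W' \<subseteq> V m" by (auto simp: W'_def)
    have Wim: "\<Theta> m ` W' \<subseteq> Uf m"
      using near_id_maps_into[OF \<Theta>(1) \<Theta>half Uf(5)[OF mj]] VU(1)[OF mj] W'V by blast
    have \<phi>W': "map_at \<Phi> m holomorphic_on W'" using S(4) Vdom W'V holomorphic_on_subset by blast
    have \<phi>im: "map_at \<Phi> m ` W' \<subseteq> A'" by (auto simp: W'_def)
    have \<Theta>W': "\<Theta> m holomorphic_on W'" using Vhol(2) W'V holomorphic_on_subset by blast
    have \<Theta>A': "\<Theta> (Suc m) holomorphic_on A'" using Vhol(2) A'(3) holomorphic_on_subset by blast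
    have dW': "deriv (\<Theta> m) z \<noteq> 0" if "z \<in> W'" for z
      using near_id_deriv_nonzero[OF \<Theta>W' W' that \<Theta>half] .
    have dA': "deriv (\<Theta> (Suc m)) z \<noteq> 0" if "z \<in> A'" for z
      using near_id_deriv_nonzero[OF \<Theta>A' A'(1) that \<Theta>half] .
    have eqW': "F0 m (\<Theta> m z) = \<Theta> (Suc m) (map_at \<Phi> m z)" if "z \<in> W'" for z
      using VU(2)[OF mj] W'V that by blast
    obtain A where A: "open A" "space_at \<Phi> m \<subseteq> A" "A \<subseteq> W'" and
      lift: "\<And>\<eta>. \<eta> > 0 \<Longrightarrow> \<exists>\<delta>>0. \<forall>F \<Psi>'. F holomorphic_on Uf m \<longrightarrow> \<Psi>' holomorphic_on A' \<longrightarrow>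
        (\<forall>z\<in>Uf m. norm (F z - F0 m z) \<le> \<delta>) \<longrightarrow> (\<forall>z\<in>A'. norm (\<Psi>' z - \<Theta> (Suc m) z) \<le> \<delta>) \<longrightarrow>
        (\<forall>c\<in>marked_at \<Phi> m. F c = map_at \<Phi> m c \<and> local_degree F c = local_degree (map_at \<Phi> m) c \<and> \<Psi>' (map_at \<Phi> m c) = map_at \<Phi> m c) \<longrightarrow>
        (\<exists>g. g holomorphic_on A \<and> (\<forall>z\<in>A. F (g z) = \<Psi>' (map_at \<Phi> m z) \<and> norm (g z - \<Theta> m z) < \<eta>) \<and> (\<forall>c\<in>marked_at \<Phi> m. g c = c))"
      by (rule lift_perturbation[OF Uf(1)[OF mj] Uf(3)[OF mj] W' \<phi>W' \<Theta>W' Wim dW' A'(1) \<phi>im \<Theta>A' dA' eqW'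
          S(1) XW' S(6,7) \<Theta>(5) S(9) Uf(4)[OF mj]], assumption+, rule that)
    \<comment> \<open>Points mapped into the set where the global map at index \<open>Suc m\<close>
      coincides with the uncut lift. Only there does the lifted equation become the equation between
      the global maps.\<close>
    define B where "B = {z \<in> A. map_at \<Phi> m z \<in> N (Suc m)}"
    have B: "open B" unfolding B_def
      by (rule open_holomorphic_preimage[OF S(4) _ A(1) A'(4)]) (use A(3) W'V Vdom in blast)
    have XB: "space_at \<Phi> m \<subseteq> B" using A(2) A'(5) S(5)[of m] by (auto simp: B_def)
    have BA: "B \<subseteq> A" by (auto simp: B_def)
    obtain \<psi> :: "complex \<Rightarrow> real" and L Nb where \<psi>: "smooth_on \<psi> UNIV" "open Nb" "space_at \<Phi> m \<subseteq> Nb" "\<And>z. z \<in> Nb \<Longrightarrow> \<psi> z = 1"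
      "compact L" "L \<subseteq> B" "\<And>z. z \<notin> L \<Longrightarrow> \<psi> z = 0"
      using bump_function_exists[OF S(1) B XB] by metis
    obtain a where a: "a > 0" "\<And>e \<eta> vs z. e holomorphic_on B \<Longrightarrow> (\<forall>z\<in>B. norm (e z) \<le> \<eta>) \<Longrightarrow> 0 \<le> \<eta> \<Longrightarrow>
        length vs \<le> M m + Suc j \<Longrightarrow> (\<forall>v\<in>set vs. norm v \<le> 1) \<Longrightarrow> norm (higher_deriv (cutoff B \<psi> e) vs z) \<le> a * \<eta>"
      using cutoff_higher_deriv_bound_upto[OF \<psi>(5,7,1) B \<psi>(6)] by metis
    define Nm where "Nm = Nb \<inter> B"
    show "claim m" unfolding claim_def
    proof (intro exI[of _ A] exI[of _ "N(m := Nm)"] conjI allI impI)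
      fix \<eta> :: real assume "\<eta> > 0"
      \<comment> \<open>The second entry keeps the cut-off correction, which costs the factor
        \<open>a\<close>, within the allowance of level j+1.\<close>
      define \<eta>' where "\<eta>' = min \<eta> (\<epsilon> m * (1/2) ^ Suc j / a)"
      have \<eta>': "\<eta>' > 0" "\<eta>' \<le> \<eta>" "a * \<eta>' \<le> \<epsilon> m * (1/2) ^ Suc j"
      proof -
        show "\<eta>' > 0" using \<open>\<eta> > 0\<close> a(1) \<epsilon>(1) by (simp add: \<eta>'_def)
        show "\<eta>' \<le> \<eta>" by (simp add: \<eta>'_def)
        have "\<eta>' \<le> \<epsilon> m * (1/2) ^ Suc j / a" by (simp add: \<eta>'_def)
        then show "a * \<eta>' \<le> \<epsilon> m * (1/2) ^ Suc j" using a(1) by (simp add: pos_le_divide_eq mult.commute del: power_Suc)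
      qed
      obtain \<delta>1 where \<delta>1: "\<delta>1 > 0" and lift1: "\<And>F \<Psi>'. F holomorphic_on Uf m \<Longrightarrow> \<Psi>' holomorphic_on A' \<Longrightarrow>
        (\<forall>z\<in>Uf m. norm (F z - F0 m z) \<le> \<delta>1) \<Longrightarrow> (\<forall>z\<in>A'. norm (\<Psi>' z - \<Theta> (Suc m) z) \<le> \<delta>1) \<Longrightarrow>
        (\<forall>c\<in>marked_at \<Phi> m. F c = map_at \<Phi> m c \<and> local_degree F c = local_degree (map_at \<Phi> m) c \<and> \<Psi>' (map_at \<Phi> m c) = map_at \<Phi> m c) \<Longrightarrow>
        (\<exists>g. g holomorphic_on A \<and> (\<forall>z\<in>A. F (g z) = \<Psi>' (map_at \<Phi> m z) \<and> norm (g z - \<Theta> m z) < \<eta>') \<and> (\<forall>c\<in>marked_at \<Phi> m. g c = c))"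
        using lift[OF \<eta>'(1)] by blast
      \<comment> \<open>The tolerance requested at index \<open>Suc m\<close> is the closeness
        \<open>\<delta>1\<close> that the lift at \<open>m\<close> demands of its right-hand
        side.\<close>
      obtain \<delta>2 where \<delta>2: "\<delta>2 > 0" and IH2: "\<And>F. adm F \<delta>2 \<Longrightarrow>
        (\<exists>g \<Theta>'. g holomorphic_on A' \<and> (\<forall>z\<in>A'. norm (g z - \<Theta> (Suc m) z) \<le> \<delta>1) \<and> (\<forall>c\<in>marked_at \<Phi> (Suc m). g c = c) \<and>
           (\<forall>z\<in>N (Suc m). \<Theta>' (Suc m) z = g z) \<and> (\<forall>n\<ge>Suc m. good F N \<Theta>' n))"
        using IH[OF \<delta>1] by blast
      show "\<exists>\<delta>>0. \<forall>F. adm F \<delta> \<longrightarrow>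
        (\<exists>g \<Theta>'. g holomorphic_on A \<and> (\<forall>z\<in>A. norm (g z - \<Theta> m z) \<le> \<eta>) \<and> (\<forall>c\<in>marked_at \<Phi> m. g c = c) \<and>
           (\<forall>z\<in>(N(m := Nm)) m. \<Theta>' m z = g z) \<and> (\<forall>n\<ge>m. good F (N(m := Nm)) \<Theta>' n))"
      proof (intro exI[of _ "min \<delta>1 \<delta>2"] conjI allI impI)
        show "min \<delta>1 \<delta>2 > 0" using \<delta>1 \<delta>2 by simp
        fix F assume "adm F (min \<delta>1 \<delta>2)"
        then have ad: "adm F \<delta>1" "adm F \<delta>2" unfolding adm_def by auto
        obtain g1 \<Theta>1 where g1: "g1 holomorphic_on A'" "\<forall>z\<in>A'. norm (g1 z - \<Theta> (Suc m) z) \<le> \<delta>1"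
          "\<forall>c\<in>marked_at \<Phi> (Suc m). g1 c = c" "\<And>z. z \<in> N (Suc m) \<Longrightarrow> \<Theta>1 (Suc m) z = g1 z" "\<And>n. n \<ge> Suc m \<Longrightarrow> good F N \<Theta>1 n"
          using IH2[OF ad(2)] by blast
        have "\<exists>g. g holomorphic_on A \<and> (\<forall>z\<in>A. F m (g z) = g1 (map_at \<Phi> m z) \<and> norm (g z - \<Theta> m z) < \<eta>') \<and> (\<forall>c\<in>marked_at \<Phi> m. g c = c)"
          by (rule lift1[OF _ g1(1) _ g1(2)]) (use ad(1) mj g1(3) S(8)[of m] in \<open>auto simp: adm_def\<close>)
        then obtain g where g: "g holomorphic_on A" "\<And>z. z \<in> A \<Longrightarrow> F m (g z) = g1 (map_at \<Phi> m z)"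
          "\<And>z. z \<in> A \<Longrightarrow> norm (g z - \<Theta> m z) < \<eta>'" "\<And>c. c \<in> marked_at \<Phi> m \<Longrightarrow> g c = c" by blast
        define e where "e z = g z - \<Theta> m z" for z
        have e: "e holomorphic_on B" unfolding e_def
          by (intro holomorphic_on_diff holomorphic_on_subset[OF g(1) BA]
              holomorphic_on_subset[OF \<Theta>W' subset_trans[OF BA A(3)]])
        have eb: "\<forall>z\<in>B. norm (e z) \<le> \<eta>'" using g(3) BA by (auto simp: e_def intro: less_imp_le)
        \<comment> \<open>Where the bump function is 1 this is \<Theta> + (g - \<Theta>) = g; off
          \<open>B\<close> it is the old map, which is the identity off \<open>Uf m\<close>.\<close>
        define \<Theta>2 where "\<Theta>2 = \<Theta>1(m := \<lambda>z. \<Theta> m z + cutoff B \<psi> e z)"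
        have \<Theta>2g: "\<Theta>2 m z = g z" if "z \<in> Nm" for z
          using that \<psi>(4)[of z] by (simp add: \<Theta>2_def Nm_def cutoff_def e_def)
        have NmA: "Nm \<subseteq> A" using BA by (auto simp: Nm_def)
        have XNm: "space_at \<Phi> m \<subseteq> Nm" using \<psi>(3) XB by (auto simp: Nm_def)
        have AU: "A \<subseteq> Uf m" using A(3) W'V VU(1)[OF mj] by blast
        have cut: "smooth_on (cutoff B \<psi> e) UNIV"
          by (rule smooth_on_cutoff[OF B \<psi>(5,6,1,7) smooth_on_holomorphic[OF B e]])
        have "good F (N(m := Nm)) \<Theta>2 m" unfolding good_def
        proof (intro conjI impI allI ballI)
          show "smooth_on (\<Theta>2 m) UNIV" unfolding \<Theta>2_def by (simp add: smooth_on_add[OF open_UNIV \<Theta>(1) cut])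
          show "open ((N(m := Nm)) m)" using B \<psi>(2) by (auto simp: Nm_def)
          show "space_at \<Phi> m \<subseteq> (N(m := Nm)) m" using XNm by simp
          show "\<Theta>2 m holomorphic_on (N(m := Nm)) m"
            using holomorphic_transform[OF holomorphic_on_subset[OF g(1) NmA]] \<Theta>2g by simp
          show "\<Theta>2 m c = c" if "c \<in> marked_at \<Phi> m" for c
            using \<Theta>2g[of c] g(4)[OF that] that S(7)[of m] XNm by auto
          show "close_to_order (M m + Suc j) (\<epsilon> m * (1/2) ^ Suc j) (\<Theta>2 m) (\<Theta> m)"
            unfolding close_to_order_def
          proof (intro allI impI)
            fix vs :: "complex list" and x assume vs: "length vs \<le> M m + Suc j" "\<forall>v\<in>set vs. norm v \<le> 1"
            have "(\<lambda>x. \<Theta>2 m x - \<Theta> m x) = cutoff B \<psi> e" by (simp add: \<Theta>2_def fun_eq_iff)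
            then show "norm (higher_deriv (\<lambda>x. \<Theta>2 m x - \<Theta> m x) vs x) \<le> \<epsilon> m * (1/2) ^ Suc j"
              using a(2)[OF e eb less_imp_le[OF \<eta>'(1)] vs] \<eta>'(3) by (metis order_trans)
          qed
          show "(N(m := Nm)) m \<subseteq> Uf m" using NmA AU by auto
          show "\<Theta>2 m z = z" if "z \<notin> Uf m" for z
          proof -
            have "z \<notin> B" using that BA AU by blast
            then show ?thesis using Uf(5)[OF mj that] by (simp add: \<Theta>2_def cutoff_def)
          qed
          show "map_at \<Phi> m z \<in> (N(m := Nm)) (Suc m)" if "z \<in> (N(m := Nm)) m" for z
            using that by (simp add: Nm_def B_def)
          show "F m (\<Theta>2 m z) = \<Theta>2 (Suc m) (map_at \<Phi> m z)" if "z \<in> (N(m := Nm)) m" for z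
          proof -
            have z: "z \<in> Nm" using that by simp
            have "F m (\<Theta>2 m z) = g1 (map_at \<Phi> m z)" using \<Theta>2g[OF z] g(2)[of z] NmA z by auto
            also have "\<dots> = \<Theta>1 (Suc m) (map_at \<Phi> m z)" using g1(4) z by (simp add: Nm_def B_def)
            finally show ?thesis by (simp add: \<Theta>2_def)
          qed
        qed (use mj in auto)
        moreover have "good F (N(m := Nm)) \<Theta>2 n" if "Suc m \<le> n" for n
          using g1(5)[OF that] that by (simp add: good_def \<Theta>2_def)
        ultimately have "\<forall>n\<ge>m. good F (N(m := Nm)) \<Theta>2 n" by (metis not_less_eq_eq order_antisym)
        moreover have "\<forall>z\<in>A. norm (g z - \<Theta> m z) \<le> \<eta>" using g(3) \<eta>'(2) by force
        ultimately show "\<exists>g \<Theta>'. g holomorphic_on A \<and> (\<forall>z\<in>A. norm (g z - \<Theta> m z) \<le> \<eta>) \<and> (\<forall>c\<in>marked_at \<Phi> m. g c = c) \<and>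
           (\<forall>z\<in>(N(m := Nm)) m. \<Theta>' m z = g z) \<and> (\<forall>n\<ge>m. good F (N(m := Nm)) \<Theta>' n)"
          using g(1,4) \<Theta>2g by (intro exI[of _ g] exI[of _ \<Theta>2]) simp
      qed
    next
      show "A \<subseteq> V m" using A(3) W'V by blast
      show "open ((N(m := Nm)) m)" using B \<psi>(2) by (auto simp: Nm_def)
      show "space_at \<Phi> m \<subseteq> (N(m := Nm)) m" using \<psi>(3) XB by (auto simp: Nm_def)
    qed (use A in auto)
  qed simp
  then obtain A N where "\<forall>\<eta>>0. \<exists>\<delta>>0. \<forall>F. adm F \<delta> \<longrightarrow>
        (\<exists>g \<Theta>'. g holomorphic_on A \<and> (\<forall>z\<in>A. norm (g z - \<Theta> 0 z) \<le> \<eta>) \<and> (\<forall>c\<in>marked_at \<Phi> 0. g c = c) \<and>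
           (\<forall>z\<in>N 0. \<Theta>' 0 z = g z) \<and> (\<forall>n\<ge>0. good F N \<Theta>' n))"
    unfolding claim_def by (elim exE conjE) (rule that)
  \<comment> \<open>The tolerance at index 0 may be anything, as the closeness that matters is
    already part of \<open>good\<close>.\<close>
  from this[rule_format, OF zero_less_one] obtain \<delta> where \<delta>: "\<delta> > 0" "\<forall>F. adm F \<delta> \<longrightarrow>
        (\<exists>g \<Theta>'. g holomorphic_on A \<and> (\<forall>z\<in>A. norm (g z - \<Theta> 0 z) \<le> 1) \<and> (\<forall>c\<in>marked_at \<Phi> 0. g c = c) \<and>
           (\<forall>z\<in>N 0. \<Theta>' 0 z = g z) \<and> (\<forall>n\<ge>0. good F N \<Theta>' n))"
    by (elim exE conjE) (rule that)
  have \<delta>_good: "\<exists>\<Theta>'. \<forall>n. good F N \<Theta>' n" if "adm F \<delta>" for F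
    using \<delta>(2)[rule_format, OF that] by auto
  show ?thesis
  proof (intro exI[of _ \<delta>] conjI ballI impI \<delta>(1))
    fix T' assume T': "T' \<in> finite_triangles \<Phi> (Suc j)" and tr: "truncate_triangle j T' = T" and dj: "tri_dom T' j = U"
      and c1: "\<forall>z\<in>U. norm (tri_map T' j (Suc j) z - map_at \<Phi> j z) < \<delta>"
      and c2: "\<forall>n<j. \<forall>z\<in>tri_dom T' n. norm (tri_map T' n (Suc j) z - tri_map T' n j z) < \<delta>"
    have dom: "tri_dom T' n = Uf n" if "n \<le> j" for n
    proof (cases "n < j")
      case True
      then show ?thesis using tr[symmetric] by (simp add: Uf_def truncate_triangle_def)
    next
      case False
      then have "n = j" using that by simp
      then show ?thesis using dj by (simp add: Uf_def)
    qed
    have old: "tri_map T' n j = F0 n" if "n < j" for n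
      using that tr[symmetric] by (simp add: F0_def truncate_triangle_def)
    define F where "F n = tri_map T' n (Suc j)" for n
    have "adm F \<delta>" unfolding adm_def
    proof (intro allI impI conjI ballI)
      fix n assume n: "n \<le> j"
      note D = finite_trianglesD[OF T' le_imp_less_Suc[OF n] order_refl]
      show "F n holomorphic_on Uf n" using D(4) dom[OF n] by (simp add: F_def)
      show "F n c = map_at \<Phi> n c" "local_degree (F n) c = local_degree (map_at \<Phi> n) c" if "c \<in> marked_at \<Phi> n" for c
        using D(5,6)[OF that] by (auto simp: F_def)
      show "norm (F n z - F0 n z) \<le> \<delta>" if z: "z \<in> Uf n" for z
      proof (cases "n < j")
        case True
        then have "norm (tri_map T' n (Suc j) z - tri_map T' n j z) < \<delta>" using c2 z dom[OF n] by simp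
        then show ?thesis using old[OF True] by (simp add: F_def)
      next
        case False
        then have "n = j" using n by simp
        then show ?thesis using c1 z by (auto simp: F_def F0_def Uf_def intro: less_imp_le)
      qed
    qed
    from \<delta>_good[OF this] obtain \<Theta>' where g: "\<And>n. good F N \<Theta>' n" by auto
    have cl: "close_to_order (M n + Suc j) (\<epsilon> n * (1/2) ^ Suc j) (\<Theta>' n) (\<Theta> n)" for n
      using g[of n] by (simp add: good_def)
    \<comment> \<open>The budget: (1 - 2^-j)/2 + (1/2) * 2^-(j+1) = (1 - 2^-(j+1))/2, which uses
      that \<epsilon> n is at most 1/2.\<close>
    have "norm (frechet_derivative (\<Theta>' n) (at x) v - v) \<le> (1 - (1/2) ^ Suc j) / 2 * norm v" for n x v
    proof -
      have "norm (frechet_derivative (\<Theta>' n) (at x) v - v) \<le> ((1 - (1/2) ^ j) / 2 + \<epsilon> n * (1/2) ^ Suc j) * norm v"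
        by (rule close_to_order_frechet_bound[OF _ \<Theta>(1) cl _ \<Theta>(6)]) (use g[of n] in \<open>auto simp: good_def\<close>)
      also have "\<dots> \<le> ((1 - (1/2) ^ j) / 2 + 1/2 * (1/2) ^ Suc j) * norm v"
        using \<epsilon>(2)[of n] by (intro mult_right_mono add_left_mono) auto
      also have "\<dots> = (1 - (1/2) ^ Suc j) / 2 * norm v" by (simp add: field_simps)
      finally show ?thesis .
    qed
    then have "shadowing_state \<Phi> T' (Suc j) (\<Theta>', N)"
      using g dom unfolding shadowing_state_def good_def F_def by (auto simp: less_Suc_eq_le Suc_le_eq)
    then show "\<exists>\<Theta>' W'. shadowing_state \<Phi> T' (Suc j) (\<Theta>', W') \<and>
      (\<forall>n. close_to_order (M n + Suc j) (\<epsilon> n * (1/2) ^ Suc j) (\<Theta>' n) (\<Theta> n))"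
      using cl by blast
  qed
qed

section \<open>Passing to the limit\<close>

definition shadowing_step ::
    "nonautonomous \<Rightarrow> (nat \<Rightarrow> real) \<Rightarrow> (nat \<Rightarrow> nat) \<Rightarrow> nat \<Rightarrow> triangle \<Rightarrow>
      (nat \<Rightarrow> complex \<Rightarrow> complex) \<times> (nat \<Rightarrow> complex set) \<Rightarrow>
      (nat \<Rightarrow> complex \<Rightarrow> complex) \<times> (nat \<Rightarrow> complex set) \<Rightarrow> bool" where
  "shadowing_step \<Phi> \<epsilon> M j T S S' \<longleftrightarrow> shadowing_state \<Phi> T (Suc j) S' \<and>
     (\<forall>n. close_to_order (M n + Suc j) (\<epsilon> n * (1/2) ^ Suc j) (fst S' n) (fst S n))"

text \<open>A state is selected from the finite triangle alone, with its predecessor taken at the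
  truncation. Thus it is available before any infinite triangle is given, and the states along one
  infinite triangle fit together.\<close>

primrec shadowing_states ::
    "nonautonomous \<Rightarrow> (nat \<Rightarrow> real) \<Rightarrow> (nat \<Rightarrow> nat) \<Rightarrow> nat \<Rightarrow> triangle \<Rightarrow>
      (nat \<Rightarrow> complex \<Rightarrow> complex) \<times> (nat \<Rightarrow> complex set)" where
  "shadowing_states \<Phi> \<epsilon> M 0 T = (\<lambda>_ z. z, \<lambda>_. UNIV)"
| "shadowing_states \<Phi> \<epsilon> M (Suc j) T =
     (SOME S'. shadowing_step \<Phi> \<epsilon> M j T (shadowing_states \<Phi> \<epsilon> M j (truncate_triangle j T)) S')"

lemma shadowing_state_0: "shadowing_state \<Phi> T 0 (\<lambda>_ z. z, \<lambda>_. UNIV)"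
proof -
  have "frechet_derivative (\<lambda>z. z) (at x) v = v" for x v :: complex
    by (simp add: frechet_derivative_at[OF has_derivative_ident, symmetric])
  then show ?thesis by (auto simp: shadowing_state_def intro!: smooth_on_id holomorphic_on_ident)
qed

lemma truncate_truncate: "i \<le> j \<Longrightarrow> truncate_triangle i (truncate_triangle j T) = truncate_triangle i T"
  by (auto simp: truncate_triangle_def fun_eq_iff)

text \<open>Needed for the limit of the conjugacy equation, where the map and the point at which it
  is evaluated both vary with \<open>j\<close>.\<close>

lemma tendsto_uniform_limit_at:
  fixes f :: "nat \<Rightarrow> complex \<Rightarrow> complex"
  assumes u: "uniform_limit U f g sequentially" and U: "open U" and c: "continuous_on U g"
    and w: "w \<longlonglongrightarrow> l" "l \<in> U"
  shows "(\<lambda>j. f j (w j)) \<longlonglongrightarrow> g l"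
proof -
  have inU: "\<forall>\<^sub>F j in sequentially. w j \<in> U" using topological_tendstoD[OF w(1) U w(2)] .
  have "(\<lambda>j. f j (w j) - g (w j)) \<longlonglongrightarrow> 0"
  proof (rule tendstoI)
    fix e :: real assume "e > 0"
    from uniform_limitD[OF u this] inU
    show "\<forall>\<^sub>F j in sequentially. dist (f j (w j) - g (w j)) 0 < e"
      by eventually_elim (simp add: dist_norm)
  qed
  moreover have "(\<lambda>j. g (w j)) \<longlonglongrightarrow> g l"
    using continuous_on_tendsto_compose[OF c w inU] .
  ultimately have "(\<lambda>j. (f j (w j) - g (w j)) + g (w j)) \<longlonglongrightarrow> 0 + g l" by (rule tendsto_add)
  then show ?thesis by simp
qed

lemma C_norm_on_le:
  assumes "\<And>vs x. length vs \<le> m \<Longrightarrow> (\<forall>v\<in>set vs. norm v \<le> 1) \<Longrightarrow> norm (higher_deriv f vs x) \<le> b" "0 \<le> b"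
  shows "C_norm_on m f S \<le> ennreal (of_nat (Suc m) * b)"
proof -
  have "deriv_norm k f x \<le> ennreal b" if "k \<le> m" for k x
    unfolding deriv_norm_def using assms(1) that by (intro SUP_least ennreal_leI) auto
  then have "C_norm_on m f S \<le> (\<Sum>k\<le>m. ennreal b)"
    unfolding C_norm_on_def by (intro sum_mono SUP_least) auto
  also have "\<dots> = ennreal (of_nat (Suc m) * b)"
    using assms(2) by (simp add: ennreal_mult'' ennreal_of_nat_eq_real_of_nat ennreal_mult)
  finally show ?thesis .
qed

text \<open>A real linear map that respects multiplication by \<i> at 1 is complex linear.\<close>

lemma cauchy_riemann_imp_field_derivative:
  assumes "cauchy_riemann_at f z"
  shows "(f has_field_derivative frechet_derivative f (at z) 1) (at z)"
proof -
  let ?L = "frechet_derivative f (at z)"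
  have d: "f differentiable (at z)" and i: "?L \<i> = \<i> * ?L 1"
    using assms by (auto simp: cauchy_riemann_at_def)
  have "?L v = ?L 1 * v" for v
  proof -
    have "?L v = of_real (Re v) * ?L 1 + of_real (Im v) * (\<i> * ?L 1)"
      using complex_linear_combination[OF linear_frechet_derivative[OF d], of v] i by (simp add: scaleR_conv_of_real)
    also have "\<dots> = (of_real (Re v) + \<i> * of_real (Im v)) * ?L 1" by (simp add: algebra_simps)
    finally show ?thesis by (simp add: complex_eq[symmetric] mult.commute)
  qed
  then have "?L = (*) (?L 1)" by (rule ext)
  then show ?thesis using has_frechet_derivative[OF d] by (simp add: has_field_derivative_def)
qed

theorem theorem4p4:
  fixes \<Phi> :: nonautonomous and \<epsilon> :: "nat \<Rightarrow> real" and M :: "nat \<Rightarrow> nat"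
  assumes "nonautonomous_system \<Phi>"
    and "\<And>n. 0 < \<epsilon> n"
  shows "\<exists>\<delta> :: nat \<Rightarrow> triangle \<Rightarrow> complex set \<Rightarrow> real.
    (\<forall>j\<ge>1. \<forall>T\<in>finite_triangles \<Phi> (j - 1). \<forall>U\<in>nbhds_at \<Phi> (j - 1). 0 < \<delta> j T U) \<and>
    (\<forall>T. infinite_triangle \<Phi> T \<and>
       (\<forall>j\<ge>1.
          (\<forall>z\<in>tri_dom T (j - 1).
             norm (tri_map T (j - 1) j z - map_at \<Phi> (j - 1) z)
               < \<delta> j (truncate_triangle (j - 1) T) (tri_dom T (j - 1))) \<and>
          (\<forall>n<j - 1. \<forall>z\<in>tri_dom T n.
             norm (tri_map T n j z - tri_map T n (j - 1) z)
               < \<delta> j (truncate_triangle (j - 1) T) (tri_dom T (j - 1)))) \<longrightarrow>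
       (\<exists>f :: nat \<Rightarrow> complex \<Rightarrow> complex.
          (\<forall>n. uniform_limit (tri_dom T n) (\<lambda>j. tri_map T n j) (f n) sequentially \<and>
               f n holomorphic_on tri_dom T n) \<and>
          (\<exists>\<Theta> :: nat \<Rightarrow> complex \<Rightarrow> complex.
             (\<forall>n. diffeomorphism (\<Theta> n)) \<and>
             (\<forall>n. \<forall>z\<in>space_at \<Phi> n. f n (\<Theta> n z) = \<Theta> (Suc n) (map_at \<Phi> n z)) \<and>
             (\<forall>n. C_norm_on (M n) (\<lambda>z. \<Theta> n z - z) (tri_dom T n) \<le> ennreal (\<epsilon> n)) \<and>
             (\<forall>n. \<forall>z. z \<notin> tri_dom T n \<or> z \<in> marked_at \<Phi> n \<longrightarrow> \<Theta> n z = z) \<and>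
             (\<forall>n. (\<forall>z\<in>space_at \<Phi> n. cauchy_riemann_at (\<Theta> n) z) \<and>
                  conformal_on (\<Theta> n) (interior (space_at \<Phi> n))))))"
proof -
  \<comment> \<open>The C^M norm sums M + 1 orders, hence the division; the minimum with 1/2 serves
    the derivative budget of \<open>shadowing_state_extend\<close>.\<close>
  define \<epsilon>' where "\<epsilon>' n = min (\<epsilon> n) (1/2) / of_nat (Suc (M n))" for n
  have \<epsilon>'_pos: "0 < \<epsilon>' n" for n
    using assms(2)[of n] by (simp add: \<epsilon>'_def del: of_nat_Suc)
  have \<epsilon>'_half: "\<epsilon>' n \<le> 1/2" for n
  proof -
    have "\<epsilon>' n \<le> min (\<epsilon> n) (1/2) / 1"
      unfolding \<epsilon>'_def using assms(2)[of n] by (intro divide_left_mono) auto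
    then show ?thesis by simp
  qed
  define st where "st = shadowing_states \<Phi> \<epsilon>' M"
  define ext where "ext j T U \<delta> \<longleftrightarrow> (0::real) < \<delta> \<and> (\<forall>T'\<in>finite_triangles \<Phi> (Suc j). truncate_triangle j T' = T \<longrightarrow> tri_dom T' j = U \<longrightarrow>
    (\<forall>z\<in>U. norm (tri_map T' j (Suc j) z - map_at \<Phi> j z) < \<delta>) \<longrightarrow>
    (\<forall>n<j. \<forall>z\<in>tri_dom T' n. norm (tri_map T' n (Suc j) z - tri_map T' n j z) < \<delta>) \<longrightarrow>
    (\<exists>S'. shadowing_step \<Phi> \<epsilon>' M j T' (st j T) S'))" for j T U \<delta>
  \<comment> \<open>The default 1 only secures positivity for all arguments. Along the given
    infinite triangle \<open>shadowing_state_extend\<close> guarantees that a suitable bound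
    exists.\<close>
  define \<delta>0 where "\<delta>0 j T U = (if \<exists>\<delta>. ext j T U \<delta> then SOME \<delta>. ext j T U \<delta> else 1)" for j T U
  have \<delta>0: "\<delta>0 j T U > 0" "(\<exists>\<delta>. ext j T U \<delta>) \<Longrightarrow> ext j T U (\<delta>0 j T U)" for j T U
  proof -
    show e: "ext j T U (\<delta>0 j T U)" if ex: "\<exists>\<delta>. ext j T U \<delta>"
      using someI_ex[OF ex] ex by (simp add: \<delta>0_def)
    show "\<delta>0 j T U > 0"
    proof (cases "\<exists>\<delta>. ext j T U \<delta>")
      case True
      from e[OF this] show ?thesis unfolding ext_def by blast
    qed (simp add: \<delta>0_def)
  qed
  \<comment> \<open>The theorem counts by the new level, \<open>\<delta>0\<close> by the old one.
    The geometric entry makes the maps of the triangle themselves converge uniformly.\<close>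
  define \<delta> where "\<delta> j T U = min (\<delta>0 (j - 1) T U) ((1/2) ^ j)" for j T U
  have \<delta>_pos: "\<delta> j T U > 0" for j T U using \<delta>0(1) by (simp add: \<delta>_def)
  show ?thesis
  proof (intro exI[of _ \<delta>] conjI allI ballI impI \<delta>_pos, elim conjE)
    fix T assume inf: "infinite_triangle \<Phi> T" and near: "\<forall>j\<ge>1.
          (\<forall>z\<in>tri_dom T (j - 1).
             norm (tri_map T (j - 1) j z - map_at \<Phi> (j - 1) z)
               < \<delta> j (truncate_triangle (j - 1) T) (tri_dom T (j - 1))) \<and>
          (\<forall>n<j - 1. \<forall>z\<in>tri_dom T n.
             norm (tri_map T n j z - tri_map T n (j - 1) z)
               < \<delta> j (truncate_triangle (j - 1) T) (tri_dom T (j - 1)))"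
    define Tr where "Tr k = truncate_triangle k T" for k
    have Tr: "Tr k \<in> finite_triangles \<Phi> k" for k using inf by (simp add: infinite_triangle_def Tr_def)
    have Trdom: "tri_dom (Tr k) n = tri_dom T n" if "n < k" for n k using that by (simp add: Tr_def truncate_triangle_def)
    have Trmap: "tri_map (Tr k) n j = tri_map T n j" if "n < j" "j \<le> k" for n j k
      using that by (simp add: Tr_def truncate_triangle_def)
    have dom: "open (tri_dom T n)" "space_at \<Phi> n \<subseteq> tri_dom T n" "tri_dom T n \<subseteq> dom_at \<Phi> n" for n
      using finite_trianglesD(1-3)[OF Tr[of "Suc n"] lessI order_refl] Trdom[of n "Suc n"] by simp_all
    have hol: "tri_map T n j holomorphic_on tri_dom T n" if "n < j" for n j
      using finite_trianglesD(4)[OF Tr[of j] that order_refl] Trdom[OF that] Trmap[OF that order_refl] by simp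
    have near1: "norm (tri_map T j (Suc j) z - map_at \<Phi> j z) < \<delta>0 j (Tr j) (tri_dom T j)" if "z \<in> tri_dom T j" for j z
    proof -
      have "norm (tri_map T j (Suc j) z - map_at \<Phi> j z) < \<delta> (Suc j) (Tr j) (tri_dom T j)"
        using near[rule_format, of "Suc j"] that by (simp add: Tr_def)
      then show ?thesis by (simp add: \<delta>_def)
    qed
    have near2: "norm (tri_map T n (Suc j) z - tri_map T n j z) < \<delta>0 j (Tr j) (tri_dom T j)"
        "norm (tri_map T n (Suc j) z - tri_map T n j z) < (1/2) ^ Suc j" if "n < j" "z \<in> tri_dom T n" for n j z
    proof -
      have "norm (tri_map T n (Suc j) z - tri_map T n j z) < \<delta> (Suc j) (Tr j) (tri_dom T j)"
        using near[rule_format, of "Suc j"] that by (simp add: Tr_def)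
      then show "norm (tri_map T n (Suc j) z - tri_map T n j z) < \<delta>0 j (Tr j) (tri_dom T j)"
        "norm (tri_map T n (Suc j) z - tri_map T n j z) < (1/2) ^ Suc j" by (simp_all add: \<delta>_def)
    qed
    define Z where "Z j = st j (Tr j)" for j
    have step: "shadowing_step \<Phi> \<epsilon>' M j (Tr (Suc j)) (Z j) (Z (Suc j))" if Zj: "shadowing_state \<Phi> (Tr j) j (Z j)" for j
    proof -
      have U: "tri_dom T j \<in> nbhds_at \<Phi> j" using dom by (simp add: nbhds_at_def)
      obtain \<Theta> W where ZW: "Z j = (\<Theta>, W)" by (cases "Z j")
      from shadowing_state_extend[OF assms(1) Tr[of j] U _ \<epsilon>'_pos \<epsilon>'_half, of \<Theta> W M] Zj
      have "\<exists>\<delta>. ext j (Tr j) (tri_dom T j) \<delta>"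
        unfolding ext_def shadowing_step_def Z_def[symmetric] ZW by simp
      from \<delta>0(2)[OF this] have "ext j (Tr j) (tri_dom T j) (\<delta>0 j (Tr j) (tri_dom T j))" .
      then have "\<exists>S'. shadowing_step \<Phi> \<epsilon>' M j (Tr (Suc j)) (st j (Tr j)) S'"
        unfolding ext_def
      proof (elim conjE, drule_tac bspec[OF _ Tr[of "Suc j"]], elim impE)
        show "truncate_triangle j (Tr (Suc j)) = Tr j" by (simp add: Tr_def truncate_truncate)
      qed (use near1 near2(1) in \<open>auto simp: Trdom Trmap\<close>)
      from someI_ex[OF this] show ?thesis
        by (simp add: Z_def st_def Tr_def truncate_truncate)
    qed
    have Zst: "shadowing_state \<Phi> (Tr j) j (Z j)" for j
    proof (induction j)
      case 0
      then show ?case using shadowing_state_0 by (simp add: Z_def st_def)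
    next
      case (Suc j)
      from step[OF this] show ?case by (simp add: shadowing_step_def)
    qed
    define \<theta> where "\<theta> j = fst (Z j)" for j
    define W where "W j = snd (Z j)" for j
    have Z\<theta>: "shadowing_state \<Phi> (Tr j) j (\<theta> j, W j)" for j using Zst by (simp add: \<theta>_def W_def)
    have \<theta>: "smooth_on (\<theta> j n) UNIV" "open (W j n)" "space_at \<Phi> n \<subseteq> W j n" "\<theta> j n holomorphic_on W j n"
      "\<And>z. z \<in> marked_at \<Phi> n \<Longrightarrow> \<theta> j n z = z"
      "\<And>x v. norm (frechet_derivative (\<theta> j n) (at x) v - v) \<le> (1 - (1/2) ^ j) / 2 * norm v" for j n
      using Z\<theta>[of j] by (auto simp: shadowing_state_def)
    have \<theta>id: "\<theta> j n = (\<lambda>z. z)" if "j \<le> n" for j n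
      using Z\<theta>[of j] that by (auto simp: shadowing_state_def)
    have \<theta>out: "\<theta> j n z = z" if "z \<notin> tri_dom T n" for j n z
      using Z\<theta>[of j] \<theta>id[of j n] that Trdom[of n j] by (cases "n < j") (auto simp: shadowing_state_def)
    have \<theta>eq: "tri_map T n j (\<theta> j n z) = \<theta> j (Suc n) (map_at \<Phi> n z)" if "n < j" "z \<in> space_at \<Phi> n" for j n z
    proof -
      have "z \<in> W j n" using \<theta>(3) that(2) by blast
      then have "tri_map (Tr j) n j (\<theta> j n z) = \<theta> j (Suc n) (map_at \<Phi> n z)"
        using Z\<theta>[of j] that(1) by (auto simp: shadowing_state_def)
      then show ?thesis by (simp add: Trmap[OF that(1) order_refl])
    qed
    have \<theta>close: "close_to_order (M n + Suc j) (\<epsilon>' n * (1/2) ^ Suc j) (\<theta> (Suc j) n) (\<theta> j n)" for j n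
      using step[OF Zst, of j] by (simp add: shadowing_step_def \<theta>_def)
    \<comment> \<open>The corrections of the first \<open>j\<close> levels form a geometric sum
      starting from the identity.\<close>
    have \<theta>total: "norm (higher_deriv (\<theta> j n) vs x - higher_deriv (\<lambda>z. z) vs x) \<le> \<epsilon>' n * (1 - (1/2) ^ j)"
      if vs: "length vs \<le> M n" "\<forall>v\<in>set vs. norm v \<le> 1" for j n vs x
    proof (induction j)
      case 0
      then show ?case using \<theta>id[of 0 n] by simp
    next
      case (Suc j)
      have "norm (higher_deriv (\<lambda>x. \<theta> (Suc j) n x - \<theta> j n x) vs x) \<le> \<epsilon>' n * (1/2) ^ Suc j"
        using \<theta>close[of n j] vs unfolding close_to_order_def by (simp del: power_Suc)
      then have "norm (higher_deriv (\<theta> (Suc j) n) vs x - higher_deriv (\<theta> j n) vs x) \<le> \<epsilon>' n * (1/2) ^ Suc j"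
        by (simp add: higher_deriv_diff \<theta>(1) del: power_Suc)
      from norm_triangle_le[OF add_mono[OF this Suc]]
      show ?case by (simp add: algebra_simps)
    qed
    have "\<exists>g. smooth_on g UNIV \<and> (\<forall>vs x. (\<lambda>j. higher_deriv (\<theta> j n) vs x) \<longlonglongrightarrow> higher_deriv g vs x)" for n
    \<comment> \<open>\<open>close_to_order\<close> reaches order \<open>M n + Suc j\<close>, which
      is (M n + 1) + j.\<close>
    proof (rule smooth_telescope[where m = "M n + 1" and b = "\<lambda>j. \<epsilon>' n * (1/2) ^ Suc j"])
      show "norm (higher_deriv (\<lambda>x. \<theta> (Suc j) n x - \<theta> j n x) vs x) \<le> \<epsilon>' n * (1/2) ^ Suc j"
        if "length vs \<le> M n + 1 + j" "\<forall>v\<in>set vs. norm v \<le> 1" for j vs x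
        using \<theta>close[of n j] that unfolding close_to_order_def by (simp del: power_Suc)
      show "summable (\<lambda>j. \<epsilon>' n * (1/2) ^ Suc j)"
        by (intro summable_mult) (simp add: summable_Suc_iff summable_geometric del: power_Suc)
    qed (rule \<theta>(1))
    then obtain \<Theta> where \<Theta>: "\<And>n. smooth_on (\<Theta> n) UNIV"
      "\<And>n vs x. (\<lambda>j. higher_deriv (\<theta> j n) vs x) \<longlonglongrightarrow> higher_deriv (\<Theta> n) vs x" by metis
    have lim: "(\<lambda>j. \<theta> j n z) \<longlonglongrightarrow> \<Theta> n z" for n z using \<Theta>(2)[of n "[]" z] by simp
    have dlim: "(\<lambda>j. frechet_derivative (\<theta> j n) (at z) v) \<longlonglongrightarrow> frechet_derivative (\<Theta> n) (at z) v" for n z v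
      using \<Theta>(2)[of n "[v]" z] by (simp add: higher_deriv_eqs)
    have half: "norm (frechet_derivative (\<Theta> n) (at x) v - v) \<le> norm v / 2" for n x v
    proof (rule tendsto_upperbound)
      show "(\<lambda>j. norm (frechet_derivative (\<theta> j n) (at x) v - v)) \<longlonglongrightarrow> norm (frechet_derivative (\<Theta> n) (at x) v - v)"
        by (intro tendsto_intros dlim)
      have "norm (frechet_derivative (\<theta> j n) (at x) v - v) \<le> norm v / 2" for j
      proof -
        have "(1 - (1/2) ^ j) / 2 * norm v \<le> 1 / 2 * norm v" by (intro mult_right_mono) auto
        then show ?thesis using \<theta>(6)[of j n x v] by simp
      qed
      then show "\<forall>\<^sub>F j in sequentially. norm (frechet_derivative (\<theta> j n) (at x) v - v) \<le> norm v / 2" by simp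
    qed simp
    have diffeo: "diffeomorphism (\<Theta> n)" for n by (rule diffeomorphism_perturbed_id[OF \<Theta>(1) half])
    have out: "\<Theta> n z = z" if "z \<notin> tri_dom T n \<or> z \<in> marked_at \<Phi> n" for n z
    proof -
      have "\<theta> j n z = z" for j using that \<theta>out \<theta>(5) by blast
      then show ?thesis using LIMSEQ_unique[OF lim, of n z z] by simp
    qed
    have "\<exists>f. uniform_limit (tri_dom T n) (tri_map T n) f sequentially" for n
    proof -
      have "uniformly_convergent_on (tri_dom T n) (tri_map T n)"
      proof (rule uniformly_convergent_on_telescope[where N = "Suc n" and b = "\<lambda>j. (1/2) ^ Suc j"])
        show "norm (tri_map T n (Suc i) x - tri_map T n i x) \<le> (1/2) ^ Suc i" if "Suc n \<le> i" "x \<in> tri_dom T n" for i x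
          using near2(2)[of n i x] that by (simp add: less_imp_le del: power_Suc)
        show "summable (\<lambda>j. (1/2) ^ Suc j :: real)" by (simp add: summable_Suc_iff summable_geometric del: power_Suc)
      qed
      then show ?thesis by (simp add: uniformly_convergent_on_def)
    qed
    then obtain f where f: "\<And>n. uniform_limit (tri_dom T n) (tri_map T n) (f n) sequentially" by metis
    have f_hol: "f n holomorphic_on tri_dom T n" for n
    \<comment> \<open>The shift by \<open>Suc n\<close> skips the entries with j at most n, which
      are not part of the triangle and need not be holomorphic.\<close>
    proof (rule holomorphic_uniform_sequence[where f = "\<lambda>i. tri_map T n (i + Suc n)"])
      show "open (tri_dom T n)" by (rule dom)
      show "tri_map T n (i + Suc n) holomorphic_on tri_dom T n" for i by (rule hol) simp
      have shifted: "uniform_limit (tri_dom T n) (\<lambda>i. tri_map T n (i + Suc n)) (f n) sequentially"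
        using f[of n] unfolding uniform_limit_iff by (subst eventually_sequentially_seg) 
      show "\<exists>d>0. cball x d \<subseteq> tri_dom T n \<and> uniform_limit (cball x d) (\<lambda>i. tri_map T n (i + Suc n)) (f n) sequentially"
        if "x \<in> tri_dom T n" for x
      proof -
        obtain d where "d > 0" "cball x d \<subseteq> tri_dom T n"
          using dom(1)[of n] \<open>x \<in> tri_dom T n\<close> open_contains_cball by blast
        then show ?thesis using uniform_limit_on_subset[OF shifted] by blast
      qed
    qed
    have conj: "f n (\<Theta> n z) = \<Theta> (Suc n) (map_at \<Phi> n z)" if z: "z \<in> space_at \<Phi> n" for n z
    proof (rule LIMSEQ_unique)
      have "z \<in> tri_dom T n" using dom(2) z by blast
      \<comment> \<open>The limit point must lie in the open set on which the maps converge
        uniformly; the injectivity of \<Theta> n keeps it there.\<close>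
      then have "\<Theta> n z \<in> tri_dom T n" by (intro near_id_maps_into[OF \<Theta>(1) half out]) auto
      then show "(\<lambda>j. tri_map T n j (\<theta> j n z)) \<longlonglongrightarrow> f n (\<Theta> n z)"
        by (intro tendsto_uniform_limit_at[OF f dom(1) _ lim] holomorphic_on_imp_continuous_on[OF f_hol])
      have "\<forall>\<^sub>F j in sequentially. \<theta> j (Suc n) (map_at \<Phi> n z) = tri_map T n j (\<theta> j n z)"
        using eventually_gt_at_top[of n] by eventually_elim (simp add: \<theta>eq z)
      then show "(\<lambda>j. tri_map T n j (\<theta> j n z)) \<longlonglongrightarrow> \<Theta> (Suc n) (map_at \<Phi> n z)"
        by (rule Lim_transform_eventually[OF lim])
    qed
    have norm: "C_norm_on (M n) (\<lambda>z. \<Theta> n z - z) (tri_dom T n) \<le> ennreal (\<epsilon> n)" for n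
    proof -
      have "norm (higher_deriv (\<lambda>z. \<Theta> n z - z) vs x) \<le> \<epsilon>' n"
        if vs: "length vs \<le> M n" "\<forall>v\<in>set vs. norm v \<le> 1" for vs x
      proof -
        have "norm (higher_deriv (\<Theta> n) vs x - higher_deriv (\<lambda>z. z) vs x) \<le> \<epsilon>' n"
        proof (rule tendsto_upperbound)
          show "(\<lambda>j. norm (higher_deriv (\<theta> j n) vs x - higher_deriv (\<lambda>z. z) vs x)) \<longlonglongrightarrow>
              norm (higher_deriv (\<Theta> n) vs x - higher_deriv (\<lambda>z. z) vs x)"
            by (intro tendsto_intros \<Theta>(2))
          have "\<epsilon>' n * (1 - (1/2) ^ j) \<le> \<epsilon>' n" for j
            using \<epsilon>'_pos[of n] by (simp add: mult_le_cancel_left1)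
          then show "\<forall>\<^sub>F j in sequentially. norm (higher_deriv (\<theta> j n) vs x - higher_deriv (\<lambda>z. z) vs x) \<le> \<epsilon>' n"
            using \<theta>total[OF vs, of _ x] by (intro always_eventually allI) (metis order_trans)
        qed simp
        then show ?thesis by (simp add: higher_deriv_diff[OF \<Theta>(1) smooth_on_id[OF open_UNIV]])
      qed
      then have "C_norm_on (M n) (\<lambda>z. \<Theta> n z - z) (tri_dom T n) \<le> ennreal (of_nat (Suc (M n)) * \<epsilon>' n)"
        using \<epsilon>'_pos[of n] by (intro C_norm_on_le) auto
      also have "of_nat (Suc (M n)) * \<epsilon>' n \<le> \<epsilon> n" by (simp add: \<epsilon>'_def del: of_nat_Suc)
      then have "ennreal (of_nat (Suc (M n)) * \<epsilon>' n) \<le> ennreal (\<epsilon> n)" by (rule ennreal_leI)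
      finally show ?thesis .
    qed
    have cr: "cauchy_riemann_at (\<Theta> n) z" if z: "z \<in> space_at \<Phi> n" for n z
      unfolding cauchy_riemann_at_def
    proof
      show "\<Theta> n differentiable (at z)" using smooth_on_diffble[OF \<Theta>(1)] by blast
      have "frechet_derivative (\<theta> j n) (at z) \<i> = \<i> * frechet_derivative (\<theta> j n) (at z) 1" for j
        using frechet_derivative_holomorphic[OF \<theta>(4,2)] \<theta>(3) z by (simp add: subset_iff)
      then have "(\<lambda>j. frechet_derivative (\<theta> j n) (at z) \<i>) \<longlonglongrightarrow> \<i> * frechet_derivative (\<Theta> n) (at z) 1"
        using tendsto_mult[OF tendsto_const dlim[of n z 1], of \<i>] by simp
      then show "frechet_derivative (\<Theta> n) (at z) \<i> = \<i> * frechet_derivative (\<Theta> n) (at z) 1"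
        using LIMSEQ_unique[OF dlim] by blast
    qed
    have conf: "conformal_on (\<Theta> n) (interior (space_at \<Phi> n))" for n
    proof -
      have int: "z \<in> space_at \<Phi> n" if "z \<in> interior (space_at \<Phi> n)" for z using that interior_subset by blast
      have h: "\<Theta> n holomorphic_on interior (space_at \<Phi> n)"
        using cauchy_riemann_imp_field_derivative[OF cr[OF int]] by (subst holomorphic_on_open) auto
      have "inj (\<Theta> n)" using diffeo by (simp add: diffeomorphism_def bij_def)
      then have "inj_on (\<Theta> n) (interior (space_at \<Phi> n))" by (rule inj_on_subset) simp
      then show ?thesis
        using h near_id_deriv_nonzero[OF h open_interior _ half] by (simp add: conformal_on_def)
    qed
    show "\<exists>f. (\<forall>n. uniform_limit (tri_dom T n) (\<lambda>j. tri_map T n j) (f n) sequentially \<and>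
               f n holomorphic_on tri_dom T n) \<and>
          (\<exists>\<Theta>. (\<forall>n. diffeomorphism (\<Theta> n)) \<and>
             (\<forall>n. \<forall>z\<in>space_at \<Phi> n. f n (\<Theta> n z) = \<Theta> (Suc n) (map_at \<Phi> n z)) \<and>
             (\<forall>n. C_norm_on (M n) (\<lambda>z. \<Theta> n z - z) (tri_dom T n) \<le> ennreal (\<epsilon> n)) \<and>
             (\<forall>n. \<forall>z. z \<notin> tri_dom T n \<or> z \<in> marked_at \<Phi> n \<longrightarrow> \<Theta> n z = z) \<and>
             (\<forall>n. (\<forall>z\<in>space_at \<Phi> n. cauchy_riemann_at (\<Theta> n) z) \<and>
                  conformal_on (\<Theta> n) (interior (space_at \<Phi> n))))"
      by (intro exI[of _ f] exI[of _ \<Theta>] conjI allI ballI impI f f_hol diffeo conj norm out cr conf)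
  qed
qed

end
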